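(* Let $\Omega\subset\mathbb{R}^N$, $N\ge 2$, be a region satisfying (B2), and let $e\in H_0(\Delta,\Omega)$ be a normalized Dirichlet eigenfunction of the Laplacian on $\Omega$ with eigenvalue $\lambda$, i.e. $\int_\Omega e^2\,dx=1$ and $$\int_\Omega[\nabla e\cdot\nabla v-\lambda\,e\,v]\,dx=0\qquad\text{for all } v\in H_0^1(\Omega).$$ Then $$\int_{\partial\Omega}|D_\nu e|^2\,d\sigma\le\frac{\|\mathbb{P}_He\|^2}{q_1}\,\lambda^2\le\frac{1}{q_1}\,\lambda^2,$$ where $\mathbb{P}_H$ is the Bergman harmonic projection, $\|\cdot\|$ is the $L^2(\Omega)$ norm, and $q_1$ is the smallest DBS eigenvalue on $\Omega$.
   Context: A region is a nonempty connected open subset of $\mathbb{R}^N$. All functions are real valued and derivatives are weak. (B1): $\Omega$ is bounded and $\partial\Omega$ is the union of a finite number of disjoint closed Lipschitz surfaces, each having finite surface area. $\sigma$ is $(N-1)$-dimensional Hausdorff measure on $\partial\Omega$, $\nu$ is the outward unit normal, $\gamma$ the boundary trace on $H^1(\Omega)$. $H_0(\Delta,\Omega)=\{u\in H_0^1(\Omega):\Delta u\in L^2(\Omega)\}$ ($\Delta$ the weak Laplacian), a Hilbert space with inner product $[u,v]_\Delta:=\int_\Omega\Delta u\,\Delta v\,dx$. For $u\in H_0(\Delta,\Omega)$, $D_\nu u\in L^2(\partial\Omega,d\sigma)$ is the normal derivative determined by $\int_{\partial\Omega}\gamma(v)D_\nu u\,d\sigma=\int_\Omega(\nabla u\cdot\nabla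 v+v\Delta u)\,dx$ for all $v\in H^1(\Omega)$. (B2): (B1) holds and $D_\nu$ is a compact mapping of $H_0(\Delta,\Omega)$ into $L^2(\partial\Omega,d\sigma)$. A DBS (Dirichlet Biharmonic Steklov) eigenvalue is a $q\in\mathbb{R}$ for which there is a non-zero $b\in H_0(\Delta,\Omega)$ with $\int_\Omega\Delta b\,\Delta v\,dx=q\int_{\partial\Omega}D_\nu b\,D_\nu v\,d\sigma$ for all $v\in H_0(\Delta,\Omega)$; all DBS eigenvalues are strictly positive and there is a smallest one, $q_1$. The Bergman harmonic projection $\mathbb{P}_H$ is the orthogonal projection of $L^2(\Omega)$ onto $L^2_H(\Omega)$, the space of all $u\in L^2(\Omega)$ with $\int_\Omega u\,\Delta v\,dx=0$ for all $v\in C_c^2(\Omega)$. *)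

theory Defs
  imports "HOL-Analysis.Analysis"
begin

text \<open>
  Elements of \<open>L\<^sup>2\<close> and of Sobolev spaces are represented by functions on the whole space; equality
  in these spaces is equality almost everywhere on \<open>\<Omega>\<close> (or on its boundary). Accordingly
  operators such as the weak gradient are given by a predicate \<open>is_...\<close>, saying
  that a function represents the value, together with a choice of one representative.
\<close>

definition L2 :: "'b measure \<Rightarrow> ('b \<Rightarrow> real) set" where
  "L2 M = {f. f \<in> borel_measurable M \<and> integrable M (\<lambda>x. (f x)\<^sup>2)}"

definition L2_norm :: "'b measure \<Rightarrow> ('b \<Rightarrow> real) \<Rightarrow> real" where
  "L2_norm M f = sqrt (\<integral>x. (f x)\<^sup>2 \<partial>M)"

definition region :: "'a::euclidean_space set \<Rightarrow> bool" where
  "region \<Omega> \<longleftrightarrow> \<Omega> \<noteq> {} \<and> open \<Omega> \<and> connected \<Omega>"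


subsection \<open>Test functions\<close>

definition partial :: "'a::euclidean_space \<Rightarrow> ('a \<Rightarrow> real) \<Rightarrow> 'a \<Rightarrow> real" where
  "partial i \<phi> x = frechet_derivative \<phi> (at x) i"

fun C_k :: "nat \<Rightarrow> ('a::euclidean_space \<Rightarrow> real) \<Rightarrow> bool" where
  "C_k 0 \<phi> \<longleftrightarrow> continuous_on UNIV \<phi>"
| "C_k (Suc k) \<phi> \<longleftrightarrow> \<phi> differentiable_on UNIV \<and> (\<forall>i\<in>Basis. C_k k (partial i \<phi>))"

definition C_c :: "nat \<Rightarrow> 'a::euclidean_space set \<Rightarrow> ('a \<Rightarrow> real) set" where
  "C_c k \<Omega> = {\<phi>. C_k k \<phi> \<and> compact (closure {x. \<phi> x \<noteq> 0}) \<and> closure {x. \<phi> x \<noteq> 0} \<subseteq> \<Omega>}"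

definition classical_laplacian :: "('a::euclidean_space \<Rightarrow> real) \<Rightarrow> 'a \<Rightarrow> real" where
  "classical_laplacian \<phi> x = (\<Sum>i\<in>Basis. partial i (partial i \<phi>) x)"


subsection \<open>Sobolev spaces\<close>

definition is_weak_gradient ::
    "'a::euclidean_space set \<Rightarrow> ('a \<Rightarrow> real) \<Rightarrow> ('a \<Rightarrow> 'a) \<Rightarrow> bool" where
  "is_weak_gradient \<Omega> u G \<longleftrightarrow>
     (\<forall>i\<in>Basis. (\<lambda>x. G x \<bullet> i) \<in> L2 (lebesgue_on \<Omega>) \<and>
       (\<forall>\<phi>\<in>C_c 1 \<Omega>. (\<integral>x. u x * partial i \<phi> x \<partial>lebesgue_on \<Omega>)
                    = - (\<integral>x. (G x \<bullet> i) * \<phi> x \<partial>lebesgue_on \<Omega>)))"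

definition H1 :: "'a::euclidean_space set \<Rightarrow> ('a \<Rightarrow> real) set" where
  "H1 \<Omega> = {u \<in> L2 (lebesgue_on \<Omega>). \<exists>G. is_weak_gradient \<Omega> u G}"

definition weak_gradient :: "'a::euclidean_space set \<Rightarrow> ('a \<Rightarrow> real) \<Rightarrow> 'a \<Rightarrow> 'a" where
  "weak_gradient \<Omega> u = (SOME G. is_weak_gradient \<Omega> u G)"

definition H1_norm :: "'a::euclidean_space set \<Rightarrow> ('a \<Rightarrow> real) \<Rightarrow> real" where
  "H1_norm \<Omega> u = sqrt ((\<integral>x. (u x)\<^sup>2 \<partial>lebesgue_on \<Omega>)
                     + (\<integral>x. (norm (weak_gradient \<Omega> u x))\<^sup>2 \<partial>lebesgue_on \<Omega>))"

definition H1_0 :: "'a::euclidean_space set \<Rightarrow> ('a \<Rightarrow> real) set" where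
  "H1_0 \<Omega> = {u \<in> H1 \<Omega>. \<exists>\<phi>. (\<forall>n. \<phi> n \<in> C_c 1 \<Omega>) \<and>
                (\<lambda>n::nat. H1_norm \<Omega> (\<lambda>x. \<phi> n x - u x)) \<longlonglongrightarrow> 0}"

definition is_weak_laplacian ::
    "'a::euclidean_space set \<Rightarrow> ('a \<Rightarrow> real) \<Rightarrow> ('a \<Rightarrow> real) \<Rightarrow> bool" where
  "is_weak_laplacian \<Omega> u f \<longleftrightarrow> f \<in> L2 (lebesgue_on \<Omega>) \<and>
     (\<forall>\<phi>\<in>C_c 2 \<Omega>. (\<integral>x. u x * classical_laplacian \<phi> x \<partial>lebesgue_on \<Omega>)
                  = (\<integral>x. f x * \<phi> x \<partial>lebesgue_on \<Omega>))"

definition weak_laplacian :: "'a::euclidean_space set \<Rightarrow> ('a \<Rightarrow> real) \<Rightarrow> 'a \<Rightarrow> real" where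
  "weak_laplacian \<Omega> u = (SOME f. is_weak_laplacian \<Omega> u f)"

definition H_0_Laplace :: "'a::euclidean_space set \<Rightarrow> ('a \<Rightarrow> real) set" where
  "H_0_Laplace \<Omega> = {u \<in> H1_0 \<Omega>. \<exists>f. is_weak_laplacian \<Omega> u f}"


subsection \<open>Hausdorff measure and the boundary condition (B1)\<close>

text \<open>
  The normalisation makes the \<open>s\<close>-dimensional measure agree with Lebesgue measure for integral \<open>s\<close>.
  The covering sets are required to be bounded because \<^const>\<open>diameter\<close> is unspecified on unbounded
  sets. The definition is meant for \<open>s > 0\<close> only (\<open>0 powr 0 = 0\<close>).
\<close>

definition hausdorff_premeasure :: "real \<Rightarrow> real \<Rightarrow> 'a::euclidean_space set \<Rightarrow> ennreal" where
  "hausdorff_premeasure s \<delta> A =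
     (INF C \<in> {C :: nat \<Rightarrow> 'a set. A \<subseteq> (\<Union>i. C i) \<and> (\<forall>i. bounded (C i) \<and> diameter (C i) \<le> \<delta>)}.
        \<Sum>i. ennreal (unit_ball_vol s * (diameter (C i) / 2) powr s))"

definition hausdorff_outer_measure :: "real \<Rightarrow> 'a::euclidean_space set \<Rightarrow> ennreal" where
  "hausdorff_outer_measure s A = (SUP \<delta>\<in>{0<..}. hausdorff_premeasure s \<delta> A)"

text \<open>
  The outer measure is a metric outer measure, hence countably additive on the Borel sets.
\<close>

definition hausdorff_measure :: "real \<Rightarrow> 'a::euclidean_space measure" where
  "hausdorff_measure s = measure_of UNIV (sets borel) (hausdorff_outer_measure s)"

definition surface_measure :: "'a::euclidean_space set \<Rightarrow> 'a measure" where
  "surface_measure \<Omega> = restrict_space (hausdorff_measure (real (DIM('a) - 1))) (frontier \<Omega>)"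

text \<open>
  Near each of its points the surface is the graph of a Lipschitz function over a hyperplane; the
  point \<open>x - (x \<bullet> n) n\<close> is the projection of \<open>x\<close> to the hyperplane orthogonal to the unit vector \<open>n\<close>.
\<close>

definition closed_lipschitz_surface :: "'a::euclidean_space set \<Rightarrow> bool" where
  "closed_lipschitz_surface S \<longleftrightarrow> S \<noteq> {} \<and> compact S \<and> connected S \<and>
     (\<forall>z\<in>S. \<exists>U n (h :: 'a \<Rightarrow> real) L. open U \<and> z \<in> U \<and> norm n = 1 \<and> L-lipschitz_on UNIV h \<and>
        S \<inter> U = {x \<in> U. x \<bullet> n = h (x - (x \<bullet> n) *\<^sub>R n)})"

definition B1 :: "'a::euclidean_space set \<Rightarrow> bool" where
  "B1 \<Omega> \<longleftrightarrow> bounded \<Omega> \<and>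
     (\<exists>\<S>. finite \<S> \<and> disjoint \<S> \<and> \<Union>\<S> = frontier \<Omega> \<and>
        (\<forall>S\<in>\<S>. closed_lipschitz_surface S \<and>
                emeasure (hausdorff_measure (real (DIM('a) - 1))) S < \<infinity>))"


subsection \<open>Boundary trace and normal derivative\<close>

text \<open>
  The boundary trace is the continuous extension to \<open>H1 \<Omega>\<close> of the restriction map from \<open>C\<^sup>1\<close> functions
  on the closure of \<open>\<Omega>\<close>; \<open>is_trace \<Omega> v g\<close> says that \<open>g\<close> represents the trace of \<open>v\<close>.
\<close>

definition is_trace ::
    "'a::euclidean_space set \<Rightarrow> ('a \<Rightarrow> real) \<Rightarrow> ('a \<Rightarrow> real) \<Rightarrow> bool" where
  "is_trace \<Omega> v g \<longleftrightarrow> v \<in> H1 \<Omega> \<and> g \<in> L2 (surface_measure \<Omega>) \<and>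
     (\<exists>\<phi>. (\<forall>n::nat. C_k 1 (\<phi> n)) \<and>
          (\<lambda>n. H1_norm \<Omega> (\<lambda>x. \<phi> n x - v x)) \<longlonglongrightarrow> 0 \<and>
          (\<lambda>n. L2_norm (surface_measure \<Omega>) (\<lambda>x. \<phi> n x - g x)) \<longlonglongrightarrow> 0)"

definition is_normal_derivative ::
    "'a::euclidean_space set \<Rightarrow> ('a \<Rightarrow> real) \<Rightarrow> ('a \<Rightarrow> real) \<Rightarrow> bool" where
  "is_normal_derivative \<Omega> u d \<longleftrightarrow> d \<in> L2 (surface_measure \<Omega>) \<and>
     (\<forall>v\<in>H1 \<Omega>. \<forall>g. is_trace \<Omega> v g \<longrightarrow>
        (\<integral>x. g x * d x \<partial>surface_measure \<Omega>)
          = (\<integral>x. (weak_gradient \<Omega> u x \<bullet> weak_gradient \<Omega> v x + v x * weak_laplacian \<Omega> u x)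
               \<partial>lebesgue_on \<Omega>))"

definition normal_derivative :: "'a::euclidean_space set \<Rightarrow> ('a \<Rightarrow> real) \<Rightarrow> 'a \<Rightarrow> real" where
  "normal_derivative \<Omega> u = (SOME d. is_normal_derivative \<Omega> u d)"

text \<open>
  In (B2) the existence part makes the normal derivative a map into \<open>L\<^sup>2\<close> of the boundary. Its
  compactness refers to the norm \<open>\<parallel>\<Delta>u\<parallel>\<close> of \<^const>\<open>H_0_Laplace\<close>.
\<close>

definition B2 :: "'a::euclidean_space set \<Rightarrow> bool" where
  "B2 \<Omega> \<longleftrightarrow> B1 \<Omega> \<and>
     (\<forall>u\<in>H_0_Laplace \<Omega>. \<exists>d. is_normal_derivative \<Omega> u d) \<and>
     (\<forall>u K. (\<forall>n::nat. u n \<in> H_0_Laplace \<Omega> \<and>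
                       L2_norm (lebesgue_on \<Omega>) (weak_laplacian \<Omega> (u n)) \<le> K) \<longrightarrow>
        (\<exists>r g. strict_mono (r :: nat \<Rightarrow> nat) \<and> g \<in> L2 (surface_measure \<Omega>) \<and>
           (\<lambda>n. L2_norm (surface_measure \<Omega>)
                   (\<lambda>x. normal_derivative \<Omega> (u (r n)) x - g x)) \<longlonglongrightarrow> 0))"


subsection \<open>DBS eigenvalues and the Bergman harmonic projection\<close>

definition DBS_eigenvalue :: "'a::euclidean_space set \<Rightarrow> real \<Rightarrow> bool" where
  "DBS_eigenvalue \<Omega> q \<longleftrightarrow>
     (\<exists>b\<in>H_0_Laplace \<Omega>. \<not> (AE x in lebesgue_on \<Omega>. b x = 0) \<and>
        (\<forall>v\<in>H_0_Laplace \<Omega>.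
           (\<integral>x. weak_laplacian \<Omega> b x * weak_laplacian \<Omega> v x \<partial>lebesgue_on \<Omega>)
             = q * (\<integral>x. normal_derivative \<Omega> b x * normal_derivative \<Omega> v x \<partial>surface_measure \<Omega>)))"

definition first_DBS_eigenvalue :: "'a::euclidean_space set \<Rightarrow> real" where
  "first_DBS_eigenvalue \<Omega> = (LEAST q. DBS_eigenvalue \<Omega> q)"

definition L2_harmonic :: "'a::euclidean_space set \<Rightarrow> ('a \<Rightarrow> real) set" where
  "L2_harmonic \<Omega> = {u \<in> L2 (lebesgue_on \<Omega>).
     \<forall>\<phi>\<in>C_c 2 \<Omega>. (\<integral>x. u x * classical_laplacian \<phi> x \<partial>lebesgue_on \<Omega>) = 0}"

definition bergman_projection ::
    "'a::euclidean_space set \<Rightarrow> ('a \<Rightarrow> real) \<Rightarrow> 'a \<Rightarrow> real" where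
  "bergman_projection \<Omega> f = (SOME p. p \<in> L2_harmonic \<Omega> \<and>
     (\<forall>h\<in>L2_harmonic \<Omega>. (\<integral>x. (f x - p x) * h x \<partial>lebesgue_on \<Omega>) = 0))"

end

theory Submission
  imports Defs
begin

text \<open>
  Why the estimate holds. Write \<open>[u,v]\<close> for the inner product \<open>\<integral> \<Delta>u \<Delta>v\<close> of \<open>H\<^sub>0(\<Delta>,\<Omega>)\<close> and \<open>D\<close> for the
  normal derivative. The reciprocal of \<open>q\<^sub>1\<close> is the best constant \<open>M\<close> in \<open>\<parallel>D u\<parallel>\<^sup>2 \<le> M [u,u]\<close>: because \<open>D\<close> is
  compact, the supremum of \<open>\<parallel>D u\<parallel>\<^sup>2\<close> over the unit ball is attained at some \<open>b\<close>, the first variation at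
  \<open>b\<close> is the eigenvalue equation with \<open>q = 1/M\<close>, and testing the equation of any other eigenvalue \<open>q\<close> with
  its own eigenfunction gives \<open>q \<ge> 1/M\<close> (\<open>compact_form_maximiser\<close>, \<open>first_DBS_eigenvalue\<close>).

  The normal derivative of \<open>u\<close> depends only on the harmonic part of \<open>\<Delta>u\<close>: subtract from \<open>\<Delta>u\<close> its
  projection to the closure of \<open>{\<Delta>z | D z = 0}\<close>. This does not change \<open>D u\<close>, and the remainder \<open>f\<close> is
  orthogonal to \<open>\<Delta>\<phi>\<close> for all test functions \<open>\<phi>\<close>, so it is harmonic, and \<open>\<parallel>f\<parallel> \<le> \<parallel>P\<^sub>H \<Delta>u\<parallel>\<close>. Hence
  \<open>q\<^sub>1 \<parallel>D u\<parallel>\<^sup>2 \<le> \<parallel>P\<^sub>H \<Delta>u\<parallel>\<^sup>2\<close> (\<open>normal_derivative_le_harmonic_part\<close>). For the eigenfunction \<open>\<Delta>e = - \<lambda> e\<close>, which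
  gives the first inequality; the second one says that a projection does not increase the norm.

  Four analytic facts support this. (1) The weak gradient, the weak Laplacian and the normal derivative
  are unique, hence linear, almost everywhere. All three follow from one principle: an integrable
  function with compact support whose integrals against all exponentials \<open>exp (k \<bullet> x)\<close> vanish is zero,
  by the Stone--Weierstrass theorem (\<open>exp_integrals_determine\<close>). (2) The Poincare inequality, which
  is integration by parts against a coordinate function. (3) Green's formula
  \<open>\<integral> \<nabla>u \<bullet> \<nabla>v = - \<integral> v \<Delta>u\<close> for \<open>v \<in> H\<^sub>0\<^sup>1\<close>: such a \<open>v\<close> has trace zero, so this is the defining identity of
  \<open>D u\<close>. Together with (2) it bounds the norm of \<open>H\<^sup>1\<close> by \<open>\<parallel>\<Delta>u\<parallel>\<close> and makes \<open>H\<^sub>0(\<Delta>,\<Omega>)\<close> complete. (4) The normal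
  derivative of an eigenfunction is not zero, so that \<open>M > 0\<close> and an eigenvalue \<open>q\<^sub>1\<close> exists: if
  \<open>D e = 0\<close>, then testing with \<open>v = exp (k \<bullet> x)\<close> gives \<open>(|k|\<^sup>2 + \<lambda>) \<integral> e v = 0\<close> for all \<open>k\<close>, and \<open>\<lambda> > 0\<close>, so that
  \<open>e = 0\<close> by (1) (\<open>Dirichlet_eigenfunction\<close>).
\<close>

section \<open>Semi-inner products on spaces of functions\<close>

text \<open>
  The spaces in question consist of functions rather than of classes modulo equality almost
  everywhere, and on them the forms are semidefinite: a function that is zero almost everywhere has norm
  zero. The Hilbert space arguments are therefore stated for semi-inner products on sets of functions.
\<close>

locale function_space =
  fixes V :: "('a \<Rightarrow> real) set"
  assumes zero_mem: "(\<lambda>x. 0) \<in> V"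
    and add_mem: "f \<in> V \<Longrightarrow> g \<in> V \<Longrightarrow> (\<lambda>x. f x + g x) \<in> V"
    and scale_mem: "f \<in> V \<Longrightarrow> (\<lambda>x. c * f x) \<in> V"
begin

lemma diff_mem: "f \<in> V \<Longrightarrow> g \<in> V \<Longrightarrow> (\<lambda>x. f x - g x) \<in> V"
  using add_mem[of f "\<lambda>x. - 1 * g x"] scale_mem[of g "- 1"] by simp

lemma sum_mem: "finite I \<Longrightarrow> (\<And>i. i \<in> I \<Longrightarrow> f i \<in> V) \<Longrightarrow> (\<lambda>x. \<Sum>i\<in>I. f i x) \<in> V"
  by (induction I rule: finite_induct) (auto simp: zero_mem add_mem)

end

locale semi_inner = function_space V for V :: "('a \<Rightarrow> real) set" +
  fixes ip :: "('a \<Rightarrow> real) \<Rightarrow> ('a \<Rightarrow> real) \<Rightarrow> real"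
  assumes ip_commute: "f \<in> V \<Longrightarrow> g \<in> V \<Longrightarrow> ip f g = ip g f"
    and ip_add: "f \<in> V \<Longrightarrow> g \<in> V \<Longrightarrow> h \<in> V \<Longrightarrow> ip (\<lambda>x. f x + g x) h = ip f h + ip g h"
    and ip_scale: "f \<in> V \<Longrightarrow> h \<in> V \<Longrightarrow> ip (\<lambda>x. c * f x) h = c * ip f h"
    and ip_nonneg: "f \<in> V \<Longrightarrow> 0 \<le> ip f f"
begin

lemma ip_add_right:
  "f \<in> V \<Longrightarrow> g \<in> V \<Longrightarrow> h \<in> V \<Longrightarrow> ip h (\<lambda>x. f x + g x) = ip h f + ip h g"
  using ip_add[of f g h] ip_commute[of h] add_mem by simp

lemma ip_scale_right: "f \<in> V \<Longrightarrow> h \<in> V \<Longrightarrow> ip h (\<lambda>x. c * f x) = c * ip h f"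
  using ip_scale[of f h c] ip_commute[of h] scale_mem by simp

lemma ip_diff:
  "f \<in> V \<Longrightarrow> g \<in> V \<Longrightarrow> h \<in> V \<Longrightarrow> ip (\<lambda>x. f x - g x) h = ip f h - ip g h"
  using ip_add[of f "\<lambda>x. - 1 * g x" h] scale_mem[of g "- 1"] ip_scale[of g h "- 1"] by simp

lemma ip_diff_right:
  "f \<in> V \<Longrightarrow> g \<in> V \<Longrightarrow> h \<in> V \<Longrightarrow> ip h (\<lambda>x. f x - g x) = ip h f - ip h g"
  using ip_diff[of f g h] ip_commute[of h] diff_mem by simp

lemmas ip_linear = ip_add ip_add_right ip_scale ip_scale_right ip_diff ip_diff_right
lemmas space_mem = zero_mem add_mem scale_mem diff_mem

lemma Cauchy_Schwarz:
  assumes f: "f \<in> V" and g: "g \<in> V"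
  shows "(ip f g)\<^sup>2 \<le> ip f f * ip g g"
proof -
  have main: "0 \<le> ip v v * (ip u u * ip v v - (ip u v)\<^sup>2)" if "u \<in> V" "v \<in> V" for u v
  proof -
    let ?w = "\<lambda>x. ip v v * u x - ip u v * v x"
    have "0 \<le> ip ?w ?w"
      using that by (intro ip_nonneg space_mem)
    also have "ip ?w ?w = ip v v * (ip u u * ip v v - (ip u v)\<^sup>2)"
      using that ip_commute[of u v]
      by (simp add: ip_linear space_mem) (simp add: power2_eq_square algebra_simps)
    finally show ?thesis .
  qed
  \<comment> \<open>Where both squares vanish, the bound above is void; expand the squares of f + g and f - g instead.\<close>
  show ?thesis
  proof (cases "ip g g = 0 \<and> ip f f = 0")
    case True
    have "0 \<le> ip (\<lambda>x. f x + g x) (\<lambda>x. f x + g x)" "0 \<le> ip (\<lambda>x. f x - g x) (\<lambda>x. f x - g x)"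
      using f g by (auto intro!: ip_nonneg space_mem)
    then have "ip f g = 0"
      using True f g ip_commute[of f g] by (simp add: ip_linear space_mem)
    then show ?thesis using True by simp
  next
    case False
    then have "0 < ip g g \<or> 0 < ip f f"
      using ip_nonneg[OF f] ip_nonneg[OF g] by linarith
    then show ?thesis
      using main[OF f g] main[OF g f] ip_commute[OF f g]
      by (auto simp: zero_le_mult_iff mult.commute)
  qed
qed

definition nrm :: "('a \<Rightarrow> real) \<Rightarrow> real" where
  "nrm f = sqrt (ip f f)"

lemma nrm_power2: "f \<in> V \<Longrightarrow> (nrm f)\<^sup>2 = ip f f"
  by (simp add: nrm_def ip_nonneg)

lemma nrm_nonneg: "f \<in> V \<Longrightarrow> 0 \<le> nrm f"
  by (simp add: nrm_def ip_nonneg)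

lemma abs_ip_le: "f \<in> V \<Longrightarrow> g \<in> V \<Longrightarrow> \<bar>ip f g\<bar> \<le> nrm f * nrm g"
  using real_sqrt_le_mono[OF Cauchy_Schwarz] by (simp add: nrm_def real_sqrt_mult)

lemma nrm_triangle:
  assumes "f \<in> V" "g \<in> V"
  shows "nrm (\<lambda>x. f x + g x) \<le> nrm f + nrm g"
proof (rule power2_le_imp_le)
  have "(nrm (\<lambda>x. f x + g x))\<^sup>2 = (nrm f)\<^sup>2 + 2 * ip f g + (nrm g)\<^sup>2"
    using assms ip_commute[of f g] by (simp add: nrm_power2 ip_linear space_mem)
  also have "\<dots> \<le> (nrm f + nrm g)\<^sup>2"
    using abs_ip_le[of f g] assms by (simp add: power2_sum)
  finally show "(nrm (\<lambda>x. f x + g x))\<^sup>2 \<le> (nrm f + nrm g)\<^sup>2" .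
qed (use assms nrm_nonneg in auto)

lemma nrm_scale: "f \<in> V \<Longrightarrow> nrm (\<lambda>x. c * f x) = \<bar>c\<bar> * nrm f"
  by (simp add: nrm_def ip_linear space_mem real_sqrt_mult mult.assoc[symmetric])

lemma nrm_diff_commute: "f \<in> V \<Longrightarrow> g \<in> V \<Longrightarrow> nrm (\<lambda>x. f x - g x) = nrm (\<lambda>x. g x - f x)"
  using nrm_scale[of "\<lambda>x. f x - g x" "-1"] diff_mem[of f g] by simp

lemma nrm_diff_triangle:
  assumes "f \<in> V" "g \<in> V" "h \<in> V"
  shows "nrm (\<lambda>x. f x - h x) \<le> nrm (\<lambda>x. f x - g x) + nrm (\<lambda>x. g x - h x)"
  using nrm_triangle[of "\<lambda>x. f x - g x" "\<lambda>x. g x - h x"] assms by (simp add: space_mem)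

lemma parallelogram:
  assumes "f \<in> V" "g \<in> V"
  shows "ip (\<lambda>x. f x - g x) (\<lambda>x. f x - g x)
    = 2 * ip f f + 2 * ip g g - ip (\<lambda>x. f x + g x) (\<lambda>x. f x + g x)"
  using assms by (simp add: ip_linear space_mem)

definition converges :: "(nat \<Rightarrow> 'a \<Rightarrow> real) \<Rightarrow> ('a \<Rightarrow> real) \<Rightarrow> bool" where
  "converges s p \<longleftrightarrow> (\<lambda>n. nrm (\<lambda>x. s n x - p x)) \<longlonglongrightarrow> 0"

definition cauchy :: "(nat \<Rightarrow> 'a \<Rightarrow> real) \<Rightarrow> bool" where
  "cauchy s \<longleftrightarrow> (\<forall>\<epsilon>>0. \<exists>N. \<forall>m\<ge>N. \<forall>n\<ge>N. nrm (\<lambda>x. s m x - s n x) < \<epsilon>)"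

lemma ip_tendsto:
  assumes "\<And>n. s n \<in> V" "p \<in> V" "h \<in> V" "converges s p"
  shows "(\<lambda>n. ip (s n) h) \<longlonglongrightarrow> ip p h"
proof -
  have "(\<lambda>n. nrm (\<lambda>x. s n x - p x) * nrm h) \<longlonglongrightarrow> 0"
    using assms(4) unfolding converges_def by (rule tendsto_mult_left_zero)
  then have "(\<lambda>n. ip (s n) h - ip p h) \<longlonglongrightarrow> 0"
    by (rule Lim_null_comparison[rotated])
      (use abs_ip_le[OF diff_mem[OF assms(1,2)] assms(3)] assms in \<open>auto simp: ip_linear\<close>)
  then show ?thesis by (simp add: LIM_zero_iff)
qed

lemma nrm_tendsto:
  assumes "\<And>n. s n \<in> V" "p \<in> V" "converges s p"
  shows "(\<lambda>n. nrm (s n)) \<longlonglongrightarrow> nrm p"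
proof -
  have "\<bar>nrm (s n) - nrm p\<bar> \<le> nrm (\<lambda>x. s n x - p x)" for n
    using nrm_triangle[of "\<lambda>x. s n x - p x" p] nrm_triangle[of "\<lambda>x. p x - s n x" "s n"]
      nrm_diff_commute[of "s n" p] assms by (auto simp: space_mem)
  with assms(3) have "(\<lambda>n. nrm (s n) - nrm p) \<longlonglongrightarrow> 0"
    unfolding converges_def by - (rule Lim_null_comparison, auto)
  then show ?thesis by (simp add: LIM_zero_iff)
qed

lemma ip_self_tendsto:
  assumes "\<And>n. s n \<in> V" "p \<in> V" "converges s p"
  shows "(\<lambda>n. ip (s n) (s n)) \<longlonglongrightarrow> ip p p"
  using tendsto_power[OF nrm_tendsto[OF assms], of 2] assms by (simp add: nrm_power2)

lemma converges_imp_cauchy: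
  assumes "\<And>n. s n \<in> V" "p \<in> V" "converges s p"
  shows "cauchy s"
  unfolding cauchy_def
proof (intro allI impI)
  fix \<epsilon> :: real assume "0 < \<epsilon>"
  then have "\<forall>\<^sub>F n in sequentially. nrm (\<lambda>x. s n x - p x) < \<epsilon> / 2"
    using assms(3) unfolding converges_def by (auto dest: order_tendstoD(2)[where a = "\<epsilon> / 2"])
  then obtain N where N: "\<And>n. n \<ge> N \<Longrightarrow> nrm (\<lambda>x. s n x - p x) < \<epsilon> / 2"
    by (auto simp: eventually_sequentially)
  have "nrm (\<lambda>x. s m x - s n x) < \<epsilon>" if "m \<ge> N" "n \<ge> N" for m n
    using nrm_diff_triangle[of "s m" p "s n"] nrm_diff_commute[of "s n" p] N[OF that(1)] N[OF that(2)]
      assms by auto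
  then show "\<exists>N. \<forall>m\<ge>N. \<forall>n\<ge>N. nrm (\<lambda>x. s m x - s n x) < \<epsilon>" by blast
qed

text \<open>
  The form in which the parallelogram law yields the Cauchy property of an extremal sequence.
\<close>

lemma cauchy_if_power2_bound:
  assumes s: "\<And>n. s n \<in> V" and c: "c \<longlonglongrightarrow> 0"
    and bound: "\<And>m n. ip (\<lambda>x. s m x - s n x) (\<lambda>x. s m x - s n x) \<le> c m + c n"
  shows "cauchy s"
  unfolding cauchy_def
proof (intro allI impI)
  fix \<epsilon> :: real assume \<epsilon>: "0 < \<epsilon>"
  then have "\<forall>\<^sub>F n in sequentially. c n < \<epsilon>\<^sup>2 / 2"
    using c by (intro order_tendstoD(2)) auto
  then obtain N where N: "\<And>n. n \<ge> N \<Longrightarrow> c n < \<epsilon>\<^sup>2 / 2"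
    by (auto simp: eventually_sequentially)
  have "nrm (\<lambda>x. s m x - s n x) < \<epsilon>" if "m \<ge> N" "n \<ge> N" for m n
  proof (rule power2_less_imp_less)
    show "(nrm (\<lambda>x. s m x - s n x))\<^sup>2 < \<epsilon>\<^sup>2"
      using bound[of m n] N[OF that(1)] N[OF that(2)] s by (simp add: nrm_power2 space_mem)
  qed (use \<epsilon> in simp)
  then show "\<exists>N. \<forall>m\<ge>N. \<forall>n\<ge>N. nrm (\<lambda>x. s m x - s n x) < \<epsilon>" by blast
qed

definition complete_space :: bool where
  "complete_space \<longleftrightarrow> (\<forall>s. (\<forall>n. s n \<in> V) \<longrightarrow> cauchy s \<longrightarrow> (\<exists>p\<in>V. converges s p))"

text \<open>
  A minimising sequence for the distance from \<open>f\<close> to \<open>S\<close> is a Cauchy sequence by the parallelogram law, and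
  its limit \<open>p\<close> satisfies the variational equation. As \<open>p\<close> lies in the closure of \<open>S\<close>, it is returned together
  with the approximating sequence, through which properties of \<open>S\<close> are transferred to it.
\<close>

lemma orthogonal_projection:
  assumes complete: complete_space and "function_space S" and "S \<subseteq> V" and f: "f \<in> V"
  shows "\<exists>s p. (\<forall>n. s n \<in> S) \<and> p \<in> V \<and> converges s p \<and> (\<forall>h\<in>S. ip (\<lambda>x. f x - p x) h = 0)"
proof -
  interpret S: function_space S by fact
  have SV: "h \<in> S \<Longrightarrow> h \<in> V" for h using \<open>S \<subseteq> V\<close> by blast
  define Q where "Q h = ip (\<lambda>x. f x - h x) (\<lambda>x. f x - h x)" for h
  define \<delta> where "\<delta> = (INF h\<in>S. Q h)"
  have bdd: "bdd_below (Q ` S)"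
    by (rule bdd_belowI[where m = 0]) (auto simp: Q_def f SV space_mem ip_nonneg)
  have \<delta>_le: "\<delta> \<le> Q h" if "h \<in> S" for h
    unfolding \<delta>_def using that by (intro cINF_lower bdd)
  have "\<exists>h\<in>S. Q h < \<delta> + 1 / Suc n" for n
  proof -
    have "\<exists>y\<in>Q ` S. y < \<delta> + 1 / Suc n"
      using S.zero_mem unfolding \<delta>_def by (intro cInf_lessD) auto
    then show ?thesis by blast
  qed
  then obtain s where s: "\<And>n. s n \<in> S" and Qs: "\<And>n. Q (s n) < \<delta> + 1 / Suc n"
    by metis
  have sV: "s n \<in> V" for n using s SV by blast
  have "cauchy s"
  proof (rule cauchy_if_power2_bound[OF sV])
    show "(\<lambda>n. 2 * (1 / Suc n)) \<longlonglongrightarrow> 0"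
      using tendsto_mult_right_zero[OF LIMSEQ_inverse_real_of_nat] by (simp add: divide_inverse)
  next
    fix m n
    define c :: real where "c = 1 / 2"
    \<comment> \<open>The midpoint lies in S, so its distance from f is at least the infimum.\<close>
    let ?mid = "\<lambda>x. c * (s m x + s n x)"
    have "ip (\<lambda>x. s m x - s n x) (\<lambda>x. s m x - s n x) = 2 * Q (s m) + 2 * Q (s n) - 4 * Q ?mid"
      unfolding Q_def using f sV[of m] sV[of n] ip_commute[of f "s m"] ip_commute[of f "s n"]
        ip_commute[of "s m" "s n"]
      by (simp add: ip_linear space_mem) (simp add: c_def algebra_simps)
    moreover have "\<delta> \<le> Q ?mid"
      by (intro \<delta>_le S.scale_mem S.add_mem s)
    ultimately show "ip (\<lambda>x. s m x - s n x) (\<lambda>x. s m x - s n x)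
        \<le> 2 * (1 / Suc m) + 2 * (1 / Suc n)"
      using Qs[of m] Qs[of n] by linarith
  qed
  then obtain p where p: "p \<in> V" and sp: "converges s p"
    using complete sV unfolding complete_space_def by blast
  have "ip (\<lambda>x. f x - p x) h = 0" if h: "h \<in> S" for h
  proof -
    define c where "c = ip (\<lambda>x. f x - p x) h"
    have hV: "h \<in> V" using h SV by blast
    \<comment> \<open>Compare s n with its perturbation by t times h; a linear function of t below a multiple of
      t squared for all t must be zero.\<close>
    have key: "2 * t * c \<le> t\<^sup>2 * ip h h" for t
    proof -
      have le: "2 * t * (ip f h - ip (s n) h) \<le> 1 / Suc n + t\<^sup>2 * ip h h" for n
      proof -
        have "\<delta> \<le> Q (\<lambda>x. s n x + t * h x)"
          by (intro \<delta>_le S.scale_mem S.add_mem s h)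
        also have "\<dots> = Q (s n) - 2 * t * (ip f h - ip (s n) h) + t\<^sup>2 * ip h h"
          unfolding Q_def using f sV[of n] hV ip_commute[of f "s n"] ip_commute[of f h]
            ip_commute[of "s n" h]
          by (simp add: ip_linear space_mem) (simp add: algebra_simps power2_eq_square)
        finally show ?thesis using Qs[of n] by linarith
      qed
      have lim: "(\<lambda>n. 2 * t * (ip f h - ip (s n) h)) \<longlonglongrightarrow> 2 * t * (ip f h - ip p h)"
        by (intro tendsto_intros ip_tendsto sV p hV sp)
      have "(\<lambda>n. 1 / Suc n + t\<^sup>2 * ip h h) \<longlonglongrightarrow> 0 + t\<^sup>2 * ip h h"
        using LIMSEQ_inverse_real_of_nat by (intro tendsto_intros) (simp add: divide_inverse)
      from LIMSEQ_le[OF lim this] le show ?thesis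
        unfolding c_def using f p hV by (auto simp: ip_linear)
    qed
    have "c = 0"
    proof (rule ccontr)
      assume "c \<noteq> 0"
      define H where "H = ip h h + 1"
      have H: "0 < H" "ip h h < H" using ip_nonneg[OF hV] by (auto simp: H_def)
      have "2 * (c / H) * c \<le> (c / H)\<^sup>2 * ip h h" by (rule key)
      also have "\<dots> \<le> (c / H)\<^sup>2 * H" using H by (intro mult_left_mono) auto
      also have "\<dots> = (c / H) * c" using H by (simp add: power2_eq_square)
      finally have "c * c / H \<le> 0" by simp
      moreover have "0 < c * c / H" using \<open>c \<noteq> 0\<close> H(1) by (intro divide_pos_pos) (auto simp: zero_less_mult_iff linorder_neq_iff)
      ultimately show False by simp
    qed
    then show ?thesis by (simp add: c_def)
  qed
  then show ?thesis using s p sp by blast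
qed

end

lemma semi_inner_add:
  assumes "semi_inner V a" "semi_inner V b"
  shows "semi_inner V (\<lambda>u v. a u v + b u v)"
proof -
  interpret A: semi_inner V a by fact
  interpret B: semi_inner V b by fact
  show ?thesis
    by unfold_locales
      (simp_all add: A.ip_commute B.ip_commute A.ip_add B.ip_add A.ip_scale B.ip_scale
        A.ip_nonneg B.ip_nonneg distrib_left)
qed

lemma semi_inner_sum:
  assumes "function_space V" "finite I" "\<And>i. i \<in> I \<Longrightarrow> semi_inner V (a i)"
  shows "semi_inner V (\<lambda>u v. \<Sum>i\<in>I. a i u v)"
  using assms(2,3)
proof (induction I rule: finite_induct)
  case empty
  interpret function_space V by fact
  show ?case by unfold_locales auto
next
  case (insert i I)
  then show ?case by (simp add: semi_inner_add)
qed

text \<open>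
  The variational principle for the largest eigenvalue of the form \<open>d\<close> relative to \<open>a\<close>. Let \<open>M\<close> be the
  supremum of \<open>d u u\<close> over the unit ball of \<open>a\<close>. Along a maximising sequence compactness gives convergence
  for \<open>d\<close>, and then
  \<open>a (u - v) (u - v) = 2 a u u + 2 a v v - a (u + v) (u + v) \<le> 4 - d (u + v) (u + v) / M\<close> tends to
  \<open>0\<close>, so the sequence converges strongly for \<open>a\<close> too. At the maximiser \<open>b\<close> the semidefinite
  form \<open>M a - d\<close> vanishes, hence by Cauchy--Schwarz it vanishes at \<open>(b, v)\<close> for all \<open>v\<close>, which is the
  eigenvalue equation.
\<close>

lemma compact_form_maximiser:
  fixes V :: "('a \<Rightarrow> real) set"
  assumes "semi_inner V a" and "semi_inner V d"
    and complete: "semi_inner.complete_space V a"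
    and compact: "\<And>u K. (\<And>n. u n \<in> V) \<Longrightarrow> (\<And>n. a (u n) (u n) \<le> K) \<Longrightarrow>
      \<exists>r. strict_mono (r :: nat \<Rightarrow> nat) \<and> semi_inner.cauchy d (\<lambda>n. u (r n))"
    and w: "w \<in> V" and dw: "d w w \<noteq> 0"
  shows "\<exists>M>0. (\<forall>u\<in>V. d u u \<le> M * a u u) \<and> (\<exists>b\<in>V. d b b \<noteq> 0 \<and> (\<forall>v\<in>V. M * a b v = d b v))"
proof -
  interpret A: semi_inner V a by fact
  interpret D: semi_inner V d by fact
  define S where "S = {d u u | u. u \<in> V \<and> a u u \<le> 1}"
  \<comment> \<open>Otherwise a sequence in the unit ball has d-norms that outgrow n, and no subsequence of it is
    Cauchy for d.\<close>
  have bdd: "bdd_above S"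
  proof (rule ccontr)
    assume "\<not> bdd_above S"
    then have "\<exists>y\<in>S. (real n)\<^sup>2 < y" for n
      unfolding bdd_above_def by (meson not_le)
    then have "\<forall>n. \<exists>u. u \<in> V \<and> a u u \<le> 1 \<and> (real n)\<^sup>2 < d u u"
      unfolding S_def by blast
    from choice[OF this] obtain u where "\<forall>n. u n \<in> V \<and> a (u n) (u n) \<le> 1 \<and> (real n)\<^sup>2 < d (u n) (u n)"
      by (rule exE)
    then have u: "\<And>n. u n \<in> V" "\<And>n. a (u n) (u n) \<le> 1" "\<And>n. (real n)\<^sup>2 < d (u n) (u n)"
      by auto
    from compact[of u, OF u(1,2)] obtain r where r: "strict_mono r" "D.cauchy (\<lambda>n. u (r n))"
      by (elim exE conjE)
    have large: "real (r n) \<le> D.nrm (u (r n))" for n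
      unfolding D.nrm_def by (rule real_le_rsqrt) (use u(3)[of "r n"] in simp)
    obtain N where N: "\<And>m n. m \<ge> N \<Longrightarrow> n \<ge> N \<Longrightarrow> D.nrm (\<lambda>x. u (r m) x - u (r n) x) < 1"
      using r(2) unfolding D.cauchy_def by (meson zero_less_one)
    obtain m where m: "m \<ge> N" "D.nrm (u (r N)) + 1 < real m"
      using reals_Archimedean2[of "max (real N) (D.nrm (u (r N)) + 1)"] that
      by (metis less_imp_le max_less_iff_conj of_nat_less_iff)
    have "D.nrm (u (r m)) \<le> D.nrm (\<lambda>x. u (r m) x - u (r N) x) + D.nrm (u (r N))"
      using D.nrm_triangle[of "\<lambda>x. u (r m) x - u (r N) x" "u (r N)"] u(1) by (simp add: A.space_mem)
    then show False
      using N[of m N] m large[of m] seq_suble[OF r(1), of m] by linarith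
  qed
  define M where "M = Sup S"
  have unit: "d u u \<le> M" if "u \<in> V" "a u u \<le> 1" for u
    unfolding M_def using that bdd by (intro cSup_upper) (auto simp: S_def)
  \<comment> \<open>Homogeneity; where a u u = 0, all multiples of u lie in the unit ball, which forces d u u = 0.\<close>
  have bound: "d u u \<le> M * a u u" if u: "u \<in> V" for u
  proof (cases "a u u = 0")
    case False
    then have pos: "0 < a u u" using A.ip_nonneg[OF u] by simp
    define c where "c = inverse (sqrt (a u u))"
    have c: "c * c = inverse (a u u)"
      using pos by (simp add: c_def flip: inverse_mult_distrib)
    let ?v = "\<lambda>x. c * u x"
    have "a ?v ?v = 1" "d ?v ?v = d u u / a u u"
      using u pos c by (simp_all add: A.ip_linear D.ip_linear A.space_mem divide_inverse mult.assoc[symmetric])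
    with unit[of ?v] pos u show ?thesis by (simp add: A.space_mem field_simps)
  next
    case True
    have "c\<^sup>2 * d u u \<le> M" for c
      using unit[of "\<lambda>x. c * u x"] u True
      by (simp add: A.ip_linear D.ip_linear A.space_mem power2_eq_square mult.assoc)
    from this[of "sqrt ((\<bar>M\<bar> + 1) / d u u)"] have "d u u = 0"
      using D.ip_nonneg[OF u] by (cases "d u u = 0") (auto simp: abs_if split: if_splits)
    then show ?thesis using True by simp
  qed
  have M: "0 < M"
  proof (rule ccontr)
    assume "\<not> 0 < M"
    then have "M * a w w \<le> 0" using A.ip_nonneg[OF w] by (intro mult_nonpos_nonneg) auto
    then show False using bound[OF w] dw D.ip_nonneg[OF w] by linarith
  qed
  have "\<forall>n. \<exists>u. u \<in> V \<and> a u u \<le> 1 \<and> M - 1 / Suc n < d u u"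
  proof
    fix n
    have "\<exists>y\<in>S. M - 1 / Suc n < y"
    proof (rule less_cSupD)
      show "S \<noteq> {}"
        using A.zero_mem A.ip_scale[OF A.zero_mem A.zero_mem, of 0] by (force simp: S_def)
    qed (simp add: M_def)
    then show "\<exists>u. u \<in> V \<and> a u u \<le> 1 \<and> M - 1 / Suc n < d u u" by (auto simp: S_def)
  qed
  from choice[OF this] obtain u where "\<forall>n. u n \<in> V \<and> a (u n) (u n) \<le> 1 \<and> M - 1 / Suc n < d (u n) (u n)"
    by (rule exE)
  then have u: "\<And>n. u n \<in> V" "\<And>n. a (u n) (u n) \<le> 1" "\<And>n. M - 1 / Suc n < d (u n) (u n)"
    by auto
  from compact[of u, OF u(1,2)] obtain r where r: "strict_mono r" "D.cauchy (\<lambda>n. u (r n))"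
    by (elim exE conjE)
  define s where "s n = u (r n)" for n
  have sV: "s n \<in> V" and sa: "a (s n) (s n) \<le> 1" for n using u by (auto simp: s_def)
  have sd: "M - 1 / Suc n < d (s n) (s n)" for n
  proof -
    have "1 / real (Suc (r n)) \<le> 1 / Suc n"
      using seq_suble[OF r(1), of n] by (intro divide_left_mono) auto
    then show ?thesis using u(3)[of "r n"] by (simp add: s_def)
  qed
  have "A.cauchy s"
    unfolding A.cauchy_def
  proof (intro allI impI)
    fix \<epsilon> :: real assume \<epsilon>: "0 < \<epsilon>"
    \<comment> \<open>Five errors of size at most \<eta> accumulate below; the minimum with 1 lets a small d-norm bound
      its own square.\<close>
    define \<eta> where "\<eta> = min 1 (M * \<epsilon>\<^sup>2 / 6)"
    have \<eta>: "0 < \<eta>" using \<epsilon> M by (simp add: \<eta>_def)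
    obtain N where N: "\<And>m n. m \<ge> N \<Longrightarrow> n \<ge> N \<Longrightarrow> D.nrm (\<lambda>x. s m x - s n x) < \<eta>"
      using r(2) \<eta> unfolding D.cauchy_def s_def by blast
    obtain N' where N': "1 / Suc N' < \<eta>"
      using reals_Archimedean[OF \<eta>] by (auto simp: divide_inverse)
    have "A.nrm (\<lambda>x. s m x - s n x) < \<epsilon>" if m: "m \<ge> max N N'" and n: "n \<ge> max N N'" for m n
    proof (rule power2_less_imp_less)
      have small: "1 / real (Suc k) < \<eta>" if "k \<ge> N'" for k
        using that N' by (intro order.strict_trans1[OF _ N'] divide_left_mono) auto
      let ?diff = "\<lambda>x. s m x - s n x" and ?sum = "\<lambda>x. s m x + s n x"
      have "d ?diff ?diff = (D.nrm ?diff)\<^sup>2"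
        using sV by (simp add: D.nrm_power2 A.space_mem)
      also have "\<dots> \<le> (D.nrm ?diff) * 1"
        unfolding power2_eq_square using N[of m n] m n sV D.nrm_nonneg[of ?diff]
        by (intro mult_left_mono) (auto simp: \<eta>_def A.space_mem)
      also have "\<dots> < \<eta>" using N[of m n] m n by simp
      finally have dd: "d ?diff ?diff < \<eta>" .
      have "4 * M - 5 * \<eta> < d ?sum ?sum"
        using D.parallelogram[OF sV sV, of m n] sd[of m] sd[of n] small[of m] small[of n] m n dd
        by simp
      also have "\<dots> \<le> M * a ?sum ?sum" using sV by (intro bound A.space_mem)
      finally have "M * (4 - a ?sum ?sum) < 5 * \<eta>" by (simp add: algebra_simps)
      moreover have "a ?diff ?diff \<le> 4 - a ?sum ?sum"
        using A.parallelogram[OF sV sV, of m n] sa[of m] sa[of n] by simp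
      ultimately have "M * a ?diff ?diff < 5 * \<eta>"
        using M by (meson mult_left_mono order.strict_trans1 less_imp_le)
      also have "\<dots> < 6 * \<eta>" using \<eta> by simp
      also have "\<dots> \<le> M * \<epsilon>\<^sup>2" by (simp add: \<eta>_def)
      finally show "(A.nrm ?diff)\<^sup>2 < \<epsilon>\<^sup>2"
        using M sV by (simp add: A.nrm_power2 A.space_mem)
    qed (use \<epsilon> in simp)
    then show "\<exists>N. \<forall>m\<ge>N. \<forall>n\<ge>N. A.nrm (\<lambda>x. s m x - s n x) < \<epsilon>" by blast
  qed
  then obtain b where b: "b \<in> V" and sb: "A.converges s b"
    using complete sV unfolding A.complete_space_def by blast
  have ab: "a b b \<le> 1"
    by (rule LIMSEQ_le_const2[OF A.ip_self_tendsto[OF sV b sb]]) (use sa in auto)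
  have "D.converges s b"
    unfolding D.converges_def
  proof (rule tendsto_sandwich[OF _ _ tendsto_const])
    show "(\<lambda>n. sqrt M * A.nrm (\<lambda>x. s n x - b x)) \<longlonglongrightarrow> 0"
      using sb unfolding A.converges_def by (rule tendsto_mult_right_zero)
    show "\<forall>\<^sub>F n in sequentially. D.nrm (\<lambda>x. s n x - b x) \<le> sqrt M * A.nrm (\<lambda>x. s n x - b x)"
      using bound sV b
      by (auto simp: D.nrm_def A.nrm_def real_sqrt_mult[symmetric] A.space_mem)
  qed (use sV b in \<open>auto simp: D.nrm_nonneg A.space_mem\<close>)
  then have "(\<lambda>n. d (s n) (s n)) \<longlonglongrightarrow> d b b"
    using sV b by (intro D.ip_self_tendsto)
  moreover have "(\<lambda>n. M - 1 / Suc n) \<longlonglongrightarrow> M - 0"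
    using LIMSEQ_inverse_real_of_nat by (intro tendsto_intros) (simp add: divide_inverse)
  ultimately have db: "M \<le> d b b"
    using sd by (intro LIMSEQ_le[of "\<lambda>n. M - 1 / Suc n" M]) (auto simp: less_imp_le)
  \<comment> \<open>The Euler--Lagrange equation is Cauchy--Schwarz for this form, which is zero at (b, b).\<close>
  interpret C: semi_inner V "\<lambda>f g. M * a f g - d f g"
  proof (unfold_locales, goal_cases)
    case (1 f g) then show ?case by (simp add: A.ip_commute D.ip_commute)
  next
    case (2 f g h) then show ?case by (simp add: A.ip_add D.ip_add algebra_simps)
  next
    case (3 f h c) then show ?case by (simp add: A.ip_scale D.ip_scale algebra_simps)
  next
    case (4 f) then show ?case using bound by simp
  qed
  have "M * a b b - d b b \<le> 0" 
    using mult_left_mono[OF ab, of M] M db unfolding mult_1_right by linarith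
  then have zero: "M * a b b - d b b = 0" using C.ip_nonneg[OF b] by simp
  have "M * a b v = d b v" if "v \<in> V" for v
    using C.Cauchy_Schwarz[OF b that] zero by simp
  moreover have "d b b \<noteq> 0" using db M by simp
  ultimately show ?thesis using M bound b by blast
qed

section \<open>The space of square integrable functions\<close>

definition L2_inner :: "'b measure \<Rightarrow> ('b \<Rightarrow> real) \<Rightarrow> ('b \<Rightarrow> real) \<Rightarrow> real" where
  "L2_inner M f g = (\<integral>x. f x * g x \<partial>M)"

lemma L2_measurable: "f \<in> L2 M \<Longrightarrow> f \<in> borel_measurable M"
  by (simp add: L2_def)

lemma L2_square_integrable: "f \<in> L2 M \<Longrightarrow> integrable M (\<lambda>x. (f x)\<^sup>2)"
  by (simp add: L2_def)

lemma L2_mult_integrable: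
  assumes "f \<in> L2 M" "g \<in> L2 M"
  shows "integrable M (\<lambda>x. f x * g x)"
proof (rule Bochner_Integration.integrable_bound)
  show "integrable M (\<lambda>x. (f x)\<^sup>2 + (g x)\<^sup>2)"
    using assms by (intro Bochner_Integration.integrable_add L2_square_integrable)
  have "\<bar>a * b\<bar> \<le> a\<^sup>2 + b\<^sup>2" for a b :: real
    using sum_squares_bound[of "\<bar>a\<bar>" "\<bar>b\<bar>"] abs_ge_zero[of "a * b"]
    unfolding power2_abs abs_mult by linarith
  then show "AE x in M. norm (f x * g x) \<le> norm ((f x)\<^sup>2 + (g x)\<^sup>2)"
    by auto
qed (use assms L2_measurable in measurable)

lemma L2_inner_AE_cong:
  assumes "f \<in> L2 M" "g \<in> L2 M" "f' \<in> L2 M" "g' \<in> L2 M"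
    and "AE x in M. f x = f' x" "AE x in M. g x = g' x"
  shows "L2_inner M f g = L2_inner M f' g'"
  unfolding L2_inner_def using assms by (intro integral_cong_AE) (auto simp: L2_def)

interpretation L2: semi_inner "L2 M" "L2_inner M" for M :: "'b measure"
proof
  show "(\<lambda>x. 0) \<in> L2 M" by (simp add: L2_def)
next
  fix f g :: "'b \<Rightarrow> real" assume fg: "f \<in> L2 M" "g \<in> L2 M"
  have "integrable M (\<lambda>x. (f x)\<^sup>2 + (g x)\<^sup>2 + 2 * (f x * g x))"
    using fg by (intro Bochner_Integration.integrable_add integrable_mult_right
        L2_square_integrable L2_mult_integrable)
  then show "(\<lambda>x. f x + g x) \<in> L2 M"
    using fg by (auto simp: L2_def power2_sum mult.assoc)
  show "L2_inner M f g = L2_inner M g f"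
    by (simp add: L2_inner_def mult.commute)
next
  fix f :: "'b \<Rightarrow> real" and c assume "f \<in> L2 M"
  then show "(\<lambda>x. c * f x) \<in> L2 M"
    by (auto simp: L2_def power_mult_distrib)
next
  fix f g h :: "'b \<Rightarrow> real" assume "f \<in> L2 M" "g \<in> L2 M" "h \<in> L2 M"
  then show "L2_inner M (\<lambda>x. f x + g x) h = L2_inner M f h + L2_inner M g h"
    by (simp add: L2_inner_def distrib_right L2_mult_integrable)
next
  fix f h :: "'b \<Rightarrow> real" and c assume "f \<in> L2 M" "h \<in> L2 M"
  then show "L2_inner M (\<lambda>x. c * f x) h = c * L2_inner M f h"
    by (simp add: L2_inner_def mult.assoc)
next
  fix f :: "'b \<Rightarrow> real" assume "f \<in> L2 M"
  then show "0 \<le> L2_inner M f f"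
    by (simp add: L2_inner_def)
qed

lemma L2_nrm_eq: "L2.nrm M f = L2_norm M f"
  by (simp add: L2.nrm_def L2_inner_def L2_norm_def power2_eq_square)

lemma L2_inner_self_eq_0_iff:
  assumes "f \<in> L2 M"
  shows "L2_inner M f f = 0 \<longleftrightarrow> (AE x in M. f x = 0)"
proof -
  have "L2_inner M f f = 0 \<longleftrightarrow> (AE x in M. f x * f x = 0)"
    unfolding L2_inner_def using assms
    by (intro integral_nonneg_eq_0_iff_AE L2_mult_integrable) auto
  then show ?thesis by simp
qed

text \<open>
  Riesz--Fischer. The increments \<open>d n\<close> of a subsequence with \<open>\<parallel>d n\<parallel> \<le> 4\<^sup>-\<^sup>n\<close> satisfy \<open>\<integral> \<Sum>n. 4\<^sup>n (d n)\<^sup>2 < \<infinity>\<close>. So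
  \<open>2\<^sup>n |d n|\<close> is bounded at almost every point and the subsequence converges there; Fatou's lemma turns this
  into convergence in norm.
\<close>

lemma L2_complete: "semi_inner.complete_space (L2 M) (L2_inner M)"
  unfolding L2.complete_space_def
proof (intro allI impI)
  fix s :: "nat \<Rightarrow> 'a \<Rightarrow> real"
  assume "\<forall>n. s n \<in> L2 M" and cs: "L2.cauchy M s"
  then have s: "s n \<in> L2 M" for n by blast
  have [measurable]: "s n \<in> borel_measurable M" for n
    using s L2_measurable by blast
  have nnsq: "(\<integral>\<^sup>+x. ennreal ((f x)\<^sup>2) \<partial>M) = ennreal ((L2.nrm M f)\<^sup>2)" if "f \<in> L2 M" for f
    using that
    by (subst nn_integral_eq_integral)
      (auto simp: L2_square_integrable L2.nrm_power2 L2_inner_def power2_eq_square[of "f _"]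
        L2_mult_integrable)
  have "\<forall>n. \<exists>N. \<forall>m\<ge>N. \<forall>k\<ge>N. L2.nrm M (\<lambda>x. s m x - s k x) < (1 / 4) ^ n"
    using cs unfolding L2.cauchy_def by simp
  from choice[OF this] obtain N where
    N: "\<forall>n. \<forall>m\<ge>N n. \<forall>k\<ge>N n. L2.nrm M (\<lambda>x. s m x - s k x) < (1 / 4) ^ n"
    by (rule exE)
  define r where "r n = (\<Sum>k\<le>n. N k)" for n
  have rN: "N n \<le> r n" "N n \<le> r (Suc n)" for n
    unfolding r_def by (auto intro: member_le_sum trans_le_add1)
  define d where "d n x = s (r (Suc n)) x - s (r n) x" for n x
  have d: "d n \<in> L2 M" for n
    unfolding d_def using s by (intro L2.diff_mem)
  have [measurable]: "d n \<in> borel_measurable M" for n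
    using d L2_measurable by blast
  have d_small: "(L2.nrm M (d n))\<^sup>2 \<le> (1 / 16) ^ n" for n
  proof -
    have "d n = (\<lambda>x. s (r (Suc n)) x - s (r n) x)"
      by (simp add: d_def fun_eq_iff)
    then have "L2.nrm M (d n) < (1 / 4) ^ n"
      using N rN[of n] by simp
    then have "(L2.nrm M (d n))\<^sup>2 \<le> ((1 / 4) ^ n)\<^sup>2"
      using d by (intro power_mono) (auto simp: L2.nrm_nonneg)
    also have "\<dots> = ((1 / 4)\<^sup>2) ^ n" by (simp add: power_mult[symmetric] mult.commute)
    finally show ?thesis by (simp add: power2_eq_square)
  qed
  have "(\<integral>\<^sup>+x. (\<Sum>n. ennreal (4 ^ n * (d n x)\<^sup>2)) \<partial>M) = (\<Sum>n. \<integral>\<^sup>+x. ennreal (4 ^ n * (d n x)\<^sup>2) \<partial>M)"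
    by (intro nn_integral_suminf) measurable
  also have "\<dots> \<le> (\<Sum>n. ennreal ((1 / 4) ^ n))"
  proof (intro suminf_le summableI)
    fix n
    have "(\<integral>\<^sup>+x. ennreal (4 ^ n * (d n x)\<^sup>2) \<partial>M) = ennreal (4 ^ n) * (\<integral>\<^sup>+x. ennreal ((d n x)\<^sup>2) \<partial>M)"
      by (subst nn_integral_cmult[symmetric]) (auto simp: ennreal_mult)
    also have "\<dots> = ennreal (4 ^ n * (L2.nrm M (d n))\<^sup>2)"
      by (simp add: nnsq d ennreal_mult)
    also have "\<dots> \<le> ennreal (4 ^ n * (1 / 16) ^ n)"
      by (intro ennreal_leI mult_left_mono d_small) auto
    also have "(4 :: real) ^ n * (1 / 16) ^ n = (1 / 4) ^ n"
      by (simp add: power_mult_distrib[symmetric])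
    finally show "(\<integral>\<^sup>+x. ennreal (4 ^ n * (d n x)\<^sup>2) \<partial>M) \<le> ennreal ((1 / 4) ^ n)" .
  qed
  also have "\<dots> < \<infinity>"
    by (subst suminf_ennreal2) (auto intro!: summable_geometric)
  finally have fin: "AE x in M. (\<Sum>n. ennreal (4 ^ n * (d n x)\<^sup>2)) \<noteq> \<infinity>"
    by (intro nn_integral_PInf_AE) auto
  have term_le: "f n \<le> (\<Sum>n. f n)" for f :: "nat \<Rightarrow> ennreal" and n
    using sum_le_suminf[OF summableI, of "{n}" f] by simp
  from fin have conv: "AE x in M. convergent (\<lambda>n. s (r n) x)"
  proof eventually_elim
    case (elim x)
    define S where "S = (\<Sum>n. ennreal (4 ^ n * (d n x)\<^sup>2))"
    obtain c where c: "S = ennreal c" "0 \<le> c"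
      using elim[folded S_def] by (cases S) auto
    have "\<bar>d n x\<bar> \<le> sqrt c * (1 / 2) ^ n" for n
    proof -
      have "ennreal (4 ^ n * (d n x)\<^sup>2) \<le> S"
        unfolding S_def by (rule term_le)
      moreover have root: "sqrt (4 ^ n * (d n x)\<^sup>2) = 2 ^ n * \<bar>d n x\<bar>"
        using real_sqrt_abs[of "2 ^ n * d n x"]
        by (simp add: power_mult_distrib power_mult[symmetric] mult.commute[of n] power_mult abs_mult)
      ultimately have "4 ^ n * (d n x)\<^sup>2 \<le> c"
        using c by simp
      then have "sqrt (4 ^ n * (d n x)\<^sup>2) \<le> sqrt c" by simp
      then have "2 ^ n * \<bar>d n x\<bar> \<le> sqrt c"
        unfolding root .
      then show ?thesis by (simp add: field_simps)
    qed
    moreover have "summable (\<lambda>n. sqrt c * (1 / 2) ^ n)"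
      by (intro summable_mult summable_geometric) simp
    ultimately have "summable (\<lambda>n. d n x)"
      using summable_comparison_test'[of "\<lambda>n. sqrt c * (1 / 2) ^ n" 0 "\<lambda>n. d n x"] by simp
    then have "convergent (\<lambda>n. \<Sum>k<n. d k x)"
      by (simp add: summable_iff_convergent)
    then have "convergent (\<lambda>n. (\<Sum>k<n. d k x) + s (r 0) x)"
      by (intro convergent_add convergent_const)
    moreover have "(\<Sum>k<n. d k x) + s (r 0) x = s (r n) x" for n
      unfolding d_def by (subst sum_lessThan_telescope) simp
    ultimately show ?case by simp
  qed
  define p where "p x = lim (\<lambda>n. s (r n) x)" for x
  have [measurable]: "p \<in> borel_measurable M"
    unfolding p_def by measurable
  have p_lim: "AE x in M. (\<lambda>n. s (r n) x) \<longlonglongrightarrow> p x"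
    using conv by eventually_elim (simp add: p_def convergent_LIMSEQ_iff)
  have r_tail: "\<forall>\<^sub>F n in sequentially. r n \<ge> N k" for k
    using eventually_ge_at_top[of k]
  proof eventually_elim
    case (elim n)
    then show ?case unfolding r_def by (intro member_le_sum) auto
  qed
  have dist: "(\<integral>\<^sup>+x. ennreal ((s m x - p x)\<^sup>2) \<partial>M) \<le> ennreal (((1 / 4) ^ k)\<^sup>2)" if m: "m \<ge> N k" for m k
  proof -
    have "(\<integral>\<^sup>+x. ennreal ((s m x - p x)\<^sup>2) \<partial>M)
        = (\<integral>\<^sup>+x. liminf (\<lambda>n. ennreal ((s m x - s (r n) x)\<^sup>2)) \<partial>M)"
    proof (rule nn_integral_cong_AE)
      show "AE x in M. ennreal ((s m x - p x)\<^sup>2) = liminf (\<lambda>n. ennreal ((s m x - s (r n) x)\<^sup>2))"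
        using p_lim
      proof eventually_elim
        case (elim x)
        have "(\<lambda>n. ennreal ((s m x - s (r n) x)\<^sup>2)) \<longlonglongrightarrow> ennreal ((s m x - p x)\<^sup>2)"
          by (intro tendsto_intros elim)
        then show ?case using lim_imp_Liminf[OF sequentially_bot] by metis
      qed
    qed
    also have "\<dots> \<le> liminf (\<lambda>n. \<integral>\<^sup>+x. ennreal ((s m x - s (r n) x)\<^sup>2) \<partial>M)"
      by (intro nn_integral_liminf) auto
    also have "\<dots> \<le> limsup (\<lambda>n. \<integral>\<^sup>+x. ennreal ((s m x - s (r n) x)\<^sup>2) \<partial>M)"
      by (rule Liminf_le_Limsup) simp
    also have "\<dots> \<le> ennreal (((1 / 4) ^ k)\<^sup>2)"
    proof (rule Limsup_bounded)
      show "\<forall>\<^sub>F n in sequentially. (\<integral>\<^sup>+x. ennreal ((s m x - s (r n) x)\<^sup>2) \<partial>M) \<le> ennreal (((1 / 4) ^ k)\<^sup>2)"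
        using r_tail[of k]
      proof eventually_elim
        case (elim n)
        have "L2.nrm M (\<lambda>x. s m x - s (r n) x) \<le> (1 / 4) ^ k"
          using N m elim by (meson less_imp_le)
        then show ?case
          using s by (subst nnsq) (auto intro!: ennreal_leI power_mono L2.diff_mem L2.nrm_nonneg)
      qed
    qed
    finally show ?thesis .
  qed
  have diffL2: "(\<lambda>x. s (N k) x - p x) \<in> L2 M" for k
    using order.strict_trans1[OF dist[of k "N k"] ennreal_less_top]
    by (auto simp: L2_def integrable_iff_bounded)
  have p: "p \<in> L2 M"
    using L2.diff_mem[OF s[of "N 0"] diffL2[of 0]] by simp
  have "L2.converges M s p"
    unfolding L2.converges_def
  proof (rule LIMSEQ_I)
    fix \<epsilon> :: real assume "0 < \<epsilon>"
    then obtain k where k: "(1 / 4) ^ k < \<epsilon>"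
      using real_arch_pow_inv[of \<epsilon> "1 / 4"] by auto
    have "norm (L2.nrm M (\<lambda>x. s m x - p x) - 0) < \<epsilon>" if m: "m \<ge> N k" for m
    proof -
      have "ennreal ((L2.nrm M (\<lambda>x. s m x - p x))\<^sup>2) \<le> ennreal (((1 / 4) ^ k)\<^sup>2)"
        using dist[OF m] s p by (subst nnsq[symmetric]) (auto intro: L2.diff_mem)
      then have "(L2.nrm M (\<lambda>x. s m x - p x))\<^sup>2 \<le> ((1 / 4) ^ k)\<^sup>2"
        by simp
      then have "L2.nrm M (\<lambda>x. s m x - p x) \<le> (1 / 4) ^ k"
        by (rule power2_le_imp_le) simp
      then show ?thesis
        using k L2.nrm_nonneg[of "\<lambda>x. s m x - p x" M] s p by (simp add: L2.diff_mem)
    qed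
    then show "\<exists>n0. \<forall>n\<ge>n0. norm (L2.nrm M (\<lambda>x. s n x - p x) - 0) < \<epsilon>" by blast
  qed
  with p show "\<exists>p\<in>L2 M. L2.converges M s p" by blast
qed

lemma L2_cauchy_converges:
  assumes "\<And>n. s n \<in> L2 M" "L2.cauchy M s"
  obtains p where "p \<in> L2 M" "L2.converges M s p"
  using L2_complete[of M] assms unfolding L2.complete_space_def by metis

text \<open>
  Pointwise additivity and homogeneity almost everywhere is what holds for operators that are defined by
  choosing representatives, such as the weak Laplacian. It suffices to pull the inner product of \<open>L\<^sup>2\<close> back
  to a semi-inner product on \<open>V\<close>.
\<close>

locale L2_pullback = function_space V for V :: "('a \<Rightarrow> real) set" +
  fixes T :: "('a \<Rightarrow> real) \<Rightarrow> 'b \<Rightarrow> real" and M :: "'b measure"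
  assumes T_L2: "u \<in> V \<Longrightarrow> T u \<in> L2 M"
    and T_add: "u \<in> V \<Longrightarrow> v \<in> V \<Longrightarrow> AE x in M. T (\<lambda>y. u y + v y) x = T u x + T v x"
    and T_scale: "u \<in> V \<Longrightarrow> AE x in M. T (\<lambda>y. c * u y) x = c * T u x"
begin

sublocale semi_inner V "\<lambda>u v. L2_inner M (T u) (T v)"
proof (unfold_locales, goal_cases)
  case (1 f g)
  then show ?case using T_L2 L2.ip_commute by blast
next
  case (2 f g h)
  then have "L2_inner M (T (\<lambda>y. f y + g y)) (T h) = L2_inner M (\<lambda>x. T f x + T g x) (T h)"
    using T_add by (intro L2_inner_AE_cong T_L2 L2.add_mem add_mem) auto
  then show ?case using 2 T_L2 L2.ip_add[of "T f" M "T g" "T h"] by simp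
next
  case (3 f h c)
  then have "L2_inner M (T (\<lambda>y. c * f y)) (T h) = L2_inner M (\<lambda>x. c * T f x) (T h)"
    using T_scale by (intro L2_inner_AE_cong T_L2 L2.scale_mem scale_mem) auto
  then show ?case using 3 T_L2 L2.ip_scale[of "T f" M "T h" c] by simp
next
  case (4 f)
  then show ?case using T_L2 L2.ip_nonneg by blast
qed

lemma semi_inner: "semi_inner V (\<lambda>u v. L2_inner M (T u) (T v))"
  by unfold_locales

lemma T_diff:
  assumes "u \<in> V" "v \<in> V"
  shows "AE x in M. T (\<lambda>y. u y - v y) x = T u x - T v x"
  using T_add[OF assms(1) scale_mem[OF assms(2), of "-1"]] T_scale[OF assms(2), of "-1"]
  by eventually_elim simp

lemma nrm_diff_eq:
  assumes "u \<in> V" "v \<in> V"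
  shows "nrm (\<lambda>x. u x - v x) = L2.nrm M (\<lambda>x. T u x - T v x)"
  unfolding nrm_def L2.nrm_def using T_diff[OF assms] assms
  by (intro arg_cong[where f = sqrt] L2_inner_AE_cong L2.diff_mem T_L2 diff_mem) auto

lemma converges_iff:
  "(\<And>n. s n \<in> V) \<Longrightarrow> p \<in> V \<Longrightarrow> converges s p \<longleftrightarrow> L2.converges M (\<lambda>n. T (s n)) (T p)"
  by (simp add: converges_def L2.converges_def nrm_diff_eq)

lemma cauchy_iff: "(\<And>n. s n \<in> V) \<Longrightarrow> cauchy s \<longleftrightarrow> L2.cauchy M (\<lambda>n. T (s n))"
  by (simp add: cauchy_def L2.cauchy_def nrm_diff_eq)

end

lemma L2_converges_AE_cong:
  assumes "\<And>n. s n \<in> L2 M" "p \<in> L2 M" "q \<in> L2 M" "AE x in M. p x = q x" "L2.converges M s p"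
  shows "L2.converges M s q"
proof -
  have "L2.nrm M (\<lambda>x. s n x - p x) = L2.nrm M (\<lambda>x. s n x - q x)" for n
    unfolding L2.nrm_def using assms(4)
    by (intro arg_cong[where f = sqrt] L2_inner_AE_cong L2.diff_mem assms) auto
  with assms(5) show ?thesis by (simp add: L2.converges_def)
qed

section \<open>Calculus of test functions\<close>

lemma partial_eqI: "(f has_derivative f') (at x) \<Longrightarrow> partial i f x = f' i"
  unfolding partial_def using frechet_derivative_at by metis

lemma C_k_SucI:
  assumes "\<And>x. (f has_derivative D x) (at x)" and "\<And>i. i \<in> Basis \<Longrightarrow> C_k k (\<lambda>x. D x i)"
  shows "C_k (Suc k) f"
proof -
  have "f differentiable_on UNIV"
    using assms(1) by (auto simp: differentiable_on_def differentiable_def)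
  moreover have "partial i f = (\<lambda>x. D x i)" for i
    using assms(1) by (auto intro: partial_eqI)
  ultimately show ?thesis using assms(2) by simp
qed

lemma C_k_Suc_has_derivative:
  assumes "C_k (Suc k) f"
  shows "(f has_derivative frechet_derivative f (at x)) (at x)"
  using assms by (simp add: differentiable_on_def frechet_derivative_works)

lemma C_k_Suc_partial: "C_k (Suc k) f \<Longrightarrow> i \<in> Basis \<Longrightarrow> C_k k (partial i f)"
  by simp

lemma C_k_imp_continuous: "C_k k f \<Longrightarrow> continuous_on S f"
  by (cases k)
    (auto intro: continuous_on_subset differentiable_imp_continuous_on)

lemma C_k_SucD: "C_k (Suc k) f \<Longrightarrow> C_k k f"
proof (induction k arbitrary: f)
  case 0
  then show ?case using C_k_imp_continuous[of "Suc 0" f UNIV] by simp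
next
  case (Suc k)
  then show ?case by (subst C_k.simps) (use Suc.prems in auto)
qed

lemma C_k_mono: "C_k k f \<Longrightarrow> m \<le> k \<Longrightarrow> C_k m f"
  by (induction k) (auto simp: le_Suc_eq simp del: C_k.simps dest: C_k_SucD)

lemma C_k_const: "C_k k (\<lambda>x. c)"
proof (induction k arbitrary: c)
  case (Suc k)
  show ?case by (rule C_k_SucI[where D = "\<lambda>x h. 0"]) (auto intro: Suc)
qed simp

lemma C_k_add: "C_k k f \<Longrightarrow> C_k k g \<Longrightarrow> C_k k (\<lambda>x. f x + g x)"
proof (induction k arbitrary: f g)
  case (Suc k)
  show ?case
  proof (rule C_k_SucI)
    show "((\<lambda>x. f x + g x) has_derivative
        (\<lambda>h. frechet_derivative f (at x) h + frechet_derivative g (at x) h)) (at x)" for x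
      using Suc.prems[THEN C_k_Suc_has_derivative] by (rule has_derivative_add)
    show "C_k k (\<lambda>x. frechet_derivative f (at x) i + frechet_derivative g (at x) i)"
      if "i \<in> Basis" for i
      using Suc.IH[OF C_k_Suc_partial C_k_Suc_partial, OF Suc.prems(1) that Suc.prems(2) that]
      by (simp add: partial_def)
  qed
qed (simp add: continuous_on_add)

lemma C_k_mult: "C_k k f \<Longrightarrow> C_k k g \<Longrightarrow> C_k k (\<lambda>x. f x * g x)"
proof (induction k arbitrary: f g)
  case (Suc k)
  show ?case
  proof (rule C_k_SucI)
    show "((\<lambda>x. f x * g x) has_derivative
        (\<lambda>h. f x * frechet_derivative g (at x) h + frechet_derivative f (at x) h * g x)) (at x)" for x
      using Suc.prems[THEN C_k_Suc_has_derivative] by (rule has_derivative_mult)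
    show "C_k k (\<lambda>x. f x * frechet_derivative g (at x) i + frechet_derivative f (at x) i * g x)"
      if "i \<in> Basis" for i
      using C_k_add[OF Suc.IH[OF C_k_SucD C_k_Suc_partial] Suc.IH[OF C_k_Suc_partial C_k_SucD],
          OF Suc.prems(1) Suc.prems(2) that Suc.prems(1) that Suc.prems(2)]
      by (simp add: partial_def)
  qed
qed (simp add: continuous_on_mult)

lemma partial_mult:
  assumes "C_k (Suc 0) f" "C_k (Suc 0) g"
  shows "partial i (\<lambda>x. f x * g x) x = f x * partial i g x + partial i f x * g x"
  using partial_eqI[OF has_derivative_mult[OF assms[THEN C_k_Suc_has_derivative]]]
  by (simp add: partial_def)

lemma C_k_inner: "C_k k (\<lambda>x. x \<bullet> v + c)"
proof (cases k)
  case (Suc m)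
  show ?thesis unfolding Suc
    by (rule C_k_SucI[where D = "\<lambda>x h. h \<bullet> v"]) (auto intro!: derivative_eq_intros C_k_const)
qed (auto intro!: continuous_intros)

lemma has_derivative_exp_inner:
  "((\<lambda>x. exp (k \<bullet> x)) has_derivative (\<lambda>h. (k \<bullet> h) * exp (k \<bullet> x))) (at x)"
  by (auto intro!: derivative_eq_intros)

lemma C_k_exp_inner: "C_k n (\<lambda>x. exp (k \<bullet> x))"
proof (induction n)
  case (Suc n)
  show ?case
    by (rule C_k_SucI[OF has_derivative_exp_inner]) (intro C_k_mult C_k_const Suc)
qed (auto intro!: continuous_intros)

lemma partial_exp_inner: "partial i (\<lambda>x. exp (k \<bullet> x)) x = (k \<bullet> i) * exp (k \<bullet> x)"
  by (rule partial_eqI[OF has_derivative_exp_inner])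

text \<open>
  For \<open>m > k\<close> this is a function of class \<open>C\<^sup>k\<close> that is positive exactly on the ball around \<open>c\<close> of radius \<open>r\<close>. Powers
  of the positive part keep the derivatives in the same family, up to polynomial factors.
\<close>

definition bump :: "'a::euclidean_space \<Rightarrow> real \<Rightarrow> nat \<Rightarrow> 'a \<Rightarrow> real" where
  "bump c r m x = max 0 (r\<^sup>2 - (x - c) \<bullet> (x - c)) ^ m"

lemma bump_nonzero_iff: "0 < r \<Longrightarrow> bump c r (Suc m) x \<noteq> 0 \<longleftrightarrow> x \<in> ball c r"
proof -
  assume r: "0 < r"
  have "(x - c) \<bullet> (x - c) < r\<^sup>2 \<longleftrightarrow> norm (x - c) < r"
    using r abs_le_square_iff[of r "norm (x - c)"] by (simp add: power2_norm_eq_inner flip: not_le)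
  then show ?thesis
    by (auto simp: bump_def max_def dist_norm norm_minus_commute)
qed

lemma has_derivative_pos_part_power:
  fixes t :: real
  shows "((\<lambda>t::real. max 0 t ^ Suc (Suc m)) has_real_derivative (real (Suc (Suc m)) * max 0 t ^ Suc m)) (at t)"
proof -
  consider "t < 0" | "t = 0" | "t > 0" by linarith
  then show ?thesis
  proof cases
    case 1
    have "((\<lambda>t::real. 0) has_real_derivative (real (Suc (Suc m)) * max 0 t ^ Suc m)) (at t)"
      using 1 by (simp add: max_def)
    then show ?thesis
      by (rule has_field_derivative_transform_within_open[where S = "{..<0}"]) (use 1 in auto)
  next
    case 3
    have "((\<lambda>t::real. t ^ Suc (Suc m)) has_real_derivative (real (Suc (Suc m)) * max 0 t ^ Suc m)) (at t)"
      using 3 DERIV_pow[of "Suc (Suc m)" t] by (simp add: max_def)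
    then show ?thesis
      by (rule has_field_derivative_transform_within_open[where S = "{0<..}"]) (use 3 in auto)
  next
    case 2
    have "((\<lambda>y::real. max 0 y ^ Suc m) \<longlongrightarrow> max 0 0 ^ Suc m) (at 0)"
      by (intro tendsto_intros)
    moreover have "\<forall>\<^sub>F y::real in at 0. max 0 y ^ Suc m = max 0 y ^ Suc (Suc m) / y"
      by (auto simp: eventually_at_filter max_def)
    ultimately have "((\<lambda>y::real. max 0 y ^ Suc (Suc m) / y) \<longlongrightarrow> max 0 0 ^ Suc m) (at 0)"
      by (rule Lim_transform_eventually)
    then show ?thesis
      unfolding 2 by (simp add: has_field_derivative_iff)
  qed
qed

text \<open>
  The partial derivatives of a bump function are linear functions times the bump function with the
  exponent lowered by one.
\<close>

lemma C_k_bump: "C_k k (bump c r (Suc k))"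
proof (induction k)
  case 0
  show ?case by (auto simp: bump_def intro!: continuous_intros)
next
  case (Suc k)
  let ?D = "\<lambda>x h. - 2 * ((x - c) \<bullet> h) * (Suc (Suc k) * max 0 (r\<^sup>2 - (x - c) \<bullet> (x - c)) ^ Suc k)"
  have "C_k (Suc k) (\<lambda>x. max 0 (r\<^sup>2 - (x - c) \<bullet> (x - c)) ^ Suc (Suc k))"
  proof (rule C_k_SucI[where D = ?D])
    fix x
    have "((\<lambda>x. r\<^sup>2 - (x - c) \<bullet> (x - c)) has_derivative (\<lambda>h. - 2 * ((x - c) \<bullet> h))) (at x)"
      by (auto intro!: derivative_eq_intros simp: inner_commute)
    from DERIV_compose_FDERIV[OF has_derivative_pos_part_power this]
    show "((\<lambda>x. max 0 (r\<^sup>2 - (x - c) \<bullet> (x - c)) ^ Suc (Suc k)) has_derivative ?D x) (at x)" .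
  next
    fix i :: 'a assume "i \<in> Basis"
    have "C_k k (\<lambda>x. (- 2 * real (Suc (Suc k))) * ((x \<bullet> i + (- (c \<bullet> i))) * bump c r (Suc k) x))"
      by (intro C_k_mult C_k_const C_k_inner Suc)
    then show "C_k k (\<lambda>x. ?D x i)"
      by (simp add: bump_def inner_diff_left algebra_simps)
  qed
  then show ?case unfolding bump_def[abs_def] .
qed

lemma C_cI:
  assumes "C_k k \<phi>" "compact K" "K \<subseteq> \<Omega>" "\<And>x. x \<notin> K \<Longrightarrow> \<phi> x = 0"
  shows "\<phi> \<in> C_c k \<Omega>"
proof -
  have "closure {x. \<phi> x \<noteq> 0} \<subseteq> K"
    using assms by (intro closure_minimal) (auto simp: compact_imp_closed)
  moreover from this have "compact (closure {x. \<phi> x \<noteq> 0})"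
    using assms(2) by (meson bounded_subset closed_closure compact_eq_bounded_closed)
  ultimately show ?thesis using assms unfolding C_c_def by auto
qed

lemma C_cE:
  assumes "\<phi> \<in> C_c k \<Omega>"
  obtains K where "C_k k \<phi>" "compact K" "K \<subseteq> \<Omega>" "\<And>x. x \<notin> K \<Longrightarrow> \<phi> x = 0"
proof (rule that)
  show "\<phi> x = 0" if "x \<notin> closure {x. \<phi> x \<noteq> 0}" for x
    using that closure_subset[of "{x. \<phi> x \<noteq> 0}"] by auto
qed (use assms in \<open>auto simp: C_c_def\<close>)

lemma C_c_mult: "\<phi> \<in> C_c k \<Omega> \<Longrightarrow> C_k k g \<Longrightarrow> (\<lambda>x. \<phi> x * g x) \<in> C_c k \<Omega>"
proof (erule C_cE)
  fix K
  assume g: "C_k k g" and K: "C_k k \<phi>" "compact K" "K \<subseteq> \<Omega>" "\<And>x. x \<notin> K \<Longrightarrow> \<phi> x = 0"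
  show ?thesis
    by (rule C_cI[OF C_k_mult[OF K(1) g] K(2,3)]) (simp add: K(4))
qed

lemma C_c_add: "\<phi> \<in> C_c k \<Omega> \<Longrightarrow> \<psi> \<in> C_c k \<Omega> \<Longrightarrow> (\<lambda>x. \<phi> x + \<psi> x) \<in> C_c k \<Omega>"
proof (elim C_cE)
  fix K L
  assume K: "C_k k \<phi>" "compact K" "K \<subseteq> \<Omega>" "\<And>x. x \<notin> K \<Longrightarrow> \<phi> x = 0"
    and L: "C_k k \<psi>" "compact L" "L \<subseteq> \<Omega>" "\<And>x. x \<notin> L \<Longrightarrow> \<psi> x = 0"
  show ?thesis
    by (rule C_cI[OF C_k_add[OF K(1) L(1)] compact_Un[OF K(2) L(2)]]) (use K L in auto)
qed

lemma C_c_mono: "\<phi> \<in> C_c k \<Omega> \<Longrightarrow> m \<le> k \<Longrightarrow> \<Omega> \<subseteq> \<Omega>' \<Longrightarrow> \<phi> \<in> C_c m \<Omega>'"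
  by (auto simp: C_c_def C_k_mono)

lemma C_c_partial:
  assumes "\<phi> \<in> C_c (Suc k) \<Omega>" "i \<in> Basis"
  shows "partial i \<phi> \<in> C_c k \<Omega>"
  using assms(1)
proof (rule C_cE)
  fix K assume K: "C_k (Suc k) \<phi>" "compact K" "K \<subseteq> \<Omega>" "\<And>x. x \<notin> K \<Longrightarrow> \<phi> x = 0"
  have "partial i \<phi> x = 0" if "x \<notin> K" for x
  proof -
    have "((\<lambda>x. 0) has_derivative (\<lambda>h. 0)) (at x)" by simp
    then have "(\<phi> has_derivative (\<lambda>h. 0)) (at x)"
      by (rule has_derivative_transform_within_open[where s = "- K"])
        (use that K compact_imp_closed in auto)
    then show ?thesis by (rule partial_eqI)
  qed
  with K assms(2) show ?thesis by (auto intro: C_cI)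
qed

lemma bump_mem_C_c: "0 < r \<Longrightarrow> cball c r \<subseteq> \<Omega> \<Longrightarrow> bump c r (Suc k) \<in> C_c k \<Omega>"
  by (rule C_cI[where K = "cball c r", OF C_k_bump])
    (use bump_nonzero_iff[of r c k] in \<open>force simp: mem_ball\<close>)+

interpretation C_c: function_space "C_c k \<Omega>" for k and \<Omega> :: "'a::euclidean_space set"
proof
  show "(\<lambda>x. 0) \<in> C_c k \<Omega>" by (rule C_cI[where K = "{}"]) (auto intro: C_k_const)
next
  fix f c assume "f \<in> C_c k \<Omega>"
  from C_c_mult[OF this C_k_const[of k c]] show "(\<lambda>x. c * f x) \<in> C_c k \<Omega>"
    by (simp add: mult.commute)
qed (rule C_c_add)

lemma C_c_integrable_lborel:
  fixes g :: "'a::euclidean_space \<Rightarrow> real"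
  assumes "g \<in> C_c k \<Omega>"
  shows "integrable lborel g"
  using assms
proof (rule C_cE)
  fix K assume K: "C_k k g" "compact K" "K \<subseteq> \<Omega>" "\<And>x. x \<notin> K \<Longrightarrow> g x = 0"
  have "integrable lborel (\<lambda>x. indicator K x *\<^sub>R g x)"
    using K C_k_imp_continuous by (intro borel_integrable_compact) auto
  moreover have "(\<lambda>x. indicator K x *\<^sub>R g x) = g"
    using K(4) by (auto simp: indicator_def fun_eq_iff)
  ultimately show ?thesis by simp
qed

text \<open>
  The difference quotients in direction \<open>i\<close> have integral zero by translation invariance of Lebesgue
  measure, and they converge dominatedly to the partial derivative.
\<close>

lemma integral_partial_eq_0:
  fixes \<psi> :: "'a::euclidean_space \<Rightarrow> real"
  assumes \<psi>: "\<psi> \<in> C_c (Suc 0) UNIV" and i: "i \<in> Basis"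
  shows "(\<integral>x. partial i \<psi> x \<partial>lborel) = 0"
  using \<psi>
proof (rule C_cE)
  fix K assume K: "C_k (Suc 0) \<psi>" "compact K" "K \<subseteq> UNIV" "\<And>x. x \<notin> K \<Longrightarrow> \<psi> x = 0"
  note der = C_k_Suc_has_derivative[OF K(1)]
  have cont: "continuous_on S (partial i \<psi>)" for S
    using C_k_imp_continuous[OF C_k_Suc_partial[OF K(1) i]] .
  have int: "integrable lborel \<psi>" by (rule C_c_integrable_lborel[OF \<psi>])
  have [measurable]: "\<psi> \<in> borel_measurable borel" "partial i \<psi> \<in> borel_measurable borel"
    using C_k_imp_continuous[OF K(1)] cont by (auto intro!: borel_measurable_continuous_onI)
  \<comment> \<open>The step sizes are at most 1, so the difference quotients are supported in the ball of radius
    R + 1, and the mean value theorem evaluates the derivative in the ball of radius R + 2.\<close>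
  obtain R where R: "0 < R" "K \<subseteq> cball 0 R"
    using compact_imp_bounded[OF K(2)] that unfolding bounded_pos by (metis mem_cball_0 subsetI)
  have "bounded (partial i \<psi> ` cball 0 (R + 2))"
    by (intro compact_imp_bounded compact_continuous_image cont compact_cball)
  then obtain B where B: "\<And>x. norm x \<le> R + 2 \<Longrightarrow> \<bar>partial i \<psi> x\<bar> \<le> B"
    unfolding bounded_iff by (metis image_eqI mem_cball_0 real_norm_def)
  define h where "h n = 1 / real (Suc n)" for n
  have h: "0 < h n" "h n \<le> 1" for n by (auto simp: h_def)
  have h0: "h \<longlonglongrightarrow> 0"
    unfolding h_def using LIMSEQ_inverse_real_of_nat by (simp add: divide_inverse)
  define q where "q n x = (\<psi> (h n *\<^sub>R i + x) - \<psi> x) / h n" for n x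
  have path: "((\<lambda>t. \<psi> (t *\<^sub>R i + x)) has_real_derivative partial i \<psi> (t *\<^sub>R i + x)) (at t)" for t x
  proof -
    have "((\<lambda>t. t *\<^sub>R i + x) has_derivative (\<lambda>t. t *\<^sub>R i)) (at t)"
      by (auto intro!: derivative_eq_intros)
    from has_derivative_compose[OF this der]
    have "((\<lambda>t. \<psi> (t *\<^sub>R i + x)) has_derivative
        (\<lambda>s. frechet_derivative \<psi> (at (t *\<^sub>R i + x)) (s *\<^sub>R i))) (at t)" .
    moreover have "frechet_derivative \<psi> (at y) (s *\<^sub>R i) = partial i \<psi> y * s" for y s
      using linear_scale[OF has_derivative_linear[OF der]] by (simp add: partial_def mult.commute)
    ultimately show ?thesis
      by (simp add: has_field_derivative_def)
  qed
  have q_lim: "(\<lambda>n. q n x) \<longlonglongrightarrow> partial i \<psi> x" for x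
  proof -
    have "((\<lambda>s. (\<psi> ((0 + s) *\<^sub>R i + x) - \<psi> (0 *\<^sub>R i + x)) / s) \<longlongrightarrow> partial i \<psi> (0 *\<^sub>R i + x)) (at 0)"
      using path[of x 0] unfolding DERIV_def .
    moreover have "filterlim h (at 0) sequentially"
      using h0 h by (auto simp: filterlim_at less_imp_neq[symmetric])
    ultimately show ?thesis
      unfolding q_def using filterlim_compose by fastforce
  qed
  have q_bound: "norm (q n x) \<le> indicator (cball 0 (R + 1)) x * B" for n x
  proof (cases "norm x \<le> R + 1")
    case True
    obtain z where z: "0 < z" "z < h n"
      "\<psi> (h n *\<^sub>R i + x) - \<psi> (0 *\<^sub>R i + x) = (h n - 0) * partial i \<psi> (z *\<^sub>R i + x)"
      using MVT2[OF h(1)[of n] path[of x]] by blast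
    then have "q n x = partial i \<psi> (z *\<^sub>R i + x)"
      using h(1)[of n] by (simp add: q_def)
    moreover have "norm (z *\<^sub>R i + x) \<le> R + 2"
      using norm_triangle_ineq[of "z *\<^sub>R i" x] z h(2)[of n] True i by simp
    ultimately show ?thesis using B True by simp
  next
    case False
    have "norm x \<le> norm (h n *\<^sub>R i + x) + norm (h n *\<^sub>R i)"
      using norm_triangle_ineq4[of "h n *\<^sub>R i + x" "h n *\<^sub>R i"] by simp
    then have "R < norm (h n *\<^sub>R i + x)" "R < norm x"
      using False h[of n] i by auto
    then have "\<psi> (h n *\<^sub>R i + x) = 0" "\<psi> x = 0"
      using K(4) R by (auto simp: subset_iff not_less[symmetric])
    then show ?thesis using False by (simp add: q_def)
  qed
  have "(\<lambda>n. \<integral>x. q n x \<partial>lborel) \<longlonglongrightarrow> (\<integral>x. partial i \<psi> x \<partial>lborel)"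
  proof (rule integral_dominated_convergence)
    have "integrable lborel (\<lambda>x. indicator (cball (0::'a) (R + 1)) x *\<^sub>R B)"
      by (intro borel_integrable_compact) auto
    then show "integrable lborel (\<lambda>x. indicator (cball (0::'a) (R + 1)) x * B)" by simp
  qed (use q_lim q_bound in \<open>auto simp: q_def\<close>)
  moreover have "(\<integral>x. q n x \<partial>lborel) = 0" for n
  proof -
    have "integrable (distr lborel borel ((+) (h n *\<^sub>R i))) \<psi>" "(\<integral>x. \<psi> x \<partial>distr lborel borel ((+) (h n *\<^sub>R i))) = (\<integral>x. \<psi> x \<partial>lborel)"
      using int by (simp_all add: lborel_distr_plus)
    then have "integrable lborel (\<lambda>x. \<psi> (h n *\<^sub>R i + x))"
      "(\<integral>x. \<psi> (h n *\<^sub>R i + x) \<partial>lborel) = (\<integral>x. \<psi> x \<partial>lborel)"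
      by (simp_all add: integrable_distr_eq integral_distr)
    then show ?thesis
      using int by (simp add: q_def)
  qed
  ultimately show ?thesis by (simp add: LIMSEQ_const_iff)
qed

lemma C_c_lebesgue_on:
  fixes g :: "'a::euclidean_space \<Rightarrow> real"
  assumes "g \<in> C_c k \<Omega>" "open \<Omega>"
  shows "integrable (lebesgue_on \<Omega>) g" "(\<integral>x. g x \<partial>lebesgue_on \<Omega>) = (\<integral>x. g x \<partial>lborel)"
proof -
  have int: "integrable lborel g" by (rule C_c_integrable_lborel[OF assms(1)])
  then have "integrable lebesgue g" "(\<integral>x. g x \<partial>lebesgue) = (\<integral>x. g x \<partial>lborel)"
    by (auto simp: integrable_completion integral_completion)
  moreover have "(\<lambda>x. indicator \<Omega> x *\<^sub>R g x) = g"
    using assms(1) by (elim C_cE) (force simp: indicator_def fun_eq_iff)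
  ultimately show "integrable (lebesgue_on \<Omega>) g" "(\<integral>x. g x \<partial>lebesgue_on \<Omega>) = (\<integral>x. g x \<partial>lborel)"
    using assms(2) by (simp_all add: integrable_restrict_space integral_restrict_space)
qed

lemma C_c_subset_L2: "open \<Omega> \<Longrightarrow> C_c k \<Omega> \<subseteq> L2 (lebesgue_on \<Omega>)"
proof
  fix g :: "'a \<Rightarrow> real" assume \<Omega>: "open \<Omega>" and g: "g \<in> C_c k \<Omega>"
  have "C_k k g" using g by (rule C_cE)
  then have "integrable (lebesgue_on \<Omega>) (\<lambda>x. g x * g x)"
    using g \<Omega> by (intro C_c_lebesgue_on[of _ k] C_c_mult)
  then show "g \<in> L2 (lebesgue_on \<Omega>)"
    using C_c_lebesgue_on(1)[OF g \<Omega>] by (simp add: L2_def power2_eq_square)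
qed

lemma integral_by_parts_C_c:
  fixes v \<phi> :: "'a::euclidean_space \<Rightarrow> real"
  assumes \<Omega>: "open \<Omega>" and v: "C_k (Suc 0) v" and \<phi>: "\<phi> \<in> C_c (Suc 0) \<Omega>" and i: "i \<in> Basis"
  shows "(\<integral>x. v x * partial i \<phi> x \<partial>lebesgue_on \<Omega>) = - (\<integral>x. partial i v x * \<phi> x \<partial>lebesgue_on \<Omega>)"
proof -
  have \<phi>1: "C_k (Suc 0) \<phi>" using \<phi> by (rule C_cE)
  have v0: "C_k 0 v" "C_k 0 (partial i v)" using C_k_SucD[OF v] C_k_Suc_partial[OF v i] .
  have p: "(\<lambda>x. \<phi> x * v x) \<in> C_c (Suc 0) \<Omega>" by (rule C_c_mult[OF \<phi> v])
  have 1: "(\<lambda>x. partial i \<phi> x * v x) \<in> C_c 0 \<Omega>" "(\<lambda>x. \<phi> x * partial i v x) \<in> C_c 0 \<Omega>"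
    using v0 i \<phi> by (auto intro!: C_c_mult C_c_partial simp del: C_k.simps intro: C_c_mono)
  have "0 = (\<integral>x. partial i (\<lambda>x. \<phi> x * v x) x \<partial>lborel)"
    using integral_partial_eq_0[OF _ i] C_c_mono[OF p, of "Suc 0" UNIV] by simp
  also have "\<dots> = (\<integral>x. \<phi> x * partial i v x + partial i \<phi> x * v x \<partial>lborel)"
    by (simp only: partial_mult[OF \<phi>1 v])
  also have "\<dots> = (\<integral>x. \<phi> x * partial i v x \<partial>lborel) + (\<integral>x. partial i \<phi> x * v x \<partial>lborel)"
    by (intro Bochner_Integration.integral_add C_c_integrable_lborel[OF 1(1)]
        C_c_integrable_lborel[OF 1(2)])
  finally show ?thesis
    using C_c_lebesgue_on(2)[OF 1(1) \<Omega>] C_c_lebesgue_on(2)[OF 1(2) \<Omega>] by (simp add: mult.commute)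
qed

section \<open>Exponential functions separate integrable functions\<close>

text \<open>
  The linear span of the functions \<open>exp (k \<bullet> x)\<close> is an algebra because
  \<open>exp (k \<bullet> x) * exp (l \<bullet> x) = exp ((k + l) \<bullet> x)\<close>. Exponentials are preferred to polynomials because they are
  eigenfunctions of the Laplacian.
\<close>

inductive_set exp_sums :: "('a::real_inner \<Rightarrow> real) set" where
  exp: "(\<lambda>x. c * exp (k \<bullet> x)) \<in> exp_sums"
| add: "f \<in> exp_sums \<Longrightarrow> g \<in> exp_sums \<Longrightarrow> (\<lambda>x. f x + g x) \<in> exp_sums"

lemma exp_sums_mult:
  assumes "f \<in> exp_sums" "g \<in> exp_sums"
  shows "(\<lambda>x. f x * g x) \<in> exp_sums"
  using assms
proof (induction rule: exp_sums.induct)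
  case (exp c k)
  from exp show ?case
  proof (induction rule: exp_sums.induct)
    case (exp c' k')
    have "(\<lambda>x. (c * c') * exp ((k + k') \<bullet> x)) \<in> exp_sums" by (rule exp_sums.exp)
    then show ?case by (simp add: inner_add_left exp_add mult_ac)
  next
    case (add f g)
    then show ?case using exp_sums.add[OF add.IH] by (simp add: distrib_left)
  qed
next
  case (add f h)
  then show ?case using exp_sums.add[OF add.IH] by (simp add: distrib_right)
qed

lemma exp_sums_continuous: "f \<in> exp_sums \<Longrightarrow> continuous_on S f"
  by (induction rule: exp_sums.induct) (auto intro!: continuous_intros)

lemma exp_sums_dense:
  fixes g :: "'a::real_inner \<Rightarrow> real"
  assumes "compact K" "continuous_on K g" "0 < \<epsilon>"
  shows "\<exists>p\<in>exp_sums. \<forall>x\<in>K. \<bar>g x - p x\<bar> < \<epsilon>"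
proof -
  interpret function_ring_on exp_sums K
  proof
    show "(\<lambda>_. c) \<in> (exp_sums :: ('a \<Rightarrow> real) set)" for c
      using exp_sums.exp[of c 0] by simp
  next
    fix x y :: 'a assume "x \<noteq> y"
    then have "(x - y) \<bullet> x \<noteq> (x - y) \<bullet> y"
      using inner_eq_zero_iff[of "x - y"] by (simp add: inner_diff_right)
    moreover have "(\<lambda>z. 1 * exp ((x - y) \<bullet> z)) \<in> exp_sums" by (rule exp_sums.exp)
    ultimately show "\<exists>f\<in>exp_sums. f x \<noteq> f y"
      by (intro bexI[of _ "\<lambda>z. 1 * exp ((x - y) \<bullet> z)"]) auto
  qed (use assms(1) in \<open>auto intro: exp_sums_continuous exp_sums.add exp_sums_mult\<close>)
  show ?thesis by (rule Stone_Weierstrass_basic) (fact assms)+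
qed

lemma AE_eq_0_if_set_integrals_eq_0:
  fixes f :: "'b \<Rightarrow> real"
  assumes int: "integrable N f" and zero: "\<And>A. A \<in> sets N \<Longrightarrow> (LINT x:A|N. f x) = 0"
  shows "AE x in N. f x = 0"
proof -
  have [measurable]: "f \<in> borel_measurable N" using int by auto
  have half: "AE x in N. c * f x \<le> 0" for c :: real
  proof -
    let ?A = "{x \<in> space N. 0 < c * f x}"
    have A: "?A \<in> sets N" by measurable
    have "integrable N (\<lambda>x. indicator ?A x * (c * f x))"
      using integrable_real_mult_indicator[OF A, of "\<lambda>x. c * f x"] int by (simp add: mult.commute)
    moreover have "(\<integral>x. indicator ?A x * (c * f x) \<partial>N) = 0"
      using zero[OF A] by (simp add: set_lebesgue_integral_def mult.left_commute[of _ c])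
    moreover have "AE x in N. 0 \<le> indicator ?A x * (c * f x)"
      by (auto simp: indicator_def)
    ultimately have "AE x in N. indicator ?A x * (c * f x) = 0"
      by (simp add: integral_nonneg_eq_0_iff_AE)
    with AE_space show ?thesis
      by eventually_elim (auto simp: indicator_def split: if_splits)
  qed
  show ?thesis using half[of 1] half[of "-1"] by eventually_elim auto
qed

text \<open>
  The hypothesis extends from exponentials to all continuous functions by Stone--Weierstrass, to indicator
  functions of closed sets by dominated convergence, and to all Borel sets by Dynkin's argument. The
  measure \<open>N\<close> stands for Lebesgue measure and for Hausdorff measure.
\<close>

lemma exp_integrals_determine:
  fixes f :: "'a::euclidean_space \<Rightarrow> real"
  assumes N: "sets N = sets borel" and int: "integrable N f"
    and K: "compact K" "\<And>x. x \<notin> K \<Longrightarrow> f x = 0"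
    and zero: "\<And>k. (\<integral>x. f x * exp (k \<bullet> x) \<partial>N) = 0"
  shows "AE x in N. f x = 0"
proof -
  note [measurable_cong] = N
  have [measurable]: "f \<in> borel_measurable N" using int by auto
  have int_mult: "integrable N (\<lambda>x. f x * g x)" if g: "continuous_on UNIV g" for g
  proof -
    have [measurable]: "g \<in> borel_measurable borel"
      using g by (rule borel_measurable_continuous_onI)
    have "bounded (g ` K)"
      by (intro compact_imp_bounded compact_continuous_image K continuous_on_subset[OF g]) auto
    then obtain B where B: "\<And>x. x \<in> K \<Longrightarrow> \<bar>g x\<bar> \<le> B"
      unfolding bounded_iff by (metis image_eqI real_norm_def)
    show ?thesis
    proof (rule Bochner_Integration.integrable_bound)
      show "integrable N (\<lambda>x. B * f x)" using int by simp
      have "norm (f x * g x) \<le> norm (B * f x)" for x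
      proof (cases "x \<in> K")
        case True
        then have "\<bar>f x\<bar> * \<bar>g x\<bar> \<le> \<bar>f x\<bar> * \<bar>B\<bar>"
          using B[OF True] by (intro mult_left_mono) auto
        then show ?thesis by (simp add: abs_mult mult.commute)
      qed (simp add: K)
      then show "AE x in N. norm (f x * g x) \<le> norm (B * f x)" by simp
    qed measurable
  qed
  have exp_sums_zero: "(\<integral>x. f x * p x \<partial>N) = 0" if "p \<in> exp_sums" for p
    using that
  proof (induction rule: exp_sums.induct)
    case (exp c k)
    then show ?case using zero[of k] by (simp add: mult.left_commute[of _ c])
  next
    case (add p q)
    then show ?case
      by (simp add: distrib_left int_mult exp_sums_continuous)
  qed
  have cont_zero: "(\<integral>x. f x * g x \<partial>N) = 0" if g: "continuous_on UNIV g" for g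
  proof (rule ccontr)
    let ?I = "\<integral>x. f x * g x \<partial>N" and ?J = "\<integral>x. \<bar>f x\<bar> \<partial>N"
    assume nz: "?I \<noteq> 0"
    \<comment> \<open>The summand 1 avoids a division by zero and makes the final estimate strict.\<close>
    define \<epsilon> where "\<epsilon> = \<bar>?I\<bar> / (?J + 1)"
    have J: "0 \<le> ?J" by simp
    then have "0 < \<epsilon>" using nz unfolding \<epsilon>_def by (intro divide_pos_pos add_nonneg_pos) auto
    then obtain p where p: "p \<in> exp_sums" "\<And>x. x \<in> K \<Longrightarrow> \<bar>g x - p x\<bar> < \<epsilon>"
      using exp_sums_dense[OF K(1) continuous_on_subset[OF g]] by blast
    have "?I = (\<integral>x. f x * g x - f x * p x \<partial>N)"
      using exp_sums_zero[OF p(1)] int_mult[OF g] int_mult[OF exp_sums_continuous[OF p(1)]] by simp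
    also have "\<bar>\<dots>\<bar> \<le> (\<integral>x. \<epsilon> * \<bar>f x\<bar> \<partial>N)"
    proof (rule integral_abs_bound_integral)
      fix x
      show "\<bar>f x * g x - f x * p x\<bar> \<le> \<epsilon> * \<bar>f x\<bar>"
      proof (cases "x \<in> K")
        case True
        then have "\<bar>f x\<bar> * \<bar>g x - p x\<bar> \<le> \<bar>f x\<bar> * \<epsilon>"
          using p(2) by (intro mult_left_mono) (auto simp: less_imp_le)
        then show ?thesis by (simp add: mult.commute flip: abs_mult right_diff_distrib)
      qed (simp add: K)
    qed (use int int_mult[OF g] int_mult[OF exp_sums_continuous[OF p(1)]] in auto)
    also have "\<dots> = \<epsilon> * ?J" by simp
    also have "\<dots> < \<bar>?I\<bar>"
    proof -
      have "\<epsilon> * ?J < \<epsilon> * (?J + 1)" using \<open>0 < \<epsilon>\<close> by simp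
      also have "\<dots> = \<bar>?I\<bar>" using add_nonneg_pos[OF J zero_less_one] by (simp add: \<epsilon>_def)
      finally show ?thesis .
    qed
    finally show False by simp
  qed
  have closed_zero: "(LINT x:C|N. f x) = 0" if C: "closed C" for C
  proof (cases "C = {}")
    case False
    \<comment> \<open>Continuous functions that decrease to the indicator function of C.\<close>
    define g where "g n x = max 0 (1 - real n * infdist x C)" for n x
    have g: "continuous_on UNIV (g n)" for n
      unfolding g_def[abs_def] by (intro continuous_intros)
    have [measurable]: "C \<in> sets borel" "g n \<in> borel_measurable borel" for n
      using C borel_measurable_continuous_onI[OF g] by auto
    have lim: "(\<lambda>n. g n x) \<longlonglongrightarrow> indicator C x" for x
    proof (cases "x \<in> C")
      case True
      then show ?thesis by (simp add: g_def)
    next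
      case out: False
      then have pos: "0 < infdist x C"
        using C False in_closed_iff_infdist_zero[of C x] infdist_nonneg[of x C] by simp
      obtain n0 where n0: "1 < real n0 * infdist x C"
        using ex_less_of_nat_mult[OF pos] by blast
      have "g n x = 0" if "n \<ge> n0" for n
      proof -
        have "real n0 * infdist x C \<le> real n * infdist x C"
          using that pos by (intro mult_right_mono) auto
        with n0 show ?thesis by (simp add: g_def)
      qed
      then show ?thesis
        using out by (intro tendsto_eventually) (auto simp: eventually_sequentially)
    qed
    have "(\<lambda>n. \<integral>x. f x * g n x \<partial>N) \<longlonglongrightarrow> (\<integral>x. f x * indicator C x \<partial>N)"
    proof (rule integral_dominated_convergence)
      show "integrable N (\<lambda>x. \<bar>f x\<bar>)" using int by simp
      have "\<bar>g n x\<bar> \<le> 1" for n x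
        using infdist_nonneg[of x C] by (auto simp: g_def)
      then have "norm (f x * g n x) \<le> \<bar>f x\<bar>" for n x
        using mult_left_mono[of "\<bar>g n x\<bar>" 1 "\<bar>f x\<bar>"] by (simp add: abs_mult)
      then show "AE x in N. norm (f x * g n x) \<le> \<bar>f x\<bar>" for n by simp
    qed (auto intro!: tendsto_intros lim)
    then show ?thesis
      by (simp add: cont_zero[OF g] LIMSEQ_const_iff set_lebesgue_integral_def mult.commute)
  qed (simp add: set_lebesgue_integral_def)
  have "(LINT x:A|N. f x) = 0" if "A \<in> sets N" for A
  proof -
    have sint: "set_integrable N B f" if "B \<in> sets N" for B
      using that int unfolding set_integrable_def by (intro integrable_mult_indicator)
    have sig: "sets N = sigma_sets UNIV (Collect closed)"
      by (simp add: N borel_eq_closed)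
    have "Int_stable (Collect (closed :: 'a set \<Rightarrow> bool))"
      by (auto simp: Int_stable_def)
    moreover have "Collect closed \<subseteq> Pow (UNIV :: 'a set)" by simp
    moreover have "A \<in> sigma_sets UNIV (Collect closed)" using that sig by simp
    ultimately show ?thesis
    proof (induction rule: sigma_sets_induct_disjoint)
      case (basic B)
      then show ?case using closed_zero by simp
    next
      case empty
      show ?case by (simp add: set_lebesgue_integral_def)
    next
      case (compl B)
      then have B: "B \<in> sets N" by (simp add: sig)
      have "UNIV - B \<in> sets N" using B N by auto
      have "(LINT x:B \<union> (UNIV - B)|N. f x) = (LINT x:B|N. f x) + (LINT x:UNIV - B|N. f x)"
        using B \<open>UNIV - B \<in> sets N\<close> by (intro set_integral_Un sint) auto
      then show ?case using compl closed_zero[of UNIV] by simp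
    next
      case (union B)
      then have B: "B i \<in> sets N" for i by (auto simp: sig)
      then have "(LINT x:(\<Union>i. B i)|N. f x) = (\<Sum>i. LINT x:B i|N. f x)"
        using union(1)
        by (intro lebesgue_integral_countable_add sint) (auto simp: disjoint_family_on_def)
      then show ?case using union(3) by simp
    qed
  qed
  with int show ?thesis by (rule AE_eq_0_if_set_integrals_eq_0)
qed

text \<open>
  A Lebesgue measurable function is replaced by a Borel function that agrees with it almost everywhere.
\<close>

lemma exp_integrals_determine_lebesgue:
  fixes f :: "'a::euclidean_space \<Rightarrow> real"
  assumes \<Omega>: "\<Omega> \<in> sets lebesgue" and int: "integrable (lebesgue_on \<Omega>) f"
    and K: "compact K" "\<And>x. x \<in> \<Omega> - K \<Longrightarrow> f x = 0"
    and zero: "\<And>k. (\<integral>x. f x * exp (k \<bullet> x) \<partial>lebesgue_on \<Omega>) = 0"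
  shows "AE x in lebesgue_on \<Omega>. f x = 0"
proof -
  define F where "F x = indicator \<Omega> x * f x" for x
  have intF: "integrable lebesgue F"
    using int \<Omega> by (simp add: F_def[abs_def] integrable_restrict_space)
  then have "F \<in> borel_measurable lebesgue" by auto
  then obtain F' where F' [measurable]: "F' \<in> borel_measurable lborel" and eq: "AE x in lborel. F x = F' x"
    using completion_ex_borel_measurable_real by blast
  define G where "G x = indicator K x * F' x" for x
  have [measurable]: "K \<in> sets borel" using K(1) by (simp add: borel_compact)
  have [measurable]: "G \<in> borel_measurable lborel" unfolding G_def[abs_def] by measurable
  have FK: "x \<notin> K \<Longrightarrow> F x = 0" for x
    using K(2) by (auto simp: F_def indicator_def)
  from eq have "AE x in lborel. F x = G x"
  proof eventually_elim
    case (elim x)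
    then show ?case using FK[of x] by (auto simp: G_def indicator_def)
  qed
  then have eqG: "AE x in lebesgue. F x = G x" by (rule AE_completion)
  have G_leb: "G \<in> borel_measurable lebesgue"
    by (rule measurable_completion) measurable
  have "integrable lebesgue G"
    using intF eqG G_leb by (subst integrable_cong_AE[of G _ F]) auto
  then have "integrable lborel G" by (simp add: integrable_completion)
  moreover have "(\<integral>x. G x * exp (k \<bullet> x) \<partial>lborel) = 0" for k
  proof -
    have [measurable]: "(\<lambda>x. exp (k \<bullet> x)) \<in> borel_measurable borel"
      by (intro borel_measurable_continuous_onI continuous_intros)
    have "(\<integral>x. G x * exp (k \<bullet> x) \<partial>lborel) = (\<integral>x. G x * exp (k \<bullet> x) \<partial>lebesgue)"
      by (rule integral_completion[symmetric]) measurable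
    also have "\<dots> = (\<integral>x. F x * exp (k \<bullet> x) \<partial>lebesgue)"
      using eqG intF G_leb measurable_completion[of "\<lambda>x. exp (k \<bullet> x)" lborel borel]
      by (intro integral_cong_AE borel_measurable_times) auto
    also have "\<dots> = (\<integral>x. f x * exp (k \<bullet> x) \<partial>lebesgue_on \<Omega>)"
      using \<Omega> by (simp add: integral_restrict_space F_def mult.assoc)
    finally show ?thesis using zero by simp
  qed
  ultimately have "AE x in lborel. G x = 0"
    using K(1) by (intro exp_integrals_determine[of lborel G K]) (auto simp: G_def)
  then have "AE x in lebesgue. G x = 0" by (rule AE_completion)
  with eqG have "AE x in lebesgue. x \<in> \<Omega> \<longrightarrow> f x = 0"
    by eventually_elim (auto simp: F_def)
  then show ?thesis using \<Omega> by (simp add: AE_restrict_space_iff)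
qed

text \<open>
  The fundamental lemma of the calculus of variations for test functions of finite smoothness. On a ball
  inside \<open>\<Omega>\<close> with bump function \<open>b\<close>, the products \<open>b(x) exp (l \<bullet> x)\<close> are test functions, so the product of \<open>f\<close>
  and \<open>b\<close> integrates to zero against all exponentials and vanishes. Countably many balls cover \<open>\<Omega>\<close>.
\<close>

lemma fundamental_lemma:
  fixes f :: "'a::euclidean_space \<Rightarrow> real"
  assumes \<Omega>: "open \<Omega>" and f: "f \<in> L2 (lebesgue_on \<Omega>)"
    and zero: "\<And>\<phi>. \<phi> \<in> C_c k \<Omega> \<Longrightarrow> (\<integral>x. f x * \<phi> x \<partial>lebesgue_on \<Omega>) = 0"
  shows "AE x in lebesgue_on \<Omega>. f x = 0"
proof -
  define \<F> where "\<F> = {ball c r | c r. 0 < r \<and> cball c r \<subseteq> \<Omega>}"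
  have "\<And>B. B \<in> \<F> \<Longrightarrow> open B" by (auto simp: \<F>_def)
  then obtain \<F>' where \<F>': "\<F>' \<subseteq> \<F>" "countable \<F>'" "\<Union>\<F>' = \<Union>\<F>"
    by (rule Lindelof)
  have "AE x in lebesgue_on \<Omega>. x \<in> B \<longrightarrow> f x = 0" if "B \<in> \<F>'" for B
  proof -
    obtain c r where cr: "B = ball c r" "0 < r" "cball c r \<subseteq> \<Omega>"
      using \<open>B \<in> \<F>'\<close> \<F>'(1) unfolding \<F>_def by auto
    let ?b = "bump c r (Suc k)"
    have b: "?b \<in> C_c k \<Omega>" by (rule bump_mem_C_c[OF cr(2,3)])
    have "AE x in lebesgue_on \<Omega>. f x * ?b x = 0"
    proof (rule exp_integrals_determine_lebesgue)
      show "\<Omega> \<in> sets lebesgue" using \<Omega> by auto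
      show "integrable (lebesgue_on \<Omega>) (\<lambda>x. f x * ?b x)"
        using f b C_c_subset_L2[OF \<Omega>] by (intro L2_mult_integrable) auto
      show "f x * ?b x = 0" if "x \<in> \<Omega> - cball c r" for x
        using that bump_nonzero_iff[OF cr(2), of c k x] by auto
      fix l
      show "(\<integral>x. f x * ?b x * exp (l \<bullet> x) \<partial>lebesgue_on \<Omega>) = 0"
        using zero[OF C_c_mult[OF b C_k_exp_inner[of k l]]] by (simp add: mult.assoc)
    qed simp
    then show ?thesis
      by eventually_elim (use bump_nonzero_iff[OF cr(2), of c k] cr(1) in auto)
  qed
  then have "AE x in lebesgue_on \<Omega>. \<forall>B\<in>\<F>'. x \<in> B \<longrightarrow> f x = 0"
    unfolding AE_ball_countable[OF \<F>'(2)] by blast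
  moreover have "AE x in lebesgue_on \<Omega>. x \<in> \<Omega>"
    using AE_space[of "lebesgue_on \<Omega>"] by simp
  ultimately show ?thesis
  proof eventually_elim
    case (elim x)
    obtain r where "0 < r" "cball x r \<subseteq> \<Omega>"
      using \<Omega> elim(2) open_contains_cball by blast
    then have "ball x r \<in> \<F>" by (auto simp: \<F>_def)
    moreover have "x \<in> ball x r" using \<open>0 < r\<close> by simp
    ultimately have "x \<in> \<Union>\<F>'" unfolding \<F>'(3) by (rule UnionI)
    then show ?case using elim(1) by auto
  qed
qed

lemma L2_bounded:
  assumes "finite_measure M" "g \<in> borel_measurable M" "\<And>x. x \<in> space M \<Longrightarrow> \<bar>g x\<bar> \<le> B"
  shows "g \<in> L2 M"
proof -
  interpret finite_measure M by fact
  have "integrable M (\<lambda>x. (g x)\<^sup>2)"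
  proof (rule integrable_const_bound[where B = "B\<^sup>2"])
    show "AE x in M. norm ((g x)\<^sup>2) \<le> B\<^sup>2"
      using assms(3) by (intro AE_I2) (simp add: abs_le_square_iff[symmetric] order_trans[OF _ abs_ge_self])
  qed (use assms(2) in simp)
  with assms(2) show ?thesis by (simp add: L2_def)
qed

lemma continuous_mem_L2:
  fixes g :: "'a::euclidean_space \<Rightarrow> real"
  assumes "finite_measure M" "bounded (space M)" "continuous_on UNIV g" "g \<in> borel_measurable M"
  shows "g \<in> L2 M"
proof -
  have "bounded (g ` closure (space M))"
    using assms(2)
    by (intro compact_imp_bounded compact_continuous_image continuous_on_subset[OF assms(3)])
      (auto simp: compact_closure)
  then obtain B where "\<And>x. x \<in> closure (space M) \<Longrightarrow> \<bar>g x\<bar> \<le> B"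
    unfolding bounded_iff by (metis image_eqI real_norm_def)
  then show ?thesis
    using closure_subset by (intro L2_bounded[OF assms(1,4), of B]) blast
qed

lemma continuous_mem_L2_lebesgue_on:
  fixes g :: "'a::euclidean_space \<Rightarrow> real"
  assumes "open \<Omega>" "bounded \<Omega>" "continuous_on UNIV g"
  shows "g \<in> L2 (lebesgue_on \<Omega>)"
proof (rule continuous_mem_L2)
  show "finite_measure (lebesgue_on \<Omega>)"
    using assms lmeasurable_open by (intro finite_measure_lebesgue_on)
  have "g \<in> borel_measurable lebesgue"
    using borel_measurable_continuous_onI[OF assms(3)] by (intro measurable_completion) simp
  then show "g \<in> borel_measurable (lebesgue_on \<Omega>)" by (rule measurable_restrict_space1)
qed (use assms in auto)

lemma sets_hausdorff_measure: "sets (hausdorff_measure s) = sets borel"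
  unfolding hausdorff_measure_def by (metis sets.sigma_sets_eq sets_measure_of space_borel subset_Pow_Union
      sets.space_closed)

lemma frontier_in_sets_hausdorff: "frontier \<Omega> \<inter> space (hausdorff_measure s) \<in> sets (hausdorff_measure s)"
  unfolding sets_hausdorff_measure sets_eq_imp_space_eq[OF sets_hausdorff_measure] by auto

lemma space_surface_measure: "space (surface_measure \<Omega>) = frontier \<Omega>"
  by (simp add: surface_measure_def space_restrict_space
      sets_eq_imp_space_eq[OF sets_hausdorff_measure])

lemma finite_surface_measure:
  assumes "B1 \<Omega>"
  shows "finite_measure (surface_measure \<Omega>)"
proof
  let ?H = "hausdorff_measure (real (DIM('a) - 1)) :: 'a measure"
  obtain \<S> where \<S>: "finite \<S>" "\<Union>\<S> = frontier \<Omega>" "\<And>S. S \<in> \<S> \<Longrightarrow> compact S"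
    "\<And>S. S \<in> \<S> \<Longrightarrow> emeasure ?H S < \<infinity>"
    using assms unfolding B1_def closed_lipschitz_surface_def by auto
  have "emeasure ?H (\<Union>S\<in>\<S>. S) \<le> (\<Sum>S\<in>\<S>. emeasure ?H S)"
    using \<S>(1,3) by (intro emeasure_subadditive_finite) (auto simp: sets_hausdorff_measure borel_compact)
  also have "\<dots> < \<infinity>" using \<S>(1,4) by (simp add: less_top)
  finally show "emeasure (surface_measure \<Omega>) (space (surface_measure \<Omega>)) \<noteq> \<infinity>"
    using \<S>(2) frontier_in_sets_hausdorff[of \<Omega>] unfolding space_surface_measure
    by (simp add: surface_measure_def emeasure_restrict_space)
qed

lemma continuous_mem_L2_surface:
  fixes g :: "'a::euclidean_space \<Rightarrow> real"
  assumes "B1 \<Omega>" "continuous_on UNIV g"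
  shows "g \<in> L2 (surface_measure \<Omega>)"
proof (rule continuous_mem_L2)
  show "finite_measure (surface_measure \<Omega>)" by (rule finite_surface_measure) fact
  show "bounded (space (surface_measure \<Omega>))"
    using assms(1) by (simp add: space_surface_measure B1_def compact_frontier_bounded compact_imp_bounded)
  have "g \<in> borel_measurable (hausdorff_measure (real (DIM('a) - 1)))"
    using borel_measurable_continuous_onI[OF assms(2)]
    by (simp add: measurable_cong_sets[OF sets_hausdorff_measure refl])
  then show "g \<in> borel_measurable (surface_measure \<Omega>)"
    unfolding surface_measure_def by (rule measurable_restrict_space1)
qed fact

lemma L2_integrable:
  assumes "finite_measure M" "f \<in> L2 M"
  shows "integrable M f"
proof -
  have "(\<lambda>x. 1) \<in> L2 M" by (rule L2_bounded[OF assms(1), where B = 1]) auto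
  from L2_mult_integrable[OF assms(2) this] show ?thesis by simp
qed

lemma exp_integrals_determine_surface:
  fixes d :: "'a::euclidean_space \<Rightarrow> real"
  assumes B1: "B1 \<Omega>" and d: "d \<in> L2 (surface_measure \<Omega>)"
    and zero: "\<And>k. (\<integral>x. exp (k \<bullet> x) * d x \<partial>surface_measure \<Omega>) = 0"
  shows "AE x in surface_measure \<Omega>. d x = 0"
proof -
  let ?H = "hausdorff_measure (real (DIM('a) - 1)) :: 'a measure"
  note fr = frontier_in_sets_hausdorff[of \<Omega> "real (DIM('a) - 1)"]
  have "AE x in ?H. indicator (frontier \<Omega>) x * d x = 0"
  proof (rule exp_integrals_determine[OF sets_hausdorff_measure])
    show "integrable ?H (\<lambda>x. indicator (frontier \<Omega>) x * d x)"
      using L2_integrable[OF finite_surface_measure[OF B1] d] fr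
      by (simp add: surface_measure_def integrable_restrict_space)
    show "compact (frontier \<Omega>)" using B1 by (simp add: B1_def compact_frontier_bounded)
    show "(\<integral>x. indicator (frontier \<Omega>) x * d x * exp (k \<bullet> x) \<partial>?H) = 0" for k
      using zero[of k] fr by (simp add: surface_measure_def integral_restrict_space mult_ac)
  qed simp
  then have "AE x in ?H. x \<in> frontier \<Omega> \<longrightarrow> d x = 0"
    by eventually_elim auto
  then show ?thesis
    unfolding surface_measure_def AE_restrict_space_iff[OF fr] .
qed

section \<open>Sobolev spaces on a bounded open set\<close>

locale bounded_open_set =
  fixes \<Omega> :: "'a::euclidean_space set"
  assumes open_domain: "open \<Omega>" and bounded_domain: "bounded \<Omega>"
begin

abbreviation "dx \<equiv> lebesgue_on \<Omega>"

lemma C_k_mem_L2: "C_k k v \<Longrightarrow> v \<in> L2 dx"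
  by (intro continuous_mem_L2_lebesgue_on open_domain bounded_domain C_k_imp_continuous)

lemma C_c_mem_L2: "\<phi> \<in> C_c k \<Omega> \<Longrightarrow> \<phi> \<in> L2 dx"
  using C_c_subset_L2[OF open_domain] by blast

lemma L2_eq_if_tested:
  assumes "f \<in> L2 dx" "g \<in> L2 dx"
    and "\<And>\<phi>. \<phi> \<in> C_c k \<Omega> \<Longrightarrow> L2_inner dx f \<phi> = L2_inner dx g \<phi>"
  shows "AE x in dx. f x = g x"
proof -
  have "AE x in dx. f x - g x = 0"
  proof (rule fundamental_lemma[OF open_domain L2.diff_mem[OF assms(1,2)]])
    fix \<phi> assume "\<phi> \<in> C_c k \<Omega>"
    then show "(\<integral>x. (f x - g x) * \<phi> x \<partial>dx) = 0"
      using L2.ip_diff[OF assms(1,2) C_c_mem_L2] assms(3) by (simp add: L2_inner_def)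
  qed
  then show ?thesis by simp
qed

definition weak_partial :: "'a \<Rightarrow> ('a \<Rightarrow> real) \<Rightarrow> 'a \<Rightarrow> real" where
  "weak_partial i u x = weak_gradient \<Omega> u x \<bullet> i"

lemma is_weak_gradient_iff:
  "is_weak_gradient \<Omega> u G \<longleftrightarrow> (\<forall>i\<in>Basis. (\<lambda>x. G x \<bullet> i) \<in> L2 dx \<and>
    (\<forall>\<phi>\<in>C_c 1 \<Omega>. L2_inner dx u (partial i \<phi>) = - L2_inner dx (\<lambda>x. G x \<bullet> i) \<phi>))"
  by (simp add: is_weak_gradient_def L2_inner_def)

lemma H1_L2: "u \<in> H1 \<Omega> \<Longrightarrow> u \<in> L2 dx"
  by (simp add: H1_def)

lemma H1_weak_gradient: "u \<in> H1 \<Omega> \<Longrightarrow> is_weak_gradient \<Omega> u (weak_gradient \<Omega> u)"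
  unfolding H1_def weak_gradient_def using someI_ex[of "is_weak_gradient \<Omega> u"] by simp

lemma weak_partial_L2: "u \<in> H1 \<Omega> \<Longrightarrow> i \<in> Basis \<Longrightarrow> weak_partial i u \<in> L2 dx"
  using H1_weak_gradient[of u] by (simp add: is_weak_gradient_iff weak_partial_def[abs_def])

lemma weak_partial_tested:
  "u \<in> H1 \<Omega> \<Longrightarrow> i \<in> Basis \<Longrightarrow> \<phi> \<in> C_c 1 \<Omega> \<Longrightarrow>
    L2_inner dx u (partial i \<phi>) = - L2_inner dx (weak_partial i u) \<phi>"
  using H1_weak_gradient[of u] by (simp add: is_weak_gradient_iff weak_partial_def[abs_def])

lemma partial_C_c_L2: "\<phi> \<in> C_c 1 \<Omega> \<Longrightarrow> i \<in> Basis \<Longrightarrow> partial i \<phi> \<in> L2 dx"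
  using C_c_mem_L2 C_c_partial[of \<phi> 0 \<Omega> i] by simp

text \<open>
  A family of candidates for the weak partial derivatives decides membership in \<open>H\<^sup>1\<close> and identifies the
  chosen gradient. This is how the choice in \<^const>\<open>weak_gradient\<close> is eliminated.
\<close>

lemma H1_I:
  assumes u: "u \<in> L2 dx" and g: "\<And>i. i \<in> Basis \<Longrightarrow> g i \<in> L2 dx"
    and test: "\<And>i \<phi>. i \<in> Basis \<Longrightarrow> \<phi> \<in> C_c 1 \<Omega> \<Longrightarrow> L2_inner dx u (partial i \<phi>) = - L2_inner dx (g i) \<phi>"
  shows "u \<in> H1 \<Omega>" "i \<in> Basis \<Longrightarrow> AE x in dx. weak_partial i u x = g i x"
proof -
  define G where "G x = (\<Sum>i\<in>Basis. g i x *\<^sub>R i)" for x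
  have "G x \<bullet> i = g i x" if "i \<in> Basis" for i x
    using that by (simp add: G_def)
  then have "is_weak_gradient \<Omega> u G"
    using g test by (simp add: is_weak_gradient_iff)
  then show H1: "u \<in> H1 \<Omega>" using u by (auto simp: H1_def)
  show "AE x in dx. weak_partial i u x = g i x" if i: "i \<in> Basis"
    using i weak_partial_tested[OF H1 i] test[OF i] by (intro L2_eq_if_tested[where k = 1] weak_partial_L2 H1 g) auto
qed

lemma H1_add:
  assumes u: "u \<in> H1 \<Omega>" and v: "v \<in> H1 \<Omega>"
  shows "(\<lambda>x. u x + v x) \<in> H1 \<Omega>"
    and "i \<in> Basis \<Longrightarrow> AE x in dx. weak_partial i (\<lambda>x. u x + v x) x = weak_partial i u x + weak_partial i v x"
proof -
  have L: "(\<lambda>x. u x + v x) \<in> L2 dx" "\<And>i. i \<in> Basis \<Longrightarrow> (\<lambda>x. weak_partial i u x + weak_partial i v x) \<in> L2 dx"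
    using L2.add_mem[OF H1_L2[OF u] H1_L2[OF v]] L2.add_mem[OF weak_partial_L2[OF u] weak_partial_L2[OF v]] by auto
  have "L2_inner dx (\<lambda>x. u x + v x) (partial i \<phi>) = - L2_inner dx (\<lambda>x. weak_partial i u x + weak_partial i v x) \<phi>"
    if "i \<in> Basis" "\<phi> \<in> C_c 1 \<Omega>" for i \<phi>
    using that u v weak_partial_tested by (simp add: L2.ip_add H1_L2 weak_partial_L2 partial_C_c_L2 C_c_mem_L2)
  note H = H1_I[OF L(1), of "\<lambda>i x. weak_partial i u x + weak_partial i v x", OF L(2) this]
  show "(\<lambda>x. u x + v x) \<in> H1 \<Omega>" by (rule H(1))
  show "i \<in> Basis \<Longrightarrow> AE x in dx. weak_partial i (\<lambda>x. u x + v x) x = weak_partial i u x + weak_partial i v x" by (rule H(2))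
qed

lemma H1_scale:
  assumes u: "u \<in> H1 \<Omega>"
  shows "(\<lambda>x. c * u x) \<in> H1 \<Omega>"
    and "i \<in> Basis \<Longrightarrow> AE x in dx. weak_partial i (\<lambda>x. c * u x) x = c * weak_partial i u x"
proof -
  have L: "(\<lambda>x. c * u x) \<in> L2 dx" "\<And>i. i \<in> Basis \<Longrightarrow> (\<lambda>x. c * weak_partial i u x) \<in> L2 dx"
    using L2.scale_mem[OF H1_L2[OF u]] L2.scale_mem[OF weak_partial_L2[OF u]] by auto
  have "L2_inner dx (\<lambda>x. c * u x) (partial i \<phi>) = - L2_inner dx (\<lambda>x. c * weak_partial i u x) \<phi>"
    if "i \<in> Basis" "\<phi> \<in> C_c 1 \<Omega>" for i \<phi>
    using that u weak_partial_tested by (simp add: L2.ip_scale H1_L2 weak_partial_L2 partial_C_c_L2 C_c_mem_L2)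
  note H = H1_I[OF L(1), of "\<lambda>i x. c * weak_partial i u x", OF L(2) this]
  show "(\<lambda>x. c * u x) \<in> H1 \<Omega>" by (rule H(1))
  show "i \<in> Basis \<Longrightarrow> AE x in dx. weak_partial i (\<lambda>x. c * u x) x = c * weak_partial i u x" by (rule H(2))
qed

lemma C_k_H1:
  assumes v: "C_k (Suc 0) v"
  shows "v \<in> H1 \<Omega>" and "i \<in> Basis \<Longrightarrow> AE x in dx. weak_partial i v x = partial i v x"
proof -
  have L: "v \<in> L2 dx" "\<And>i. i \<in> Basis \<Longrightarrow> partial i v \<in> L2 dx"
    using C_k_mem_L2[OF v] C_k_mem_L2[OF C_k_Suc_partial[OF v]] by auto
  have "L2_inner dx v (partial i \<phi>) = - L2_inner dx (partial i v) \<phi>"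
    if "i \<in> Basis" "\<phi> \<in> C_c 1 \<Omega>" for i \<phi>
    using integral_by_parts_C_c[OF open_domain v] that by (simp add: L2_inner_def)
  note H = H1_I[OF L(1), of "\<lambda>i. partial i v", OF L(2) this]
  show "v \<in> H1 \<Omega>" by (rule H(1))
  show "i \<in> Basis \<Longrightarrow> AE x in dx. weak_partial i v x = partial i v x" by (rule H(2))
qed

lemma C_c_H1: "\<phi> \<in> C_c 1 \<Omega> \<Longrightarrow> \<phi> \<in> H1 \<Omega>"
  by (intro C_k_H1) (simp add: C_c_def)

sublocale H1: function_space "H1 \<Omega>"
  by unfold_locales
    (use C_k_H1(1)[OF C_k_const[of "Suc 0" 0]] in \<open>auto intro: H1_add H1_scale\<close>)

lemma weak_partial_pullback: "i \<in> Basis \<Longrightarrow> L2_pullback (H1 \<Omega>) (weak_partial i) dx"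
  by unfold_locales (auto intro: weak_partial_L2 H1_add H1_scale)

definition grad_inner :: "('a \<Rightarrow> real) \<Rightarrow> ('a \<Rightarrow> real) \<Rightarrow> real" where
  "grad_inner u v = (\<Sum>i\<in>Basis. L2_inner dx (weak_partial i u) (weak_partial i v))"

sublocale grad: semi_inner "H1 \<Omega>" grad_inner
  unfolding grad_inner_def[abs_def]
  by (intro semi_inner_sum L2_pullback.semi_inner weak_partial_pullback H1.function_space_axioms) auto

sublocale val: L2_pullback "H1 \<Omega>" "\<lambda>u. u" dx
  by unfold_locales (auto intro: H1_L2)

definition H1_inner :: "('a \<Rightarrow> real) \<Rightarrow> ('a \<Rightarrow> real) \<Rightarrow> real" where
  "H1_inner u v = L2_inner dx u v + grad_inner u v"

sublocale h1: semi_inner "H1 \<Omega>" H1_inner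
  unfolding H1_inner_def[abs_def]
  by (intro semi_inner_add grad.semi_inner_axioms val.semi_inner_axioms)

lemma weak_gradient_inner_integral:
  assumes "u \<in> H1 \<Omega>" "v \<in> H1 \<Omega>"
  shows "integrable dx (\<lambda>x. weak_gradient \<Omega> u x \<bullet> weak_gradient \<Omega> v x)"
    and "(\<integral>x. weak_gradient \<Omega> u x \<bullet> weak_gradient \<Omega> v x \<partial>dx) = grad_inner u v"
proof -
  have eq: "weak_gradient \<Omega> u x \<bullet> weak_gradient \<Omega> v x = (\<Sum>i\<in>Basis. weak_partial i u x * weak_partial i v x)" for x
    by (subst euclidean_inner) (simp add: weak_partial_def)
  have int: "integrable dx (\<lambda>x. weak_partial i u x * weak_partial i v x)" if "i \<in> Basis" for i
    using assms that by (intro L2_mult_integrable weak_partial_L2)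
  show "integrable dx (\<lambda>x. weak_gradient \<Omega> u x \<bullet> weak_gradient \<Omega> v x)"
    unfolding eq using int by (rule Bochner_Integration.integrable_sum)
  show "(\<integral>x. weak_gradient \<Omega> u x \<bullet> weak_gradient \<Omega> v x \<partial>dx) = grad_inner u v"
    unfolding eq grad_inner_def L2_inner_def using int by (rule Bochner_Integration.integral_sum)
qed

lemma H1_norm_eq: "u \<in> H1 \<Omega> \<Longrightarrow> H1_norm \<Omega> u = h1.nrm u"
  using weak_gradient_inner_integral(2)[of u u]
  unfolding H1_norm_def power2_norm_eq_inner
  by (simp add: h1.nrm_def H1_inner_def L2_inner_def power2_eq_square)

lemma H1_0_iff:
  "u \<in> H1_0 \<Omega> \<longleftrightarrow> u \<in> H1 \<Omega> \<and> (\<exists>\<phi>. (\<forall>n. \<phi> n \<in> C_c 1 \<Omega>) \<and> h1.converges \<phi> u)"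
proof -
  have "(\<lambda>n. H1_norm \<Omega> (\<lambda>x. \<phi> n x - u x)) = (\<lambda>n. h1.nrm (\<lambda>x. \<phi> n x - u x))"
    if "u \<in> H1 \<Omega>" "\<forall>n. \<phi> n \<in> C_c 1 \<Omega>" for \<phi> :: "nat \<Rightarrow> 'a \<Rightarrow> real"
    using that by (simp add: H1_norm_eq C_c_H1 H1.diff_mem)
  then show ?thesis unfolding H1_0_def h1.converges_def by (auto; metis)
qed

lemma H1_0_H1: "u \<in> H1_0 \<Omega> \<Longrightarrow> u \<in> H1 \<Omega>"
  by (simp add: H1_0_def)

lemma C_c_H1_0: "\<phi> \<in> C_c 1 \<Omega> \<Longrightarrow> \<phi> \<in> H1_0 \<Omega>"
proof -
  assume \<phi>: "\<phi> \<in> C_c 1 \<Omega>"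
  have "h1.nrm (\<lambda>x. 0) = 0"
    using h1.nrm_scale[OF H1.zero_mem, of 0] by simp
  with \<phi> show ?thesis unfolding H1_0_iff h1.converges_def
    by (auto simp: C_c_H1 intro!: exI[of _ "\<lambda>n. \<phi>"])
qed

sublocale H1_0: function_space "H1_0 \<Omega>"
proof
  show "(\<lambda>x. 0) \<in> H1_0 \<Omega>" by (intro C_c_H1_0 C_c.zero_mem)
next
  fix u v assume "u \<in> H1_0 \<Omega>" "v \<in> H1_0 \<Omega>"
  then obtain \<phi> \<psi> where uv: "u \<in> H1 \<Omega>" "v \<in> H1 \<Omega>"
    and \<phi>: "\<And>n. \<phi> n \<in> C_c 1 \<Omega>" "h1.converges \<phi> u"
    and \<psi>: "\<And>n. \<psi> n \<in> C_c 1 \<Omega>" "h1.converges \<psi> v"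
    unfolding H1_0_iff by auto
  have "h1.converges (\<lambda>n x. \<phi> n x + \<psi> n x) (\<lambda>x. u x + v x)"
    unfolding h1.converges_def
  proof (rule Lim_null_comparison)
    show "(\<lambda>n. h1.nrm (\<lambda>x. \<phi> n x - u x) + h1.nrm (\<lambda>x. \<psi> n x - v x)) \<longlonglongrightarrow> 0"
      using tendsto_add[OF \<phi>(2)[unfolded h1.converges_def] \<psi>(2)[unfolded h1.converges_def]] by simp
    have "h1.nrm (\<lambda>x. (\<phi> n x + \<psi> n x) - (u x + v x))
        \<le> h1.nrm (\<lambda>x. \<phi> n x - u x) + h1.nrm (\<lambda>x. \<psi> n x - v x)" for n
      using h1.nrm_triangle[of "\<lambda>x. \<phi> n x - u x" "\<lambda>x. \<psi> n x - v x"] uv C_c_H1[OF \<phi>(1)] C_c_H1[OF \<psi>(1)]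
      by (simp add: H1.diff_mem algebra_simps)
    moreover have "0 \<le> h1.nrm (\<lambda>x. (\<phi> n x + \<psi> n x) - (u x + v x))" for n
      using uv C_c_H1[OF \<phi>(1)] C_c_H1[OF \<psi>(1)] by (intro h1.nrm_nonneg H1.diff_mem H1.add_mem)
    ultimately show "\<forall>\<^sub>F n in sequentially. norm (h1.nrm (\<lambda>x. (\<phi> n x + \<psi> n x) - (u x + v x)))
        \<le> h1.nrm (\<lambda>x. \<phi> n x - u x) + h1.nrm (\<lambda>x. \<psi> n x - v x)"
      by (intro always_eventually) simp
  qed
  then show "(\<lambda>x. u x + v x) \<in> H1_0 \<Omega>"
    unfolding H1_0_iff using C_c.add_mem[OF \<phi>(1) \<psi>(1)]
    by (intro conjI exI[of _ "\<lambda>n x. \<phi> n x + \<psi> n x"] allI H1.add_mem uv)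
next
  fix u c assume "u \<in> H1_0 \<Omega>"
  then obtain \<phi> where u: "u \<in> H1 \<Omega>"
    and \<phi>: "\<And>n. \<phi> n \<in> C_c 1 \<Omega>" "h1.converges \<phi> u"
    unfolding H1_0_iff by auto
  have "h1.nrm (\<lambda>x. c * \<phi> n x - c * u x) = \<bar>c\<bar> * h1.nrm (\<lambda>x. \<phi> n x - u x)" for n
    using h1.nrm_scale[of "\<lambda>x. \<phi> n x - u x" c] u C_c_H1[OF \<phi>(1)]
    by (simp add: H1.diff_mem right_diff_distrib)
  then have "h1.converges (\<lambda>n x. c * \<phi> n x) (\<lambda>x. c * u x)"
    using \<phi>(2) unfolding h1.converges_def by (auto intro: tendsto_mult_right_zero)
  then show "(\<lambda>x. c * u x) \<in> H1_0 \<Omega>"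
    unfolding H1_0_iff using C_c.scale_mem[OF \<phi>(1)]
    by (intro conjI exI[of _ "\<lambda>n x. c * \<phi> n x"] allI H1.scale_mem u)
qed

lemma H1_inner_bounds:
  assumes "u \<in> H1 \<Omega>"
  shows "L2.nrm dx u \<le> h1.nrm u" "grad.nrm u \<le> h1.nrm u"
    and "i \<in> Basis \<Longrightarrow> L2.nrm dx (weak_partial i u) \<le> grad.nrm u"
proof -
  have "0 \<le> L2_inner dx u u" "0 \<le> grad_inner u u"
    using assms by (auto intro: L2.ip_nonneg H1_L2 grad.ip_nonneg)
  then show "L2.nrm dx u \<le> h1.nrm u" "grad.nrm u \<le> h1.nrm u"
    by (auto simp: L2.nrm_def h1.nrm_def grad.nrm_def H1_inner_def)
  assume i: "i \<in> Basis"
  show "L2.nrm dx (weak_partial i u) \<le> grad.nrm u"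
    unfolding L2.nrm_def grad.nrm_def grad_inner_def using assms i
    by (intro real_sqrt_le_mono member_le_sum) (auto intro: L2.ip_nonneg weak_partial_L2)
qed

lemma nrm_weak_partial_diff:
  assumes "u \<in> H1 \<Omega>" "v \<in> H1 \<Omega>" "i \<in> Basis"
  shows "L2.nrm dx (\<lambda>x. weak_partial i u x - weak_partial i v x) = L2.nrm dx (weak_partial i (\<lambda>x. u x - v x))"
proof -
  interpret D: L2_pullback "H1 \<Omega>" "weak_partial i" dx using assms(3) by (rule weak_partial_pullback)
  show ?thesis using D.nrm_diff_eq[OF assms(1,2)] by (simp add: D.nrm_def L2.nrm_def)
qed

lemma h1_convergesD:
  assumes s: "\<And>n. s n \<in> H1 \<Omega>" and p: "p \<in> H1 \<Omega>" and sp: "h1.converges s p"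
  shows "L2.converges dx s p" "grad.converges s p"
    and "i \<in> Basis \<Longrightarrow> L2.converges dx (\<lambda>n. weak_partial i (s n)) (weak_partial i p)"
proof -
  have d: "(\<lambda>x. s n x - p x) \<in> H1 \<Omega>" for n using s p by (rule H1.diff_mem)
  show "L2.converges dx s p"
    unfolding L2.converges_def using H1_inner_bounds(1)[OF d] L2.nrm_nonneg[OF H1_L2[OF d]]
    by (intro Lim_null_comparison[OF _ sp[unfolded h1.converges_def]] always_eventually) auto
  show *: "grad.converges s p"
    unfolding grad.converges_def using H1_inner_bounds(2)[OF d] grad.nrm_nonneg[OF d]
    by (intro Lim_null_comparison[OF _ sp[unfolded h1.converges_def]] always_eventually) auto
  assume i: "i \<in> Basis"
  show "L2.converges dx (\<lambda>n. weak_partial i (s n)) (weak_partial i p)"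
    unfolding L2.converges_def nrm_weak_partial_diff[OF s p i]
    using H1_inner_bounds(3)[OF d i] L2.nrm_nonneg[OF weak_partial_L2[OF d i]]
    by (intro Lim_null_comparison[OF _ *[unfolded grad.converges_def]] always_eventually) auto
qed

lemma h1_convergesI:
  assumes s: "\<And>n. s n \<in> H1 \<Omega>" and p: "p \<in> H1 \<Omega>" and "L2.converges dx s p"
    and "\<And>i. i \<in> Basis \<Longrightarrow> L2.converges dx (\<lambda>n. weak_partial i (s n)) (weak_partial i p)"
  shows "h1.converges s p"
proof -
  have d: "(\<lambda>x. s n x - p x) \<in> H1 \<Omega>" for n using s p by (rule H1.diff_mem)
  have "h1.nrm (\<lambda>x. s n x - p x) = sqrt ((L2.nrm dx (\<lambda>x. s n x - p x))\<^sup>2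
      + (\<Sum>i\<in>Basis. (L2.nrm dx (\<lambda>x. weak_partial i (s n) x - weak_partial i p x))\<^sup>2))" for n
    unfolding h1.nrm_def H1_inner_def grad_inner_def
    using d s p by (simp add: L2.nrm_power2 H1_L2 weak_partial_L2 nrm_weak_partial_diff)
  moreover have "(\<lambda>n. sqrt ((L2.nrm dx (\<lambda>x. s n x - p x))\<^sup>2
      + (\<Sum>i\<in>Basis. (L2.nrm dx (\<lambda>x. weak_partial i (s n) x - weak_partial i p x))\<^sup>2))) \<longlonglongrightarrow> sqrt (0\<^sup>2 + (\<Sum>i\<in>(Basis :: 'a set). 0\<^sup>2))"
    using assms(3,4) unfolding L2.converges_def by (intro tendsto_intros)
  ultimately show ?thesis unfolding h1.converges_def by simp
qed

text \<open>
  For a test function \<open>\<phi>\<close>, integration by parts in direction \<open>i\<close> of the product of \<open>x \<bullet> i\<close> and \<open>\<phi>\<^sup>2\<close> gives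
  \<open>\<parallel>\<phi>\<parallel>\<^sup>2 = - 2 \<integral> (x \<bullet> i) \<phi> \<partial>\<^sub>i\<phi>\<close>, and \<open>|x \<bullet> i| \<le> R\<close> on \<open>\<Omega>\<close>. So \<open>\<parallel>\<phi>\<parallel> \<le> 2 R \<parallel>\<partial>\<^sub>i\<phi>\<parallel>\<close>, which passes to limits in \<open>H\<^sup>1\<close>.
\<close>

lemma Poincare_inequality: "\<exists>C>0. \<forall>u\<in>H1_0 \<Omega>. L2_inner dx u u \<le> C * grad_inner u u"
proof -
  obtain i :: 'a where i: "i \<in> Basis" using nonempty_Basis by blast
  obtain R where R: "0 < R" "\<And>x. x \<in> \<Omega> \<Longrightarrow> norm x \<le> R"
    using bounded_domain unfolding bounded_pos by blast
  have test: "L2.nrm dx \<phi> \<le> 2 * R * grad.nrm \<phi>" if \<phi>: "\<phi> \<in> C_c 1 \<Omega>" for \<phi>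
  proof -
    let ?x = "\<lambda>x::'a. x \<bullet> i + 0" and ?d = "partial i \<phi>"
    have \<phi>1: "C_k (Suc 0) \<phi>" and \<phi>': "\<phi> \<in> C_c (Suc 0) \<Omega>" using \<phi> by (auto simp: C_c_def)
    have x1: "C_k k ?x" for k by (rule C_k_inner)
    have "(?x has_derivative (\<lambda>h. h \<bullet> i)) (at x)" for x
      by (auto intro!: derivative_eq_intros)
    from partial_eqI[OF this, of i] have coord: "partial i ?x x = 1" for x
      using i by simp
    have L: "\<phi> \<in> L2 dx" "?d \<in> L2 dx" "(\<lambda>x. ?x x * ?d x) \<in> L2 dx" "(\<lambda>x. ?x x * \<phi> x) \<in> L2 dx"
      using C_k_mem_L2[OF \<phi>1] C_k_mem_L2[OF C_k_Suc_partial[OF \<phi>1 i]]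
        C_k_mem_L2[OF C_k_mult[OF x1 C_k_Suc_partial[OF \<phi>1 i]]] C_k_mem_L2[OF C_k_mult[OF x1 \<phi>1]] by auto
    have "L2_inner dx (\<lambda>x. ?x x * \<phi> x) ?d = - L2_inner dx (partial i (\<lambda>x. ?x x * \<phi> x)) \<phi>"
      using integral_by_parts_C_c[OF open_domain C_k_mult[OF x1 \<phi>1] \<phi>' i] by (simp add: L2_inner_def)
    also have "partial i (\<lambda>x. ?x x * \<phi> x) = (\<lambda>x. ?x x * ?d x + \<phi> x)"
      using partial_mult[OF x1 \<phi>1, of i] coord by auto
    also have "L2_inner dx (\<lambda>x. ?x x * ?d x + \<phi> x) \<phi> = L2_inner dx (\<lambda>x. ?x x * ?d x) \<phi> + L2_inner dx \<phi> \<phi>"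
      by (rule L2.ip_add[OF L(3,1,1)])
    also have "L2_inner dx (\<lambda>x. ?x x * \<phi> x) ?d = L2_inner dx (\<lambda>x. ?x x * ?d x) \<phi>"
      by (simp add: L2_inner_def mult_ac)
    finally have "L2_inner dx \<phi> \<phi> = - 2 * L2_inner dx (\<lambda>x. ?x x * ?d x) \<phi>" by simp
    also have "\<dots> \<le> 2 * (L2.nrm dx (\<lambda>x. ?x x * ?d x) * L2.nrm dx \<phi>)"
      using L2.abs_ip_le[OF L(3,1)] by linarith
    also have "\<dots> \<le> 2 * ((R * L2.nrm dx ?d) * L2.nrm dx \<phi>)"
    proof (intro mult_left_mono mult_right_mono)
      have "L2_inner dx (\<lambda>x. ?x x * ?d x) (\<lambda>x. ?x x * ?d x) \<le> L2_inner dx (\<lambda>x. R * ?d x) (\<lambda>x. R * ?d x)"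
        unfolding L2_inner_def
      proof (intro integral_mono L2_mult_integrable L L2.scale_mem)
        fix x assume "x \<in> space dx"
        then have "\<bar>x \<bullet> i\<bar> \<le> R"
          using R(2)[of x] Basis_le_norm[OF i, of x] by simp
        then have "(x \<bullet> i)\<^sup>2 * (?d x)\<^sup>2 \<le> R\<^sup>2 * (?d x)\<^sup>2"
          using R(1) by (intro mult_right_mono) (auto simp: abs_le_square_iff[symmetric])
        then show "?x x * ?d x * (?x x * ?d x) \<le> R * ?d x * (R * ?d x)"
          by (simp add: power2_eq_square mult_ac)
      qed
      then have "L2.nrm dx (\<lambda>x. ?x x * ?d x) \<le> L2.nrm dx (\<lambda>x. R * ?d x)"
        by (simp add: L2.nrm_def)
      then show "L2.nrm dx (\<lambda>x. ?x x * ?d x) \<le> R * L2.nrm dx ?d"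
        using L2.nrm_scale[OF L(2), of R] R(1) by simp
    qed (use L2.nrm_nonneg[OF L(1)] in auto)
    finally have "L2.nrm dx \<phi> * L2.nrm dx \<phi> \<le> (2 * R * L2.nrm dx ?d) * L2.nrm dx \<phi>"
      using L2.nrm_power2[OF L(1)] by (simp add: power2_eq_square mult_ac)
    then have "L2.nrm dx \<phi> \<le> 2 * R * L2.nrm dx ?d"
      using L2.nrm_nonneg[OF L(1)] L2.nrm_nonneg[OF L(2)] R(1)
      by (cases "L2.nrm dx \<phi> = 0") auto
    also have "L2.nrm dx ?d = L2.nrm dx (weak_partial i \<phi>)"
    proof -
      have "AE x in dx. ?d x = weak_partial i \<phi> x" using C_k_H1(2)[OF \<phi>1 i] by eventually_elim simp
      then show ?thesis
        unfolding L2.nrm_def using C_k_H1(1)[OF \<phi>1] i L(2)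
        by (intro arg_cong[where f = sqrt] L2_inner_AE_cong weak_partial_L2)
    qed
    also have "2 * R * \<dots> \<le> 2 * R * grad.nrm \<phi>"
      using H1_inner_bounds(3)[OF C_c_H1[OF \<phi>] i] R(1) by (intro mult_left_mono) auto
    finally show ?thesis .
  qed
  have "L2_inner dx u u \<le> (2 * R)\<^sup>2 * grad_inner u u" if "u \<in> H1_0 \<Omega>" for u
  proof -
    obtain \<phi> where u: "u \<in> H1 \<Omega>" and \<phi>: "\<And>n. \<phi> n \<in> C_c 1 \<Omega>" and lim: "h1.converges \<phi> u"
      using \<open>u \<in> H1_0 \<Omega>\<close> unfolding H1_0_iff by auto
    note conv = h1_convergesD[OF C_c_H1[OF \<phi>] u lim]
    have "L2.nrm dx u \<le> 2 * R * grad.nrm u"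
      by (rule LIMSEQ_le[OF L2.nrm_tendsto[OF H1_L2[OF C_c_H1[OF \<phi>]] H1_L2[OF u] conv(1)]
            tendsto_mult[OF tendsto_const grad.nrm_tendsto[OF C_c_H1[OF \<phi>] u conv(2)]]])
        (use test[OF \<phi>] in blast)
    then have "(L2.nrm dx u)\<^sup>2 \<le> (2 * R * grad.nrm u)\<^sup>2"
      using L2.nrm_nonneg[OF H1_L2[OF u]] by (intro power_mono)
    then show ?thesis
      using u by (simp add: L2.nrm_power2 grad.nrm_power2 H1_L2 power_mult_distrib)
  qed
  then show ?thesis using R(1) by (intro exI[of _ "(2 * R)\<^sup>2"]) simp
qed

end

section \<open>The weak Laplacian and the normal derivative\<close>

context bounded_open_set
begin

text \<open>
  A diagonal sequence of test functions.
\<close>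

lemma H1_0_closed:
  assumes s: "\<And>n. s n \<in> H1_0 \<Omega>" and p: "p \<in> H1 \<Omega>" and sp: "h1.converges s p"
  shows "p \<in> H1_0 \<Omega>"
proof -
  have sH: "s n \<in> H1 \<Omega>" for n using s by (rule H1_0_H1)
  have "\<forall>n. \<exists>\<phi>. \<phi> \<in> C_c 1 \<Omega> \<and> h1.nrm (\<lambda>x. \<phi> x - s n x) < 1 / real (Suc n)"
  proof
    fix n
    obtain \<psi> where \<psi>: "\<And>k. \<psi> k \<in> C_c 1 \<Omega>" "h1.converges \<psi> (s n)"
      using s[of n] unfolding H1_0_iff by auto
    have "\<forall>\<^sub>F k in sequentially. h1.nrm (\<lambda>x. \<psi> k x - s n x) < 1 / real (Suc n)"
      using \<psi>(2) unfolding h1.converges_def by (rule order_tendstoD(2)) simp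
    then obtain k where "h1.nrm (\<lambda>x. \<psi> k x - s n x) < 1 / real (Suc n)"
      using eventually_happens by force
    then show "\<exists>\<phi>. \<phi> \<in> C_c 1 \<Omega> \<and> h1.nrm (\<lambda>x. \<phi> x - s n x) < 1 / real (Suc n)"
      using \<psi>(1) by blast
  qed
  from choice[OF this] obtain \<phi>
    where "\<forall>n. \<phi> n \<in> C_c 1 \<Omega> \<and> h1.nrm (\<lambda>x. \<phi> n x - s n x) < 1 / real (Suc n)"
    by (rule exE)
  then have \<phi>: "\<And>n. \<phi> n \<in> C_c 1 \<Omega>" "\<And>n. h1.nrm (\<lambda>x. \<phi> n x - s n x) < 1 / real (Suc n)"
    by auto
  have "h1.converges \<phi> p"
    unfolding h1.converges_def
  proof (rule Lim_null_comparison)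
    have "(\<lambda>n. 1 / real (Suc n)) \<longlonglongrightarrow> 0"
      using LIMSEQ_inverse_real_of_nat by (simp add: divide_inverse)
    from tendsto_add[OF this sp[unfolded h1.converges_def]]
    show "(\<lambda>n. 1 / real (Suc n) + h1.nrm (\<lambda>x. s n x - p x)) \<longlonglongrightarrow> 0" by simp
    have "\<bar>h1.nrm (\<lambda>x. \<phi> n x - p x)\<bar> \<le> 1 / real (Suc n) + h1.nrm (\<lambda>x. s n x - p x)" for n
      using h1.nrm_diff_triangle[OF C_c_H1[OF \<phi>(1)] sH p, of n n] \<phi>(2)[of n]
        h1.nrm_nonneg[OF H1.diff_mem[OF C_c_H1[OF \<phi>(1)] p], of n] by linarith
    then show "\<forall>\<^sub>F n in sequentially. norm (h1.nrm (\<lambda>x. \<phi> n x - p x))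
        \<le> 1 / real (Suc n) + h1.nrm (\<lambda>x. s n x - p x)"
      by simp
  qed
  then show ?thesis unfolding H1_0_iff using p \<phi>(1) by blast
qed

text \<open>
  No boundary term appears, whatever the boundary values of \<open>v\<close> are, because \<open>u\<close> is a limit of test
  functions.
\<close>

lemma grad_inner_test:
  assumes u: "u \<in> H1_0 \<Omega>" and v: "C_k 2 v"
  shows "grad_inner u v = - L2_inner dx u (classical_laplacian v)"
proof -
  obtain \<phi> where uH: "u \<in> H1 \<Omega>" and \<phi>: "\<And>n. \<phi> n \<in> C_c 1 \<Omega>" and lim: "h1.converges \<phi> u"
    using u unfolding H1_0_iff by auto
  note conv = h1_convergesD[OF C_c_H1[OF \<phi>] uH lim]
  have v1: "C_k (Suc 0) v" and v2: "i \<in> Basis \<Longrightarrow> C_k (Suc 0) (partial i v)" for i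
    using C_k_SucD[of "Suc 0" v] C_k_Suc_partial[of "Suc 0" v] v by (simp_all add: numeral_2_eq_2 del: C_k.simps)
  have L: "i \<in> Basis \<Longrightarrow> partial i v \<in> L2 dx" "i \<in> Basis \<Longrightarrow> partial i (partial i v) \<in> L2 dx" for i
    using C_k_mem_L2[OF v2] C_k_mem_L2[OF C_k_Suc_partial[OF v2]] by auto
  have each: "L2_inner dx (weak_partial i u) (weak_partial i v) = - L2_inner dx u (partial i (partial i v))"
    if i: "i \<in> Basis" for i
  proof -
    have "L2_inner dx (weak_partial i (\<phi> n)) (partial i v) = - L2_inner dx (\<phi> n) (partial i (partial i v))" for n
    proof -
      have n1: "C_k (Suc 0) (\<phi> n)" and n2: "\<phi> n \<in> C_c (Suc 0) \<Omega>" using \<phi>[of n] by (auto simp: C_c_def)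
      have "L2_inner dx (weak_partial i (\<phi> n)) (partial i v) = L2_inner dx (partial i (\<phi> n)) (partial i v)"
        using \<phi>[of n] i by (intro L2_inner_AE_cong weak_partial_L2 L C_c_H1 partial_C_c_L2 C_k_H1(2)[OF n1]) auto
      also have "\<dots> = - L2_inner dx (\<phi> n) (partial i (partial i v))"
        using integral_by_parts_C_c[OF open_domain v2[OF i] n2 i]
        by (simp add: L2_inner_def mult.commute)
      finally show ?thesis .
    qed
    then have "(\<lambda>n. - L2_inner dx (\<phi> n) (partial i (partial i v))) \<longlonglongrightarrow> L2_inner dx (weak_partial i u) (partial i v)"
      using L2.ip_tendsto[OF _ _ L(1)[OF i] conv(3)[OF i]] \<phi> uH i by (simp add: weak_partial_L2 C_c_H1)
    moreover have "(\<lambda>n. - L2_inner dx (\<phi> n) (partial i (partial i v)))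
        \<longlonglongrightarrow> - L2_inner dx u (partial i (partial i v))"
      by (intro tendsto_minus L2.ip_tendsto L(2) i conv(1) H1_L2[OF uH] H1_L2[OF C_c_H1[OF \<phi>]])
    ultimately have "L2_inner dx (weak_partial i u) (partial i v) = - L2_inner dx u (partial i (partial i v))"
      by (rule LIMSEQ_unique)
    moreover have "L2_inner dx (weak_partial i u) (weak_partial i v) = L2_inner dx (weak_partial i u) (partial i v)"
      using i uH C_k_H1(1)[OF v1] by (intro L2_inner_AE_cong weak_partial_L2 L C_k_H1(2)[OF v1]) auto
    ultimately show ?thesis by simp
  qed
  have "L2_inner dx u (classical_laplacian v) = (\<Sum>i\<in>Basis. L2_inner dx u (partial i (partial i v)))"
    unfolding L2_inner_def classical_laplacian_def sum_distrib_left
    using L H1_L2[OF uH] by (intro Bochner_Integration.integral_sum L2_mult_integrable)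
  then show ?thesis unfolding grad_inner_def by (simp add: each sum_negf)
qed

lemma classical_laplacian_C_c: "\<phi> \<in> C_c 2 \<Omega> \<Longrightarrow> classical_laplacian \<phi> \<in> C_c 0 \<Omega>"
  unfolding classical_laplacian_def[abs_def]
  using C_c_partial[of _ 0 \<Omega>] C_c_partial[of \<phi> "Suc 0" \<Omega>]
  by (intro C_c.sum_mem) (auto simp: numeral_2_eq_2)

lemma classical_laplacian_L2: "\<phi> \<in> C_c 2 \<Omega> \<Longrightarrow> classical_laplacian \<phi> \<in> L2 dx"
  by (rule C_c_mem_L2[OF classical_laplacian_C_c])

lemma C_c_2_H1_0: "\<phi> \<in> C_c 2 \<Omega> \<Longrightarrow> \<phi> \<in> H1_0 \<Omega>"
  by (intro C_c_H1_0) (auto intro: C_c_mono)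

lemma C_c_2_C_k: "\<phi> \<in> C_c 2 \<Omega> \<Longrightarrow> C_k 2 \<phi>"
  by (simp add: C_c_def)

lemma classical_laplacian_symmetric:
  assumes \<phi>: "\<phi> \<in> C_c 2 \<Omega>" and v: "C_k 2 v"
  shows "L2_inner dx \<phi> (classical_laplacian v) = L2_inner dx (classical_laplacian \<phi>) v"
proof -
  have each: "(\<integral>x. \<phi> x * partial i (partial i v) x \<partial>dx) = (\<integral>x. partial i (partial i \<phi>) x * v x \<partial>dx)"
    if i: "i \<in> Basis" for i
  proof -
    have p: "partial i \<phi> \<in> C_c (Suc 0) \<Omega>" and p0: "\<phi> \<in> C_c (Suc 0) \<Omega>"
      using C_c_partial[of \<phi> "Suc 0"] C_c_mono[OF \<phi>, of "Suc 0" \<Omega>] \<phi> i by (auto simp: numeral_2_eq_2)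
    have w: "C_k (Suc 0) (partial i v)" "C_k (Suc 0) v"
      using C_k_Suc_partial[of "Suc 0" v i] C_k_SucD[of "Suc 0" v] v i
      by (simp_all add: numeral_2_eq_2 del: C_k.simps)
    show ?thesis
      using integral_by_parts_C_c[OF open_domain w(1) p0 i] integral_by_parts_C_c[OF open_domain w(2) p i]
      by (simp add: mult.commute)
  qed
  have int: "integrable dx (\<lambda>x. \<phi> x * partial i (partial i v) x)"
      "integrable dx (\<lambda>x. partial i (partial i \<phi>) x * v x)" if i: "i \<in> Basis" for i
  proof -
    have second: "C_k 0 (partial i (partial i w))" if "C_k 2 w" for w
      using C_k_Suc_partial[OF C_k_Suc_partial[of "Suc 0" w i] i] that i by (simp add: numeral_2_eq_2)
    show "integrable dx (\<lambda>x. \<phi> x * partial i (partial i v) x)"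
      by (rule L2_mult_integrable[OF C_c_mem_L2[OF \<phi>] C_k_mem_L2[OF second[OF v]]])
    show "integrable dx (\<lambda>x. partial i (partial i \<phi>) x * v x)"
      by (rule L2_mult_integrable[OF C_k_mem_L2[OF second[OF C_c_2_C_k[OF \<phi>]]] C_k_mem_L2[OF v]])
  qed
  show ?thesis
    unfolding L2_inner_def classical_laplacian_def sum_distrib_left sum_distrib_right
    using each int by (simp add: Bochner_Integration.integral_sum)
qed

lemma is_weak_laplacian_iff:
  "is_weak_laplacian \<Omega> u f \<longleftrightarrow> f \<in> L2 dx \<and>
    (\<forall>\<phi>\<in>C_c 2 \<Omega>. L2_inner dx u (classical_laplacian \<phi>) = L2_inner dx f \<phi>)"
  by (simp add: is_weak_laplacian_def L2_inner_def)

lemma H0_H1_0: "u \<in> H_0_Laplace \<Omega> \<Longrightarrow> u \<in> H1_0 \<Omega>"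
  by (simp add: H_0_Laplace_def)

lemma H0_H1: "u \<in> H_0_Laplace \<Omega> \<Longrightarrow> u \<in> H1 \<Omega>"
  by (intro H1_0_H1 H0_H1_0)

lemma H0_L2: "u \<in> H_0_Laplace \<Omega> \<Longrightarrow> u \<in> L2 dx"
  by (intro H1_L2 H0_H1)

lemma weak_laplacian_is: "u \<in> H_0_Laplace \<Omega> \<Longrightarrow> is_weak_laplacian \<Omega> u (weak_laplacian \<Omega> u)"
  unfolding H_0_Laplace_def weak_laplacian_def using someI_ex[of "is_weak_laplacian \<Omega> u"] by simp

lemma weak_laplacian_L2: "u \<in> H_0_Laplace \<Omega> \<Longrightarrow> weak_laplacian \<Omega> u \<in> L2 dx"
  using weak_laplacian_is is_weak_laplacian_iff by blast

lemma weak_laplacian_tested: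
  "u \<in> H_0_Laplace \<Omega> \<Longrightarrow> \<phi> \<in> C_c 2 \<Omega> \<Longrightarrow>
    L2_inner dx u (classical_laplacian \<phi>) = L2_inner dx (weak_laplacian \<Omega> u) \<phi>"
  using weak_laplacian_is is_weak_laplacian_iff by blast

text \<open>
  The counterpart of \<open>H1_I\<close>: it identifies the chosen weak Laplacian.
\<close>

lemma weak_laplacianI:
  assumes u: "u \<in> H1_0 \<Omega>" and f: "is_weak_laplacian \<Omega> u f"
  shows "u \<in> H_0_Laplace \<Omega>" "AE x in dx. weak_laplacian \<Omega> u x = f x"
proof -
  show uH: "u \<in> H_0_Laplace \<Omega>" using assms by (auto simp: H_0_Laplace_def)
  show "AE x in dx. weak_laplacian \<Omega> u x = f x"
    using f weak_laplacian_tested[OF uH]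
    by (intro L2_eq_if_tested[where k = 2] weak_laplacian_L2 uH) (auto simp: is_weak_laplacian_iff)
qed

lemma is_weak_laplacian_add:
  assumes "u \<in> L2 dx" "v \<in> L2 dx" "is_weak_laplacian \<Omega> u f" "is_weak_laplacian \<Omega> v g"
  shows "is_weak_laplacian \<Omega> (\<lambda>x. u x + v x) (\<lambda>x. f x + g x)"
  using assms by (simp add: is_weak_laplacian_iff L2.add_mem L2.ip_add C_c_mem_L2 classical_laplacian_L2)

lemma is_weak_laplacian_scale:
  assumes "u \<in> L2 dx" "is_weak_laplacian \<Omega> u f"
  shows "is_weak_laplacian \<Omega> (\<lambda>x. c * u x) (\<lambda>x. c * f x)"
  using assms by (simp add: is_weak_laplacian_iff L2.scale_mem L2.ip_scale C_c_mem_L2 classical_laplacian_L2)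

lemma C_c_2_weak_laplacian: "\<phi> \<in> C_c 2 \<Omega> \<Longrightarrow> is_weak_laplacian \<Omega> \<phi> (classical_laplacian \<phi>)"
  by (simp add: is_weak_laplacian_iff classical_laplacian_L2 classical_laplacian_symmetric C_c_2_C_k)

lemma C_c_2_H0: "\<phi> \<in> C_c 2 \<Omega> \<Longrightarrow> \<phi> \<in> H_0_Laplace \<Omega>"
  by (rule weak_laplacianI[OF C_c_2_H1_0 C_c_2_weak_laplacian])

sublocale lapl: L2_pullback "H_0_Laplace \<Omega>" "weak_laplacian \<Omega>" dx
proof
  show "(\<lambda>x. 0) \<in> H_0_Laplace \<Omega>" by (intro C_c_2_H0 C_c.zero_mem)
next
  fix u v assume u: "u \<in> H_0_Laplace \<Omega>" and v: "v \<in> H_0_Laplace \<Omega>"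
  note H = weak_laplacianI[OF H1_0.add_mem is_weak_laplacian_add, OF H0_H1_0 H0_H1_0 H0_L2 H0_L2
      weak_laplacian_is weak_laplacian_is, OF u v u v u v]
  show "(\<lambda>x. u x + v x) \<in> H_0_Laplace \<Omega>" by (rule H)
  show "AE x in dx. weak_laplacian \<Omega> (\<lambda>x. u x + v x) x = weak_laplacian \<Omega> u x + weak_laplacian \<Omega> v x"
    by (rule H)
next
  fix u c assume u: "u \<in> H_0_Laplace \<Omega>"
  note H = weak_laplacianI[OF H1_0.scale_mem is_weak_laplacian_scale, OF H0_H1_0 H0_L2
      weak_laplacian_is, OF u u u]
  show "(\<lambda>x. c * u x) \<in> H_0_Laplace \<Omega>" by (rule H)
  show "AE x in dx. weak_laplacian \<Omega> (\<lambda>x. c * u x) x = c * weak_laplacian \<Omega> u x"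
    by (rule H)
  show "weak_laplacian \<Omega> u \<in> L2 dx" using u by (rule weak_laplacian_L2)
qed

abbreviation lap_inner :: "('a \<Rightarrow> real) \<Rightarrow> ('a \<Rightarrow> real) \<Rightarrow> real" where
  "lap_inner u v \<equiv> L2_inner dx (weak_laplacian \<Omega> u) (weak_laplacian \<Omega> v)"

end

locale B2_domain = bounded_open_set +
  assumes B2: "B2 \<Omega>"
begin

abbreviation "dS \<equiv> surface_measure \<Omega>"

lemma B1: "B1 \<Omega>"
  using B2 by (simp add: B2_def)

lemma normal_derivative_is:
  "u \<in> H_0_Laplace \<Omega> \<Longrightarrow> is_normal_derivative \<Omega> u (normal_derivative \<Omega> u)"
  unfolding normal_derivative_def using B2 someI_ex[of "is_normal_derivative \<Omega> u"]
  by (auto simp: B2_def)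

lemma normal_derivative_L2: "u \<in> H_0_Laplace \<Omega> \<Longrightarrow> normal_derivative \<Omega> u \<in> L2 dS"
  using normal_derivative_is by (simp add: is_normal_derivative_def)

lemma Green_trace:
  assumes u: "u \<in> H_0_Laplace \<Omega>" and g: "is_trace \<Omega> v g"
  shows "L2_inner dS g (normal_derivative \<Omega> u) = grad_inner u v + L2_inner dx v (weak_laplacian \<Omega> u)"
proof -
  have v: "v \<in> H1 \<Omega>" using g by (simp add: is_trace_def)
  have "L2_inner dS g (normal_derivative \<Omega> u)
      = (\<integral>x. (weak_gradient \<Omega> u x \<bullet> weak_gradient \<Omega> v x + v x * weak_laplacian \<Omega> u x) \<partial>dx)"
    using normal_derivative_is[OF u] v g unfolding is_normal_derivative_def L2_inner_def by blast
  also have "\<dots> = grad_inner u v + L2_inner dx v (weak_laplacian \<Omega> u)"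
    using weak_gradient_inner_integral[OF H0_H1[OF u] v]
      L2_mult_integrable[OF H1_L2[OF v] weak_laplacian_L2[OF u]]
    by (simp add: L2_inner_def)
  finally show ?thesis .
qed

lemma H1_norm_zero: "H1_norm \<Omega> (\<lambda>x. 0) = 0"
  using h1.nrm_scale[OF H1.zero_mem, of 0] H1_norm_eq[OF H1.zero_mem] by simp

lemma L2_norm_zero: "L2_norm M (\<lambda>x. 0) = 0"
  by (simp add: L2_norm_def)

lemma trace_C_k:
  assumes "C_k 1 v"
  shows "is_trace \<Omega> v v"
  unfolding is_trace_def using assms
  by (auto intro!: exI[of _ "\<lambda>n. v"] C_k_H1 continuous_mem_L2_surface[OF B1] C_k_imp_continuous
      simp: H1_norm_zero L2_norm_zero simp del: C_k.simps)

text \<open>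
  The approximating test functions of a function in \<open>H\<^sub>0\<^sup>1\<close> vanish on the boundary.
\<close>

lemma trace_H1_0:
  assumes "v \<in> H1_0 \<Omega>"
  shows "is_trace \<Omega> v (\<lambda>x. 0)"
proof -
  obtain \<phi> where v: "v \<in> H1 \<Omega>" and \<phi>: "\<And>n. \<phi> n \<in> C_c 1 \<Omega>"
    and lim: "(\<lambda>n. H1_norm \<Omega> (\<lambda>x. \<phi> n x - v x)) \<longlonglongrightarrow> 0"
    using assms unfolding H1_0_def by auto
  have "\<phi> n x = 0" if "x \<in> frontier \<Omega>" for n x
    using \<phi>[of n] that open_domain by (elim C_cE) (auto simp: frontier_def interior_open)
  then have "L2_norm dS (\<lambda>x. \<phi> n x - 0) = L2_norm dS (\<lambda>x. 0)" for n
    unfolding L2_norm_def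
    by (intro arg_cong[where f = sqrt] Bochner_Integration.integral_cong)
      (auto simp: space_surface_measure)
  then have "(\<lambda>n. L2_norm dS (\<lambda>x. \<phi> n x - 0)) \<longlonglongrightarrow> 0"
    by (simp add: L2_norm_zero)
  then show ?thesis
    unfolding is_trace_def using v \<phi> lim by (auto simp: L2.zero_mem C_c_def simp del: C_k.simps)
qed

text \<open>
  The trace of \<open>v\<close> is zero, so the boundary term disappears from the identity that defines the normal
  derivative. This extends the definition of the weak Laplacian, which is tested against functions of
  class \<open>C\<^sup>2\<close>, to all test functions in \<open>H\<^sub>0\<^sup>1\<close>.
\<close>

lemma Green_H1_0:
  assumes "u \<in> H_0_Laplace \<Omega>" "v \<in> H1_0 \<Omega>"
  shows "grad_inner u v = - L2_inner dx v (weak_laplacian \<Omega> u)"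
  using Green_trace[OF assms(1) trace_H1_0[OF assms(2)]] by (simp add: L2_inner_def)

lemma C_k_exp: "C_k 1 (\<lambda>x. exp (k \<bullet> x))"
  by (rule C_k_exp_inner)

text \<open>
  Exponentials are their own traces, and they determine a function in \<open>L\<^sup>2\<close> of the boundary.
\<close>

lemma normal_derivative_unique:
  assumes u: "u \<in> H_0_Laplace \<Omega>" and d: "d \<in> L2 dS"
    and test: "\<And>k. L2_inner dS (\<lambda>x. exp (k \<bullet> x)) d
      = grad_inner u (\<lambda>x. exp (k \<bullet> x)) + L2_inner dx (\<lambda>x. exp (k \<bullet> x)) (weak_laplacian \<Omega> u)"
  shows "AE x in dS. normal_derivative \<Omega> u x = d x"
proof -
  have "AE x in dS. normal_derivative \<Omega> u x - d x = 0"
  proof (rule exp_integrals_determine_surface[OF B1])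
    show "(\<lambda>x. normal_derivative \<Omega> u x - d x) \<in> L2 dS"
      using u d by (intro L2.diff_mem normal_derivative_L2)
    fix k :: 'a
    have "(\<lambda>x. exp (k \<bullet> x)) \<in> L2 dS"
      by (intro continuous_mem_L2_surface B1 C_k_imp_continuous[OF C_k_exp])
    then show "(\<integral>x. exp (k \<bullet> x) * (normal_derivative \<Omega> u x - d x) \<partial>dS) = 0"
      using L2.ip_diff_right[OF normal_derivative_L2[OF u] d] Green_trace[OF u trace_C_k[OF C_k_exp]] test
      by (simp add: L2_inner_def)
  qed
  then show ?thesis by simp
qed

sublocale nd: L2_pullback "H_0_Laplace \<Omega>" "normal_derivative \<Omega>" dS
proof
  fix u v assume u: "u \<in> H_0_Laplace \<Omega>" and v: "v \<in> H_0_Laplace \<Omega>"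
  show "AE x in dS. normal_derivative \<Omega> (\<lambda>x. u x + v x) x = normal_derivative \<Omega> u x + normal_derivative \<Omega> v x"
  proof (rule normal_derivative_unique[OF lapl.add_mem[OF u v] L2.add_mem[OF normal_derivative_L2 normal_derivative_L2, OF u v]])
    fix k :: 'a
    let ?e = "\<lambda>x. exp (k \<bullet> x)"
    have E: "?e \<in> L2 dS" "?e \<in> H1 \<Omega>" "?e \<in> L2 dx"
      using trace_C_k[OF C_k_exp] C_k_mem_L2[OF C_k_exp] by (auto simp: is_trace_def)
    have "L2_inner dx ?e (weak_laplacian \<Omega> (\<lambda>x. u x + v x))
        = L2_inner dx ?e (\<lambda>x. weak_laplacian \<Omega> u x + weak_laplacian \<Omega> v x)"
      using u v E by (intro L2_inner_AE_cong weak_laplacian_L2 lapl.add_mem L2.add_mem lapl.T_add) auto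
    then show "L2_inner dS ?e (\<lambda>x. normal_derivative \<Omega> u x + normal_derivative \<Omega> v x)
        = grad_inner (\<lambda>x. u x + v x) ?e + L2_inner dx ?e (weak_laplacian \<Omega> (\<lambda>x. u x + v x))"
      using u v E Green_trace[OF u trace_C_k[OF C_k_exp[of k]]] Green_trace[OF v trace_C_k[OF C_k_exp[of k]]]
      by (simp add: L2.ip_add_right grad.ip_add H0_H1 normal_derivative_L2 weak_laplacian_L2)
  qed
next
  fix u c assume u: "u \<in> H_0_Laplace \<Omega>"
  show "normal_derivative \<Omega> u \<in> L2 dS" using u by (rule normal_derivative_L2)
  show "AE x in dS. normal_derivative \<Omega> (\<lambda>x. c * u x) x = c * normal_derivative \<Omega> u x"
  proof (rule normal_derivative_unique[OF lapl.scale_mem[OF u] L2.scale_mem[OF normal_derivative_L2[OF u]]])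
    fix k :: 'a
    let ?e = "\<lambda>x. exp (k \<bullet> x)"
    have E: "?e \<in> L2 dS" "?e \<in> H1 \<Omega>" "?e \<in> L2 dx"
      using trace_C_k[OF C_k_exp] C_k_mem_L2[OF C_k_exp] by (auto simp: is_trace_def)
    have "L2_inner dx ?e (weak_laplacian \<Omega> (\<lambda>x. c * u x))
        = L2_inner dx ?e (\<lambda>x. c * weak_laplacian \<Omega> u x)"
      using u E by (intro L2_inner_AE_cong weak_laplacian_L2 lapl.scale_mem L2.scale_mem lapl.T_scale) auto
    then show "L2_inner dS ?e (\<lambda>x. c * normal_derivative \<Omega> u x)
        = grad_inner (\<lambda>x. c * u x) ?e + L2_inner dx ?e (weak_laplacian \<Omega> (\<lambda>x. c * u x))"
      using u E Green_trace[OF u trace_C_k[OF C_k_exp[of k]]]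
      by (simp add: L2.ip_scale_right grad.ip_scale H0_H1 normal_derivative_L2 weak_laplacian_L2 distrib_left)
  qed
qed

abbreviation nd_inner :: "('a \<Rightarrow> real) \<Rightarrow> ('a \<Rightarrow> real) \<Rightarrow> real" where
  "nd_inner u v \<equiv> L2_inner dS (normal_derivative \<Omega> u) (normal_derivative \<Omega> v)"

text \<open>
  Green's formula with \<open>v = u\<close> gives \<open>\<parallel>\<nabla>u\<parallel>\<^sup>2 \<le> \<parallel>u\<parallel> \<parallel>\<Delta>u\<parallel>\<close>, and the Poincare inequality absorbs \<open>\<parallel>u\<parallel>\<close>.
\<close>

lemma H1_inner_le_lap_inner: "\<exists>C. \<forall>u\<in>H_0_Laplace \<Omega>. H1_inner u u \<le> C * lap_inner u u"
proof -
  obtain C where C: "0 < C" "\<And>u. u \<in> H1_0 \<Omega> \<Longrightarrow> L2_inner dx u u \<le> C * grad_inner u u"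
    using Poincare_inequality by blast
  have "H1_inner u u \<le> (C * C + C) * lap_inner u u" if u: "u \<in> H_0_Laplace \<Omega>" for u
  proof -
    have g: "0 \<le> grad_inner u u" and l: "0 \<le> lap_inner u u"
      using grad.ip_nonneg[OF H0_H1[OF u]] lapl.ip_nonneg[OF u] .
    have uu: "L2_inner dx u u \<le> C * grad_inner u u" using C(2) H0_H1_0[OF u] .
    have "(grad_inner u u)\<^sup>2 = (L2_inner dx u (weak_laplacian \<Omega> u))\<^sup>2"
      using Green_H1_0[OF u H0_H1_0[OF u]] by simp
    also have "\<dots> \<le> L2_inner dx u u * lap_inner u u"
      by (intro L2.Cauchy_Schwarz H0_L2 weak_laplacian_L2 u)
    also have "\<dots> \<le> C * grad_inner u u * lap_inner u u"
      using uu l by (intro mult_right_mono)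
    finally have "grad_inner u u * grad_inner u u \<le> (C * lap_inner u u) * grad_inner u u"
      by (simp add: power2_eq_square mult_ac)
    then have grad: "grad_inner u u \<le> C * lap_inner u u"
      using g C(1) l by (cases "grad_inner u u = 0") auto
    have "C * grad_inner u u \<le> C * (C * lap_inner u u)"
      using grad C(1) by (intro mult_left_mono) auto
    then show ?thesis
      using uu grad by (simp add: H1_inner_def algebra_simps)
  qed
  then show ?thesis by blast
qed

lemma H0_eq_0_if_lap_inner_eq_0:
  assumes u: "u \<in> H_0_Laplace \<Omega>" and "lap_inner u u = 0"
  shows "AE x in dx. u x = 0"
proof -
  have "H1_inner u u \<le> 0" using H1_inner_le_lap_inner assms by fastforce
  moreover have "0 \<le> grad_inner u u" "0 \<le> L2_inner dx u u"
    using grad.ip_nonneg[OF H0_H1[OF u]] L2.ip_nonneg[OF H0_L2[OF u]] .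
  ultimately have "L2_inner dx u u = 0" by (simp add: H1_inner_def)
  then show ?thesis using L2_inner_self_eq_0_iff[OF H0_L2[OF u]] by blast
qed

text \<open>
  By \<open>H1_inner_le_lap_inner\<close> a Cauchy sequence for \<open>\<parallel>\<Delta>u\<parallel>\<close> is one in \<open>H\<^sup>1\<close>. The functions, their weak partial
  derivatives and their weak Laplacians converge in \<open>L\<^sup>2\<close>, and the identities that define the derivatives
  are preserved in the limit.
\<close>

lemma H0_complete: "semi_inner.complete_space (H_0_Laplace \<Omega>) lap_inner"
  unfolding lapl.complete_space_def
proof (intro allI impI)
  fix s assume "\<forall>n. s n \<in> H_0_Laplace \<Omega>" and cs: "lapl.cauchy s"
  then have s: "\<And>n. s n \<in> H_0_Laplace \<Omega>" by blast
  note sH = H0_H1[OF s]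
  obtain C where C: "\<And>u. u \<in> H_0_Laplace \<Omega> \<Longrightarrow> H1_inner u u \<le> C * lap_inner u u"
    using H1_inner_le_lap_inner by blast
  have C': "h1.nrm u \<le> sqrt \<bar>C\<bar> * lapl.nrm u" if u: "u \<in> H_0_Laplace \<Omega>" for u
  proof -
    have "H1_inner u u \<le> \<bar>C\<bar> * lap_inner u u"
      using C[OF u] mult_right_mono[OF abs_ge_self[of C] lapl.ip_nonneg[OF u]] by linarith
    then show ?thesis
      by (simp add: h1.nrm_def lapl.nrm_def flip: real_sqrt_mult)
  qed
  have h1_cauchy: "\<exists>N. \<forall>m\<ge>N. \<forall>n\<ge>N. h1.nrm (\<lambda>x. s m x - s n x) < \<epsilon>" if "0 < \<epsilon>" for \<epsilon>
  proof -
    define K where "K = sqrt \<bar>C\<bar> + 1"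
    have K: "0 < K" by (simp add: K_def add_nonneg_pos)
    obtain N where N: "\<And>m n. m \<ge> N \<Longrightarrow> n \<ge> N \<Longrightarrow> lapl.nrm (\<lambda>x. s m x - s n x) < \<epsilon> / K"
      using cs K \<open>0 < \<epsilon>\<close> unfolding lapl.cauchy_def by (meson divide_pos_pos)
    have "h1.nrm (\<lambda>x. s m x - s n x) < \<epsilon>" if mn: "m \<ge> N" "n \<ge> N" for m n
    proof -
      have d: "(\<lambda>x. s m x - s n x) \<in> H_0_Laplace \<Omega>" using s by (intro lapl.diff_mem)
      have "h1.nrm (\<lambda>x. s m x - s n x) \<le> K * lapl.nrm (\<lambda>x. s m x - s n x)"
        using C'[OF d] lapl.nrm_nonneg[OF d] by (simp add: K_def algebra_simps)
      also have "\<dots> < \<epsilon>" using N[OF mn] K by (simp add: field_simps)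
      finally show ?thesis .
    qed
    then show ?thesis by blast
  qed
  have d: "(\<lambda>x. s m x - s n x) \<in> H1 \<Omega>" for m n using sH by (intro H1.diff_mem)
  have "L2.cauchy dx s"
    unfolding L2.cauchy_def using h1_cauchy H1_inner_bounds(1)[OF d] by (meson order.strict_trans1)
  then obtain u where u: "u \<in> L2 dx" "L2.converges dx s u"
    by (rule L2_cauchy_converges[of s, OF H1_L2[OF sH]])
  have "\<exists>g. g \<in> L2 dx \<and> L2.converges dx (\<lambda>n. weak_partial i (s n)) g" if i: "i \<in> Basis" for i
  proof -
    have "L2.nrm dx (\<lambda>x. weak_partial i (s m) x - weak_partial i (s n) x) \<le> h1.nrm (\<lambda>x. s m x - s n x)" for m n
      unfolding nrm_weak_partial_diff[OF sH sH i] using H1_inner_bounds[OF d] i by (meson order_trans)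
    then have "L2.cauchy dx (\<lambda>n. weak_partial i (s n))"
      unfolding L2.cauchy_def using h1_cauchy by (meson order.strict_trans1)
    then show ?thesis
      using L2_cauchy_converges[of "\<lambda>n. weak_partial i (s n)", OF weak_partial_L2[OF sH i]] by metis
  qed
  then have "\<forall>i. \<exists>g. i \<in> Basis \<longrightarrow> g \<in> L2 dx \<and> L2.converges dx (\<lambda>n. weak_partial i (s n)) g" by blast
  from choice[OF this] obtain g
    where "\<forall>i. i \<in> Basis \<longrightarrow> g i \<in> L2 dx \<and> L2.converges dx (\<lambda>n. weak_partial i (s n)) (g i)" by (rule exE)
  then have g: "\<And>i. i \<in> Basis \<Longrightarrow> g i \<in> L2 dx"
    "\<And>i. i \<in> Basis \<Longrightarrow> L2.converges dx (\<lambda>n. weak_partial i (s n)) (g i)" by auto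
  have "L2.cauchy dx (\<lambda>n. weak_laplacian \<Omega> (s n))"
    using cs lapl.cauchy_iff s by blast
  then obtain f where f: "f \<in> L2 dx" "L2.converges dx (\<lambda>n. weak_laplacian \<Omega> (s n)) f"
    by (rule L2_cauchy_converges[of "\<lambda>n. weak_laplacian \<Omega> (s n)", OF weak_laplacian_L2[OF s]])
  have test: "L2_inner dx u (partial i \<phi>) = - L2_inner dx (g i) \<phi>" if i: "i \<in> Basis" and \<phi>: "\<phi> \<in> C_c 1 \<Omega>" for i \<phi>
  proof (rule LIMSEQ_unique)
    show "(\<lambda>n. L2_inner dx (s n) (partial i \<phi>)) \<longlonglongrightarrow> L2_inner dx u (partial i \<phi>)"
      by (intro L2.ip_tendsto H1_L2 sH u partial_C_c_L2 i \<phi>)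
    show "(\<lambda>n. L2_inner dx (s n) (partial i \<phi>)) \<longlonglongrightarrow> - L2_inner dx (g i) \<phi>"
      unfolding weak_partial_tested[OF sH i \<phi>]
      by (intro tendsto_minus L2.ip_tendsto weak_partial_L2 sH g C_c_mem_L2[OF \<phi>] i)
  qed
  have uH: "u \<in> H1 \<Omega>" "\<And>i. i \<in> Basis \<Longrightarrow> AE x in dx. weak_partial i u x = g i x"
    using H1_I[OF u(1), of g] g(1) test by simp_all
  have "h1.converges s u"
  proof (rule h1_convergesI[OF sH uH(1) u(2)])
    fix i :: 'a assume i: "i \<in> Basis"
    show "L2.converges dx (\<lambda>n. weak_partial i (s n)) (weak_partial i u)"
      by (rule L2_converges_AE_cong[OF weak_partial_L2[OF sH i] g(1)[OF i] weak_partial_L2[OF uH(1) i] _ g(2)[OF i]])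
        (use uH(2)[OF i] in eventually_elim, simp)
  qed
  then have u0: "u \<in> H1_0 \<Omega>"
    by (rule H1_0_closed[OF H0_H1_0[OF s] uH(1)])
  have "is_weak_laplacian \<Omega> u f"
    unfolding is_weak_laplacian_iff
  proof (intro conjI ballI f(1))
    fix \<phi> assume \<phi>: "\<phi> \<in> C_c 2 \<Omega>"
    show "L2_inner dx u (classical_laplacian \<phi>) = L2_inner dx f \<phi>"
    proof (rule LIMSEQ_unique)
      show "(\<lambda>n. L2_inner dx (s n) (classical_laplacian \<phi>)) \<longlonglongrightarrow> L2_inner dx u (classical_laplacian \<phi>)"
        by (intro L2.ip_tendsto H1_L2 sH u classical_laplacian_L2 \<phi>)
      show "(\<lambda>n. L2_inner dx (s n) (classical_laplacian \<phi>)) \<longlonglongrightarrow> L2_inner dx f \<phi>"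
        unfolding weak_laplacian_tested[OF s \<phi>]
        by (intro L2.ip_tendsto weak_laplacian_L2 s f C_c_mem_L2[OF \<phi>])
    qed
  qed
  note wl = weak_laplacianI[OF u0 this]
  have "L2.converges dx (\<lambda>n. weak_laplacian \<Omega> (s n)) (weak_laplacian \<Omega> u)"
    by (rule L2_converges_AE_cong[OF weak_laplacian_L2[OF s] f(1) weak_laplacian_L2[OF wl(1)] _ f(2)])
      (use wl(2) in eventually_elim, simp)
  then have "lapl.converges s u"
    using lapl.converges_iff[of s u, OF s wl(1)] by blast
  then show "\<exists>p\<in>H_0_Laplace \<Omega>. lapl.converges s p" using wl(1) by blast
qed

lemma normal_derivative_compact:
  assumes u: "\<And>n. u n \<in> H_0_Laplace \<Omega>" and K: "\<And>n. lap_inner (u n) (u n) \<le> K"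
  shows "\<exists>r. strict_mono (r :: nat \<Rightarrow> nat) \<and> nd.cauchy (\<lambda>n. u (r n))"
proof -
  have "L2_norm dx (weak_laplacian \<Omega> (u n)) \<le> sqrt K" for n
    unfolding L2_nrm_eq[symmetric] L2.nrm_def using K by simp
  then obtain r g where r: "strict_mono (r :: nat \<Rightarrow> nat)" and g: "g \<in> L2 dS"
    and lim: "(\<lambda>n. L2_norm dS (\<lambda>x. normal_derivative \<Omega> (u (r n)) x - g x)) \<longlonglongrightarrow> 0"
    using B2 u unfolding B2_def by blast
  have "L2.converges dS (\<lambda>n. normal_derivative \<Omega> (u (r n))) g"
    using lim by (simp add: L2.converges_def L2_nrm_eq)
  then have "L2.cauchy dS (\<lambda>n. normal_derivative \<Omega> (u (r n)))"
    by (intro L2.converges_imp_cauchy[of _ dS g] normal_derivative_L2 u g)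
  then have "nd.cauchy (\<lambda>n. u (r n))"
    using nd.cauchy_iff[of "\<lambda>n. u (r n)"] u by blast
  then show ?thesis using r by blast
qed

end

section \<open>The first eigenvalue and the harmonic part of an eigenfunction\<close>

context bounded_open_set
begin

lemma L2_harmonic_iff:
  "h \<in> L2_harmonic \<Omega> \<longleftrightarrow> h \<in> L2 dx \<and> (\<forall>\<phi>\<in>C_c 2 \<Omega>. L2_inner dx h (classical_laplacian \<phi>) = 0)"
  by (simp add: L2_harmonic_def L2_inner_def)

lemma L2_harmonic_L2: "h \<in> L2_harmonic \<Omega> \<Longrightarrow> h \<in> L2 dx"
  by (simp add: L2_harmonic_iff)

text \<open>
  The orthogonal projection exists because harmonicity is a set of orthogonality conditions and hence
  preserved by limits in \<open>L\<^sup>2\<close>. The choice in \<^const>\<open>bergman_projection\<close> is used only through these two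
  properties.
\<close>

lemma bergman_projection:
  assumes f: "f \<in> L2 dx"
  shows "bergman_projection \<Omega> f \<in> L2_harmonic \<Omega>"
    and "h \<in> L2_harmonic \<Omega> \<Longrightarrow> L2_inner dx f h = L2_inner dx (bergman_projection \<Omega> f) h"
proof -
  have "function_space (L2_harmonic \<Omega>)"
    by unfold_locales
      (auto simp: L2_harmonic_iff L2.space_mem L2.ip_linear classical_laplacian_L2,
       simp add: L2_inner_def)
  then obtain s p where s: "\<And>n. s n \<in> L2_harmonic \<Omega>" and p: "p \<in> L2 dx"
    and sp: "L2.converges dx s p" and orth: "\<And>h. h \<in> L2_harmonic \<Omega> \<Longrightarrow> L2_inner dx (\<lambda>x. f x - p x) h = 0"
    using L2.orthogonal_projection[OF L2_complete _ _ f, of "L2_harmonic \<Omega>"] L2_harmonic_L2 by blast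
  have "L2_inner dx p (classical_laplacian \<phi>) = 0" if \<phi>: "\<phi> \<in> C_c 2 \<Omega>" for \<phi>
  proof (rule LIMSEQ_unique)
    show "(\<lambda>n. L2_inner dx (s n) (classical_laplacian \<phi>)) \<longlonglongrightarrow> L2_inner dx p (classical_laplacian \<phi>)"
      by (intro L2.ip_tendsto L2_harmonic_L2 s p sp classical_laplacian_L2 \<phi>)
    show "(\<lambda>n. L2_inner dx (s n) (classical_laplacian \<phi>)) \<longlonglongrightarrow> 0"
      using s \<phi> by (simp add: L2_harmonic_iff)
  qed
  then have "p \<in> L2_harmonic \<Omega>" using p by (simp add: L2_harmonic_iff)
  with orth have "\<exists>p. p \<in> L2_harmonic \<Omega> \<and> (\<forall>h\<in>L2_harmonic \<Omega>. (\<integral>x. (f x - p x) * h x \<partial>dx) = 0)"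
    by (auto simp: L2_inner_def)
  from someI_ex[OF this]
  have P: "bergman_projection \<Omega> f \<in> L2_harmonic \<Omega>"
    "\<And>h. h \<in> L2_harmonic \<Omega> \<Longrightarrow> L2_inner dx (\<lambda>x. f x - bergman_projection \<Omega> f x) h = 0"
    unfolding bergman_projection_def[symmetric] L2_inner_def by auto
  show "bergman_projection \<Omega> f \<in> L2_harmonic \<Omega>" by (rule P(1))
  show "L2_inner dx f h = L2_inner dx (bergman_projection \<Omega> f) h" if "h \<in> L2_harmonic \<Omega>"
    using P(2)[OF that] L2.ip_diff[OF f L2_harmonic_L2[OF P(1)] L2_harmonic_L2[OF that]] by simp
qed

lemma classical_laplacian_exp:
  fixes k :: 'a
  shows "classical_laplacian (\<lambda>x. exp (k \<bullet> x)) = (\<lambda>x. (k \<bullet> k) * exp (k \<bullet> x))"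
proof
  fix x :: 'a
  have "partial i (\<lambda>y. exp (k \<bullet> y)) = (\<lambda>y. (k \<bullet> i) * exp (k \<bullet> y))" for i :: 'a
    by (rule ext) (rule partial_exp_inner)
  moreover have "partial i (\<lambda>y. (k \<bullet> i) * exp (k \<bullet> y)) x = (k \<bullet> i) * ((k \<bullet> i) * exp (k \<bullet> x))" for i :: 'a
    by (rule partial_eqI) (intro has_derivative_mult_right has_derivative_exp_inner)
  ultimately show "classical_laplacian (\<lambda>x. exp (k \<bullet> x)) x = (k \<bullet> k) * exp (k \<bullet> x)"
    unfolding classical_laplacian_def
    by (subst euclidean_inner[of k k]) (simp add: sum_distrib_right mult.assoc)
qed

end

context B2_domain
begin

text \<open>
  The Poincare inequality gives \<open>1 \<le> C \<lambda>\<close>. If the normal derivative of \<open>e\<close> were zero, then \<open>e\<close> would satisfy the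
  eigenvalue equation against functions that do not vanish at the boundary, in particular against
  \<open>v = exp (k \<bullet> x)\<close> with \<open>\<Delta>v = |k|\<^sup>2 v\<close>. This gives \<open>(|k|\<^sup>2 + \<lambda>) \<integral> e v = 0\<close>, so \<open>e\<close> is orthogonal to all exponentials.
\<close>

lemma Dirichlet_eigenfunction:
  assumes e: "e \<in> H_0_Laplace \<Omega>" and norm: "L2_inner dx e e = 1"
    and eig: "\<And>v. v \<in> H1_0 \<Omega> \<Longrightarrow> grad_inner e v = lam * L2_inner dx e v"
  shows "0 < lam" and "AE x in dx. weak_laplacian \<Omega> e x = - lam * e x"
    and "nd_inner e e \<noteq> 0"
proof -
  note eL = H0_L2[OF e] and e0 = H0_H1_0[OF e]
  obtain C where C: "0 < C" "L2_inner dx e e \<le> C * grad_inner e e"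
    using Poincare_inequality e0 by blast
  then have "0 < C * lam" using eig[OF e0] norm by simp
  then show lam: "0 < lam" using C(1) by (simp add: zero_less_mult_iff)
  show wl: "AE x in dx. weak_laplacian \<Omega> e x = - lam * e x"
  proof (rule L2_eq_if_tested[where k = 2])
    fix \<phi> assume \<phi>: "\<phi> \<in> C_c 2 \<Omega>"
    show "L2_inner dx (weak_laplacian \<Omega> e) \<phi> = L2_inner dx (\<lambda>x. - lam * e x) \<phi>"
      using Green_H1_0[OF e C_c_2_H1_0[OF \<phi>]] eig[OF C_c_2_H1_0[OF \<phi>]]
        L2.ip_scale[OF eL C_c_mem_L2[OF \<phi>], of "- lam"]
        L2.ip_commute[OF C_c_mem_L2[OF \<phi>] weak_laplacian_L2[OF e]] by simp
  qed (use eL e in \<open>simp_all only: weak_laplacian_L2 L2.scale_mem\<close>)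
  show "nd_inner e e \<noteq> 0"
  proof
    assume "nd_inner e e = 0"
    then have nd0: "AE x in dS. normal_derivative \<Omega> e x = 0"
      using L2_inner_self_eq_0_iff[OF normal_derivative_L2[OF e]] by blast
    have "AE x in dx. e x = 0"
    proof (rule exp_integrals_determine_lebesgue)
      show "\<Omega> \<in> sets lebesgue" using open_domain by auto
      show "integrable dx e"
        using L2_mult_integrable[OF eL C_k_mem_L2[OF C_k_const[of 0 1]]] by simp
      show "compact (closure \<Omega>)" using bounded_domain by (simp add: compact_closure)
      show "e x = 0" if "x \<in> \<Omega> - closure \<Omega>" for x
        using that closure_subset by blast
      fix k :: 'a
      let ?e = "\<lambda>x. exp (k \<bullet> x)"
      have E: "?e \<in> L2 dS" "?e \<in> L2 dx"
        using trace_C_k[OF C_k_exp] C_k_mem_L2[OF C_k_exp] by (auto simp: is_trace_def)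
      have "L2_inner dS ?e (normal_derivative \<Omega> e) = L2_inner dS ?e (\<lambda>x. 0)"
        using E nd0 by (intro L2_inner_AE_cong normal_derivative_L2 e L2.zero_mem) auto
      also have "\<dots> = 0" by (simp add: L2_inner_def)
      finally have "0 = grad_inner e ?e + L2_inner dx ?e (weak_laplacian \<Omega> e)"
        using Green_trace[OF e trace_C_k[OF C_k_exp[of k]]] by simp
      also have "grad_inner e ?e = - ((k \<bullet> k) * L2_inner dx e ?e)"
        using grad_inner_test[OF e0 C_k_exp_inner[of 2 k]] L2.ip_scale_right[OF E(2) eL]
        by (simp add: classical_laplacian_exp)
      also have "L2_inner dx ?e (weak_laplacian \<Omega> e) = L2_inner dx ?e (\<lambda>x. - lam * e x)"
        using wl E eL by (intro L2_inner_AE_cong weak_laplacian_L2 e L2.scale_mem) auto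
      also have "\<dots> = - (lam * L2_inner dx e ?e)"
        using L2.ip_scale_right[OF eL E(2), of "- lam"] L2.ip_commute[OF E(2) eL] by simp
      finally have "(k \<bullet> k + lam) * L2_inner dx e ?e = 0" by (simp add: algebra_simps)
      moreover have "k \<bullet> k + lam \<noteq> 0"
        using lam inner_ge_zero[of k] by linarith
      ultimately show "(\<integral>x. e x * exp (k \<bullet> x) \<partial>dx) = 0"
        by (simp add: L2_inner_def)
    qed
    then show False using L2_inner_self_eq_0_iff[OF eL] norm by simp
  qed
qed

text \<open>
  The set of eigenvalues has a least element only if the normal derivative is not identically zero; the
  hypothesis on \<open>e\<close> ensures this. The least eigenvalue is \<open>1 / M\<close> for the constant \<open>M\<close> of
  \<open>compact_form_maximiser\<close>.
\<close>

lemma first_DBS_eigenvalue: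
  assumes e: "e \<in> H_0_Laplace \<Omega>" and nz: "nd_inner e e \<noteq> 0"
  shows "0 < first_DBS_eigenvalue \<Omega>"
    and "u \<in> H_0_Laplace \<Omega> \<Longrightarrow> first_DBS_eigenvalue \<Omega> * nd_inner u u \<le> lap_inner u u"
proof -
  have "\<exists>M>0. (\<forall>u\<in>H_0_Laplace \<Omega>. nd_inner u u \<le> M * lap_inner u u) \<and>
      (\<exists>b\<in>H_0_Laplace \<Omega>. nd_inner b b \<noteq> 0 \<and> (\<forall>v\<in>H_0_Laplace \<Omega>. M * lap_inner b v = nd_inner b v))"
  proof (rule compact_form_maximiser[where V = "H_0_Laplace \<Omega>" and a = lap_inner and d = nd_inner
        and w = e, OF lapl.semi_inner nd.semi_inner H0_complete _ e nz])
    fix u :: "nat \<Rightarrow> 'a \<Rightarrow> real" and K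
    assume "\<And>n. u n \<in> H_0_Laplace \<Omega>" "\<And>n. lap_inner (u n) (u n) \<le> K"
    then show "\<exists>r. strict_mono (r :: nat \<Rightarrow> nat) \<and> nd.cauchy (\<lambda>n. u (r n))"
      by (rule normal_derivative_compact[of u K])
  qed
  then obtain M b where M: "0 < M"
    and "\<forall>u\<in>H_0_Laplace \<Omega>. nd_inner u u \<le> M * lap_inner u u"
    and b: "b \<in> H_0_Laplace \<Omega>" "nd_inner b b \<noteq> 0"
    and "\<forall>v\<in>H_0_Laplace \<Omega>. M * lap_inner b v = nd_inner b v"
    by (elim exE conjE bexE) (rule that)
  then have bound: "\<And>u. u \<in> H_0_Laplace \<Omega> \<Longrightarrow> nd_inner u u \<le> M * lap_inner u u"
    and b_eq: "\<And>v. v \<in> H_0_Laplace \<Omega> \<Longrightarrow> M * lap_inner b v = nd_inner b v"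
    by simp_all
  have DBS_iff: "DBS_eigenvalue \<Omega> q \<longleftrightarrow> (\<exists>b\<in>H_0_Laplace \<Omega>. \<not> (AE x in dx. b x = 0) \<and>
      (\<forall>v\<in>H_0_Laplace \<Omega>. lap_inner b v = q * nd_inner b v))" for q
    by (simp add: DBS_eigenvalue_def L2_inner_def)
  have "\<not> (AE x in dx. b x = 0)"
  proof
    assume b0: "AE x in dx. b x = 0"
    have "is_weak_laplacian \<Omega> b (\<lambda>x. 0)"
      unfolding is_weak_laplacian_iff
    proof (intro conjI ballI L2.zero_mem)
      fix \<phi> assume "\<phi> \<in> C_c 2 \<Omega>"
      then have "L2_inner dx b (classical_laplacian \<phi>) = L2_inner dx (\<lambda>x. 0) (classical_laplacian \<phi>)"
        using b0 b(1) by (intro L2_inner_AE_cong H0_L2 classical_laplacian_L2 L2.zero_mem) auto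
      then show "L2_inner dx b (classical_laplacian \<phi>) = L2_inner dx (\<lambda>x. 0) \<phi>"
        by (simp add: L2_inner_def)
    qed
    from weak_laplacianI(2)[OF H0_H1_0[OF b(1)] this]
    have "lap_inner b b = 0"
      using L2_inner_self_eq_0_iff[OF weak_laplacian_L2[OF b(1)]] by blast
    then show False
      using bound[OF b(1)] b(2) nd.ip_nonneg[OF b(1)] by simp
  qed
  moreover have "\<forall>v\<in>H_0_Laplace \<Omega>. lap_inner b v = (1 / M) * nd_inner b v"
    using b_eq M by (auto simp: field_simps)
  ultimately have "DBS_eigenvalue \<Omega> (1 / M)"
    unfolding DBS_iff using b(1) by blast
  moreover have "1 / M \<le> q" if q: "DBS_eigenvalue \<Omega> q" for q
  proof -
    obtain c where c: "c \<in> H_0_Laplace \<Omega>" "\<not> (AE x in dx. c x = 0)"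
      and eq: "lap_inner c c = q * nd_inner c c"
      using q unfolding DBS_iff by blast
    have "lap_inner c c \<noteq> 0" using H0_eq_0_if_lap_inner_eq_0[OF c(1)] c(2) by blast
    then have pos: "0 < nd_inner c c"
      using eq nd.ip_nonneg[OF c(1)] by (cases "nd_inner c c = 0") auto
    \<comment> \<open>The Rayleigh quotient of the eigenfunction c is q.\<close>
    have "1 * nd_inner c c \<le> (M * q) * nd_inner c c"
      using bound[OF c(1)] eq by simp
    then have "1 \<le> M * q" using pos by (simp only: mult_le_cancel_right_pos)
    then show ?thesis using M by (simp add: field_simps)
  qed
  ultimately have q1: "first_DBS_eigenvalue \<Omega> = 1 / M"
    unfolding first_DBS_eigenvalue_def by (rule Least_equality)
  show "0 < first_DBS_eigenvalue \<Omega>" using M by (simp add: q1)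
  show "first_DBS_eigenvalue \<Omega> * nd_inner u u \<le> lap_inner u u" if "u \<in> H_0_Laplace \<Omega>"
    using bound[OF that] M by (simp add: q1 field_simps)
qed

text \<open>
  For every exponential \<open>v\<close>, \<open>\<integral> \<nabla>\<phi> \<bullet> \<nabla>v + v \<Delta>\<phi> = - \<integral> \<phi> \<Delta>v + \<integral> v \<Delta>\<phi> = 0\<close> by symmetry of the Laplacian.
\<close>

lemma C_c_2_normal_derivative:
  assumes \<phi>: "\<phi> \<in> C_c 2 \<Omega>"
  shows "nd_inner \<phi> \<phi> = 0"
proof -
  note H = C_c_2_H0[OF \<phi>]
  note wl = weak_laplacianI(2)[OF C_c_2_H1_0[OF \<phi>] C_c_2_weak_laplacian[OF \<phi>]]
  have "AE x in dS. normal_derivative \<Omega> \<phi> x = 0"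
  proof (rule normal_derivative_unique[OF H L2.zero_mem])
    fix k :: 'a
    let ?e = "\<lambda>x. exp (k \<bullet> x)"
    have E: "?e \<in> L2 dx" by (rule C_k_mem_L2[OF C_k_exp])
    have "L2_inner dx ?e (weak_laplacian \<Omega> \<phi>) = L2_inner dx ?e (classical_laplacian \<phi>)"
      using wl by (intro L2_inner_AE_cong E weak_laplacian_L2 H classical_laplacian_L2 \<phi>) auto
    also have "\<dots> = L2_inner dx (classical_laplacian \<phi>) ?e"
      by (intro L2.ip_commute E classical_laplacian_L2 \<phi>)
    also have "\<dots> = - grad_inner \<phi> ?e"
      using grad_inner_test[OF C_c_2_H1_0[OF \<phi>] C_k_exp_inner] classical_laplacian_symmetric[OF \<phi> C_k_exp_inner]
      by simp
    finally show "L2_inner dS ?e (\<lambda>x. 0) = grad_inner \<phi> ?e + L2_inner dx ?e (weak_laplacian \<Omega> \<phi>)"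
      by (simp add: L2_inner_def)
  qed
  then show ?thesis using L2_inner_self_eq_0_iff[OF normal_derivative_L2[OF H]] by blast
qed

text \<open>
  Let \<open>S\<close> consist of the Laplacians of functions with zero normal derivative, and let \<open>f = \<Delta>u - p\<close> with \<open>p\<close>
  the projection of \<open>\<Delta>u\<close> to the closure of \<open>S\<close>. As \<open>S\<close> contains \<open>\<Delta>\<phi>\<close> for all test functions \<open>\<phi>\<close>, \<open>f\<close> is harmonic,
  and \<open>\<parallel>f\<parallel>\<^sup>2 = \<integral> f \<Delta>u = \<integral> f P\<^sub>H \<Delta>u \<le> \<parallel>f\<parallel> \<parallel>P\<^sub>H \<Delta>u\<parallel>\<close>. Approximating \<open>p\<close> by elements \<open>\<Delta>z\<close> of \<open>S\<close> and applying the bound to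
  \<open>u - z\<close>, which has the same normal derivative as \<open>u\<close>, gives \<open>q \<parallel>D\<^sub>\<nu> u\<parallel>\<^sup>2 \<le> \<parallel>f\<parallel>\<^sup>2\<close>.
\<close>

lemma normal_derivative_le_harmonic_part:
  assumes u: "u \<in> H_0_Laplace \<Omega>" and q: "0 \<le> q"
    and bound: "\<And>v. v \<in> H_0_Laplace \<Omega> \<Longrightarrow> q * nd_inner v v \<le> lap_inner v v"
  shows "q * nd_inner u u \<le> (L2.nrm dx (bergman_projection \<Omega> (weak_laplacian \<Omega> u)))\<^sup>2"
proof -
  note uL = weak_laplacian_L2[OF u]
  define S where "S = {f \<in> L2 dx. \<exists>z\<in>H_0_Laplace \<Omega>. is_weak_laplacian \<Omega> z f \<and> nd_inner z z = 0}"
  have nd0: "nd_inner z v = 0" if "z \<in> H_0_Laplace \<Omega>" "v \<in> H_0_Laplace \<Omega>" "nd_inner z z = 0" for z v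
    using nd.Cauchy_Schwarz[OF that(1,2)] that(3) by simp
  have "function_space S"
  proof
    have "is_weak_laplacian \<Omega> (\<lambda>x. 0) (\<lambda>x. 0)"
      by (simp add: is_weak_laplacian_iff L2.zero_mem) (simp add: L2_inner_def)
    then show "(\<lambda>x. 0) \<in> S"
      using C_c_2_normal_derivative[OF C_c.zero_mem] lapl.zero_mem by (auto simp: S_def L2.zero_mem)
  next
    fix f g assume "f \<in> S" "g \<in> S"
    then obtain y z where "f \<in> L2 dx" "g \<in> L2 dx"
      and y: "y \<in> H_0_Laplace \<Omega>" "is_weak_laplacian \<Omega> y f" "nd_inner y y = 0"
      and z: "z \<in> H_0_Laplace \<Omega>" "is_weak_laplacian \<Omega> z g" "nd_inner z z = 0"
      by (auto simp: S_def)
    moreover have "nd_inner (\<lambda>x. y x + z x) (\<lambda>x. y x + z x) = 0"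
      using y z nd0 by (simp add: nd.ip_linear lapl.add_mem)
    ultimately show "(\<lambda>x. f x + g x) \<in> S"
      unfolding S_def using is_weak_laplacian_add[OF H0_L2[OF y(1)] H0_L2[OF z(1)] y(2) z(2)]
      by (auto intro!: L2.add_mem bexI[of _ "\<lambda>x. y x + z x"] lapl.add_mem)
  next
    fix f c assume "f \<in> S"
    then obtain y where "f \<in> L2 dx"
      and y: "y \<in> H_0_Laplace \<Omega>" "is_weak_laplacian \<Omega> y f" "nd_inner y y = 0"
      by (auto simp: S_def)
    moreover have "nd_inner (\<lambda>x. c * y x) (\<lambda>x. c * y x) = 0"
      using y by (simp add: nd.ip_linear lapl.scale_mem)
    ultimately show "(\<lambda>x. c * f x) \<in> S"
      unfolding S_def using is_weak_laplacian_scale[OF H0_L2[OF y(1)] y(2)]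
      by (auto intro!: L2.scale_mem bexI[of _ "\<lambda>x. c * y x"] lapl.scale_mem)
  qed
  moreover have SL: "S \<subseteq> L2 dx" by (auto simp: S_def)
  ultimately obtain s p where s: "\<And>n. s n \<in> S" and p: "p \<in> L2 dx" and sp: "L2.converges dx s p"
    and orth: "\<And>h. h \<in> S \<Longrightarrow> L2_inner dx (\<lambda>x. weak_laplacian \<Omega> u x - p x) h = 0"
    using L2.orthogonal_projection[OF L2_complete _ _ uL, of S] by blast
  have sL: "s n \<in> L2 dx" for n using s SL by blast
  define f where "f x = weak_laplacian \<Omega> u x - p x" for x
  have f: "f \<in> L2 dx" unfolding f_def[abs_def] by (rule L2.diff_mem[OF uL p])
  have orth: "L2_inner dx f h = 0" if "h \<in> S" for h
    using orth[OF that] by (simp add: f_def[abs_def])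
  have "classical_laplacian \<phi> \<in> S" if "\<phi> \<in> C_c 2 \<Omega>" for \<phi>
    using that C_c_2_H0 C_c_2_weak_laplacian C_c_2_normal_derivative classical_laplacian_L2
    by (auto simp: S_def)
  then have harm: "f \<in> L2_harmonic \<Omega>"
    using f orth by (simp add: L2_harmonic_iff)
  have "L2_inner dx f p = 0"
  proof (rule LIMSEQ_unique)
    show "(\<lambda>n. L2_inner dx (s n) f) \<longlonglongrightarrow> L2_inner dx f p"
      using L2.ip_tendsto[OF sL p f sp] L2.ip_commute[OF p f] by simp
    show "(\<lambda>n. L2_inner dx (s n) f) \<longlonglongrightarrow> 0"
      using orth[OF s] L2.ip_commute[OF sL f] by simp
  qed
  then have "L2_inner dx f f = L2_inner dx (weak_laplacian \<Omega> u) f"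
    using L2.ip_diff_right[OF uL p f] L2.ip_commute[OF uL f] by (simp add: f_def[abs_def])
  also have "\<dots> = L2_inner dx (bergman_projection \<Omega> (weak_laplacian \<Omega> u)) f"
    by (rule bergman_projection(2)[OF uL harm])
  also have "\<dots> \<le> L2.nrm dx (bergman_projection \<Omega> (weak_laplacian \<Omega> u)) * L2.nrm dx f"
    using L2.abs_ip_le[OF L2_harmonic_L2[OF bergman_projection(1)[OF uL]] f] by linarith
  finally have "L2.nrm dx f * L2.nrm dx f \<le> L2.nrm dx (bergman_projection \<Omega> (weak_laplacian \<Omega> u)) * L2.nrm dx f"
    by (simp add: L2.nrm_power2[OF f, symmetric] power2_eq_square)
  then have f_le: "L2.nrm dx f \<le> L2.nrm dx (bergman_projection \<Omega> (weak_laplacian \<Omega> u))"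
    using L2.nrm_nonneg[OF f] L2.nrm_nonneg[OF L2_harmonic_L2[OF bergman_projection(1)[OF uL]]]
    by (cases "L2.nrm dx f = 0") auto
  have approx: "q * nd_inner u u \<le> L2_inner dx (\<lambda>x. weak_laplacian \<Omega> u x - s n x) (\<lambda>x. weak_laplacian \<Omega> u x - s n x)" for n
  proof -
    obtain z where z: "z \<in> H_0_Laplace \<Omega>" "is_weak_laplacian \<Omega> z (s n)" "nd_inner z z = 0"
      using s[of n] by (auto simp: S_def)
    have d: "(\<lambda>x. u x - z x) \<in> H_0_Laplace \<Omega>" by (rule lapl.diff_mem[OF u z(1)])
    have "nd_inner u u = nd_inner (\<lambda>x. u x - z x) (\<lambda>x. u x - z x)"
      using nd0[OF z(1) u z(3)] nd.ip_commute[OF u z(1)] z(3) u z(1) by (simp add: nd.ip_linear lapl.diff_mem)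
    then have "q * nd_inner u u \<le> lap_inner (\<lambda>x. u x - z x) (\<lambda>x. u x - z x)"
      using bound[OF d] by simp
    also have "\<dots> = L2_inner dx (\<lambda>x. weak_laplacian \<Omega> u x - s n x) (\<lambda>x. weak_laplacian \<Omega> u x - s n x)"
    proof -
      have "AE x in dx. weak_laplacian \<Omega> (\<lambda>x. u x - z x) x = weak_laplacian \<Omega> u x - s n x"
        using lapl.T_diff[OF u z(1)] weak_laplacianI(2)[OF H0_H1_0[OF z(1)] z(2)]
        by eventually_elim simp
      then show ?thesis
        by (intro L2_inner_AE_cong weak_laplacian_L2 d L2.diff_mem uL sL)
    qed
    finally show ?thesis .
  qed
  have "L2.converges dx (\<lambda>n x. weak_laplacian \<Omega> u x - s n x) f"
    using sp L2.nrm_diff_commute[OF sL p] by (simp add: L2.converges_def f_def)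
  from L2.ip_self_tendsto[OF L2.diff_mem[OF uL sL] f this]
  have "q * nd_inner u u \<le> L2_inner dx f f"
    using approx by (intro LIMSEQ_le_const) auto
  also have "\<dots> \<le> (L2.nrm dx (bergman_projection \<Omega> (weak_laplacian \<Omega> u)))\<^sup>2"
    unfolding L2.nrm_power2[OF f, symmetric] using f_le L2.nrm_nonneg[OF f] by (intro power_mono)
  finally show ?thesis .
qed

lemma nrm_bergman_projection_scaled:
  assumes f: "f \<in> L2 dx" and g: "g \<in> L2 dx" and eq: "AE x in dx. g x = c * f x"
  shows "(L2.nrm dx (bergman_projection \<Omega> g))\<^sup>2 = (L2.nrm dx (bergman_projection \<Omega> f))\<^sup>2 * c\<^sup>2"
proof -
  let ?P = "bergman_projection \<Omega> f" and ?Q = "bergman_projection \<Omega> g"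
  note P = bergman_projection[OF f] and Q = bergman_projection[OF g]
  note PL = L2_harmonic_L2[OF P(1)] and QL = L2_harmonic_L2[OF Q(1)]
  have gc: "L2_inner dx ?Q h = c * L2_inner dx ?P h" if h: "h \<in> L2_harmonic \<Omega>" for h
  proof -
    have "L2_inner dx g h = L2_inner dx (\<lambda>x. c * f x) h"
      using eq by (intro L2_inner_AE_cong f g L2.scale_mem L2_harmonic_L2 h) auto
    then show ?thesis
      using P(2)[OF h] Q(2)[OF h] L2.ip_scale[OF f L2_harmonic_L2[OF h]] by simp
  qed
  show ?thesis
    using gc[OF Q(1)] gc[OF P(1)] L2.ip_commute[OF PL QL]
    unfolding L2.nrm_power2[OF PL] L2.nrm_power2[OF QL] by (simp add: power2_eq_square)
qed

end

theorem theorem8p1: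
  fixes \<Omega> :: "'a::euclidean_space set" and e :: "'a \<Rightarrow> real" and lam :: real
  assumes "DIM('a) \<ge> 2"
    and "region \<Omega>"
    and "B2 \<Omega>"
    and "e \<in> H_0_Laplace \<Omega>"
    and "(\<integral>x. (e x)\<^sup>2 \<partial>lebesgue_on \<Omega>) = 1"
    and "\<forall>v\<in>H1_0 \<Omega>. (\<integral>x. (weak_gradient \<Omega> e x \<bullet> weak_gradient \<Omega> v x - lam * e x * v x)
                        \<partial>lebesgue_on \<Omega>) = 0"
  shows "(\<integral>x. \<bar>normal_derivative \<Omega> e x\<bar>\<^sup>2 \<partial>surface_measure \<Omega>)
           \<le> (L2_norm (lebesgue_on \<Omega>) (bergman_projection \<Omega> e))\<^sup>2 / first_DBS_eigenvalue \<Omega> * lam\<^sup>2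
       \<and> (L2_norm (lebesgue_on \<Omega>) (bergman_projection \<Omega> e))\<^sup>2 / first_DBS_eigenvalue \<Omega> * lam\<^sup>2
           \<le> 1 / first_DBS_eigenvalue \<Omega> * lam\<^sup>2"
proof -
  interpret B2_domain \<Omega>
    using assms(2,3) by unfold_locales (auto simp: region_def B2_def B1_def)
  note e = assms(4)
  note eL = H0_L2[OF e]
  have norm: "L2_inner dx e e = 1"
    using assms(5) by (simp add: L2_inner_def power2_eq_square)
  have eig: "grad_inner e v = lam * L2_inner dx e v" if v: "v \<in> H1_0 \<Omega>" for v
  proof -
    have "(\<integral>x. (weak_gradient \<Omega> e x \<bullet> weak_gradient \<Omega> v x - lam * (e x * v x)) \<partial>dx)
        = grad_inner e v - lam * L2_inner dx e v"
      using weak_gradient_inner_integral[OF H0_H1[OF e] H1_0_H1[OF v]]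
        L2_mult_integrable[OF eL H1_L2[OF H1_0_H1[OF v]]]
      by (simp add: L2_inner_def)
    then show ?thesis using assms(6) v by (simp add: mult.assoc)
  qed
  note eigenfunction = Dirichlet_eigenfunction[OF e norm eig]
  define q where "q = first_DBS_eigenvalue \<Omega>"
  have q: "0 < q" "\<And>u. u \<in> H_0_Laplace \<Omega> \<Longrightarrow> q * nd_inner u u \<le> lap_inner u u"
    unfolding q_def using first_DBS_eigenvalue[OF e eigenfunction(3)] by auto
  let ?P = "bergman_projection \<Omega> e"
  have "q * nd_inner e e \<le> (L2.nrm dx (bergman_projection \<Omega> (weak_laplacian \<Omega> e)))\<^sup>2"
    using q by (intro normal_derivative_le_harmonic_part e) auto
  also have "\<dots> = (L2.nrm dx ?P)\<^sup>2 * lam\<^sup>2"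
    using nrm_bergman_projection_scaled[OF eL weak_laplacian_L2[OF e] eigenfunction(2)] by simp
  finally have main: "nd_inner e e \<le> (L2.nrm dx ?P)\<^sup>2 / q * lam\<^sup>2"
    using q(1) by (simp add: field_simps)
  note P = bergman_projection[OF eL]
  note PL = L2_harmonic_L2[OF P(1)]
  have "(L2.nrm dx ?P)\<^sup>2 = L2_inner dx e ?P"
    using P(2)[OF P(1)] by (simp add: L2.nrm_power2[OF PL])
  then have "((L2.nrm dx ?P)\<^sup>2)\<^sup>2 \<le> 1 * (L2.nrm dx ?P)\<^sup>2"
    using L2.Cauchy_Schwarz[OF eL PL] norm by (simp add: L2.nrm_power2[OF PL])
  then have "(L2.nrm dx ?P)\<^sup>2 \<le> 1"
    using zero_le_power2[of "L2.nrm dx ?P"] mult_right_le_imp_le[of "(L2.nrm dx ?P)\<^sup>2" "(L2.nrm dx ?P)\<^sup>2" 1]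
    unfolding power2_eq_square[of "(L2.nrm dx ?P)\<^sup>2"] by (cases "(L2.nrm dx ?P)\<^sup>2 = 0") linarith+
  then have "(L2.nrm dx ?P)\<^sup>2 / q * lam\<^sup>2 \<le> 1 / q * lam\<^sup>2"
    using q(1) by (intro mult_right_mono divide_right_mono) auto
  with main show ?thesis
    by (simp add: q_def L2_nrm_eq L2_inner_def power2_eq_square[of "normal_derivative \<Omega> e _"])
qed

end
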